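(* The operator $\mathscr{A}$ is a minimal self-adjoint dilation of $L$; that is, $\mathscr{A}$ is a self-adjoint operator in $\mathscr{H}\supset\mathcal{H}$ such that $$P_{\mathcal H}(\mathscr{A}-zI)^{-1}\big|_{\mathcal H}=(L-zI)^{-1}\qquad\forall z\in\mathbb{C}_-,$$ and the closed linear span of $\bigcup_{z\in\mathbb{C}\setminus\mathbb{R}}(\mathscr{A}-zI)^{-1}\mathcal{H}$ is the whole of $\mathscr{H}$.
   Context: Setting. Let $\mathcal H$ be a separable Hilbert space, $A_0$ a self-adjoint operator in $\mathcal H$ with $0\in\rho(A_0)$, $\mathcal E$ an auxiliary Hilbert space, $\Pi:\mathcal E\to\mathcal H$ a bounded operator with $\operatorname{dom}(A_0)\cap\operatorname{ran}(\Pi)=\{0\}$ and $\ker(\Pi)=\{0\}$, and $\Lambda$ a (possibly unbounded) self-adjoint operator in $\mathcal E$. Inner products are linear in the first argument. Define operators $A,\Gamma_0$ on $\operatorname{dom}(A)=\operatorname{dom}(\Gamma_0):=\operatorname{dom}(A_0)\dotplus\operatorname{ran}(\Pi)$ by $A(A_0^{-1}f+\Pi\phi):=f$, $\Gamma_0(A_0^{-1}f+\Pi\phi):=\phi$ ($f\in\mathcal H$, $\phi\in\mathcal E$), and $\Gamma_1$ on $\operatorname{dom}(\Gamma_1):=\operatorname{dom}(A_0)\dotplus\Pi\operatorname{dom}(\Lambda)$ by $\Gamma_1(A_0^{-1}f+\Pi\phi):=\Pi^*f+\Lambda\phi$ ($f\in\mathcal H$, $\phi\in\operatorname{dom}(\Lambda)$).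 For $z\in\rho(A_0)$ put $\gamma(z):=(I-zA_0^{-1})^{-1}\Pi$ and $M(z):=\Gamma_1\gamma(z)=\Lambda+z\Pi^*(I-zA_0^{-1})^{-1}\Pi$ with $\operatorname{dom}(M(z))=\operatorname{dom}(\Lambda)$. The operator $L$ is the restriction of $A$ to $\operatorname{dom}(L)=\{u\in\operatorname{dom}(\Gamma_1):\Gamma_1u=\mathrm{i}\Gamma_0u\}$; equivalently, for $z\in\mathbb C_-$, $(L-zI)^{-1}=(A_0-zI)^{-1}-\gamma(z)(M(z)-\mathrm{i}I)^{-1}\gamma(\bar z)^*$. It is maximal dissipative: $\operatorname{Im}\langle Lf,f\rangle\ge 0$ on $\operatorname{dom}(L)$ and $\mathbb C_-\subset\rho(L)$. Dilation space and operator. $\mathscr H:=L^2(\mathbb R_-,\mathcal E)\oplus\mathcal H\oplus L^2(\mathbb R_+,\mathcal E)$, where $\mathcal H$ is identified with $\{0\}\oplus\mathcal H\oplus\{0\}$ and $P_{\mathcal H}$ is the orthogonal projection of $\mathscr H$ onto it. The operator $\mathscr A$ in $\mathscr H$ has domain $$\operatorname{dom}(\mathscr A):=\{(v_-,u,v_+)^\top\in\mathscr H:\ v_\pm\in W^1_2(\mathbb R_\pm,\mathcal E),\ u\in\operatorname{dom}(\Gamma_1),\ \Gamma_1u+\mathrm{i}\Gamma_0u=\sqrt2\,v_+(0),\ \Gamma_1u-\mathrm{i}\Gamma_0u=\sqrt2\,v_-(0)\},$$ where $W^1_2(\mathbb R_\pm,\mathcal E)$ are the Sobolev spaces of $\mathcal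 E$-valued functions, and acts as $\mathscr A(v_-,u,v_+)^\top:=(\mathrm{i}v_-',Au,\mathrm{i}v_+')^\top$. *)

theory Defs
  imports "HOL-Analysis.Analysis"
begin

section \<open>Complex Hilbert spaces\<close>

text \<open>The library only has real inner product spaces. A complex inner product space is a
  real one with a compatible complex structure; its sesquilinear form is linear in the first
  argument, and its real part is the real inner product that defines norm and topology.\<close>

class complex_inner = real_inner +
  fixes scaleC :: "complex \<Rightarrow> 'a \<Rightarrow> 'a"  (infixr \<open>*\<^sub>C\<close> 75)
    and cinner :: "'a \<Rightarrow> 'a \<Rightarrow> complex"
  assumes scaleC_add_right: "c *\<^sub>C (x + y) = c *\<^sub>C x + c *\<^sub>C y"
    and scaleC_add_left: "(c + d) *\<^sub>C x = c *\<^sub>C x + d *\<^sub>C x"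
    and scaleC_scaleC: "c *\<^sub>C d *\<^sub>C x = (c * d) *\<^sub>C x"
    and scaleC_of_real: "complex_of_real r *\<^sub>C x = r *\<^sub>R x"
    and cinner_add_left: "cinner (x + y) z = cinner x z + cinner y z"
    and cinner_scaleC_left: "cinner (c *\<^sub>C x) y = c * cinner x y"
    and cinner_commute: "cinner x y = cnj (cinner y x)"
    and Re_cinner: "Re (cinner x y) = inner x y"

class complex_hilbert = complex_inner + complete_space
begin
subclass banach ..
end

lemma cinner_self: "cinner x x = complex_of_real ((norm x)\<^sup>2)"
  for x :: "'a::complex_inner"
proof -
  have "cinner x x = cnj (cinner x x)" by (rule cinner_commute)
  then have "Im (cinner x x) = 0" by (metis cnj.simps(2) equal_neg_zero)
  then show ?thesis by (simp add: complex_eq_iff Re_cinner power2_norm_eq_inner)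
qed

lemma norm_scaleC: "norm (c *\<^sub>C x) = cmod c * norm x"
  for x :: "'a::complex_inner"
proof -
  have "complex_of_real ((norm (c *\<^sub>C x))\<^sup>2) = c * cinner x (c *\<^sub>C x)"
    by (metis cinner_self cinner_scaleC_left)
  also have "\<dots> = c * cnj c * cinner x x"
    by (subst cinner_commute) (simp add: cinner_scaleC_left cinner_commute[of x x, symmetric])
  also have "\<dots> = complex_of_real ((cmod c * norm x)\<^sup>2)"
    by (simp add: cinner_self complex_mult_cnj cmod_power2 power_mult_distrib)
  finally have "(norm (c *\<^sub>C x))\<^sup>2 = (cmod c * norm x)\<^sup>2"
    using of_real_eq_iff by blast
  then show ?thesis by (simp add: power2_eq_iff_nonneg)
qed

lemma cmod_cinner_le: "cmod (cinner x y) \<le> norm x * norm y"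
  for x y :: "'a::complex_inner"
proof (cases "cinner x y = 0")
  case False
  define c where "c = cnj (cinner x y) / cmod (cinner x y)"
  have c: "cmod c = 1" using False by (simp add: c_def norm_divide)
  have "c * cinner x y = complex_of_real ((cmod (cinner x y))\<^sup>2) / cmod (cinner x y)"
    unfolding c_def complex_norm_square by (simp add: mult.commute)
  then have "cinner (c *\<^sub>C x) y = cmod (cinner x y)"
    using False by (simp add: cinner_scaleC_left power2_eq_square)
  then have "cmod (cinner x y) = inner (c *\<^sub>C x) y"
    by (metis Re_complex_of_real Re_cinner)
  also have "\<dots> \<le> norm (c *\<^sub>C x) * norm y" by (rule norm_cauchy_schwarz)
  finally show ?thesis by (simp add: norm_scaleC c)
qed simp

lemma cinner_add_right: "cinner z (x + y) = cinner z x + cinner z y"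
  for x :: "'a::complex_inner"
  by (metis cinner_commute cinner_add_left complex_cnj_add)

lemma cinner_scaleC_right: "cinner x (c *\<^sub>C y) = cnj c * cinner x y"
  for x :: "'a::complex_inner"
  by (metis cinner_commute cinner_scaleC_left complex_cnj_mult)

lemma bounded_bilinear_cinner:
  "bounded_bilinear (cinner :: 'a::complex_inner \<Rightarrow> 'a \<Rightarrow> complex)"
proof (rule bounded_bilinear.intro)
  fix r :: real and x y :: 'a
  show "cinner (r *\<^sub>R x) y = r *\<^sub>R cinner x y"
    by (metis cinner_scaleC_left scaleC_of_real scaleR_conv_of_real)
  show "cinner x (r *\<^sub>R y) = r *\<^sub>R cinner x y"
    by (metis cinner_scaleC_right scaleC_of_real scaleR_conv_of_real complex_cnj_complex_of_real)
  show "\<exists>K. \<forall>a b :: 'a. norm (cinner a b) \<le> norm a * norm b * K"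
    by (rule exI[of _ 1]) (simp add: cmod_cinner_le)
qed (simp_all add: cinner_add_left cinner_add_right)

lemma bounded_linear_scaleC: "bounded_linear (\<lambda>x. c *\<^sub>C x :: 'a::complex_inner)"
proof (rule bounded_linear_intro)
  show "c *\<^sub>C r *\<^sub>R x = r *\<^sub>R c *\<^sub>C x" for r and x :: 'a
    by (metis scaleC_of_real scaleC_scaleC mult.commute)
  show "norm (c *\<^sub>C x) \<le> norm x * cmod c" for x :: 'a
    by (simp add: norm_scaleC mult.commute)
qed (simp add: scaleC_add_right)

instantiation prod :: (complex_inner, complex_inner) complex_inner
begin

definition scaleC_prod :: "complex \<Rightarrow> 'a \<times> 'b \<Rightarrow> 'a \<times> 'b" where
  "scaleC_prod c p = (c *\<^sub>C fst p, c *\<^sub>C snd p)"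

definition cinner_prod :: "'a \<times> 'b \<Rightarrow> 'a \<times> 'b \<Rightarrow> complex" where
  "cinner_prod p q = cinner (fst p) (fst q) + cinner (snd p) (snd q)"

instance
proof
  fix x y :: "'a \<times> 'b"
  show "cinner x y = cnj (cinner y x)"
    by (simp add: cinner_prod_def cinner_commute[symmetric])
qed (auto simp: scaleC_prod_def cinner_prod_def scaleC_add_right scaleC_add_left scaleC_scaleC
    scaleC_of_real cinner_add_left cinner_scaleC_left Re_cinner inner_prod_def prod_eq_iff
    algebra_simps)

end

instance prod :: (complex_hilbert, complex_hilbert) complex_hilbert ..

section \<open>Square integrable vector-valued functions\<close>

text \<open>Strong (Bochner) measurability; unlike Borel measurability it needs no separability
  assumption on the target space.\<close>

definition strongly_measurable :: "'a measure \<Rightarrow> ('a \<Rightarrow> 'b::real_normed_vector) \<Rightarrow> bool" where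
  "strongly_measurable M f \<longleftrightarrow>
     (\<exists>s. (\<forall>n. simple_function M (s n)) \<and> (\<forall>x\<in>space M. (\<lambda>n. s n x) \<longlonglongrightarrow> f x))"

definition square_integrable :: "'a measure \<Rightarrow> ('a \<Rightarrow> 'b::real_normed_vector) \<Rightarrow> bool" where
  "square_integrable M f \<longleftrightarrow>
     strongly_measurable M f \<and> integrable M (\<lambda>x. (norm (f x))\<^sup>2)"

lemma strongly_measurable_compose:
  assumes "strongly_measurable M f" "\<And>x. isCont h x"
  shows "strongly_measurable M (\<lambda>x. h (f x))"
proof -
  obtain s where s: "\<And>n. simple_function M (s n)" "\<And>x. x \<in> space M \<Longrightarrow> (\<lambda>n. s n x) \<longlonglongrightarrow> f x"
    using assms(1) unfolding strongly_measurable_def by blast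
  show ?thesis
    unfolding strongly_measurable_def
    by (rule exI[of _ "\<lambda>n x. h (s n x)"])
       (auto intro!: simple_function_compose1[OF s(1)] isCont_tendsto_compose[OF assms(2)] s(2))
qed

lemma strongly_measurable_add:
  assumes "strongly_measurable M f" "strongly_measurable M g"
  shows "strongly_measurable M (\<lambda>x. f x + g x)"
proof -
  obtain s where s: "\<And>n. simple_function M (s n)" "\<And>x. x \<in> space M \<Longrightarrow> (\<lambda>n. s n x) \<longlonglongrightarrow> f x"
    using assms(1) unfolding strongly_measurable_def by blast
  obtain t where t: "\<And>n. simple_function M (t n)" "\<And>x. x \<in> space M \<Longrightarrow> (\<lambda>n. t n x) \<longlonglongrightarrow> g x"
    using assms(2) unfolding strongly_measurable_def by blast
  show ?thesis
    unfolding strongly_measurable_def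
    by (rule exI[of _ "\<lambda>n x. s n x + t n x"])
       (auto intro!: simple_function_compose2[OF s(1) t(1)] tendsto_add s(2) t(2))
qed

lemma strongly_measurable_const: "strongly_measurable M (\<lambda>_. c)"
  unfolding strongly_measurable_def by (rule exI[of _ "\<lambda>_ _. c"]) simp

lemma borel_measurable_bilinear:
  fixes h :: "'b::real_normed_vector \<Rightarrow> 'c::real_normed_vector \<Rightarrow> 'd::metric_space"
  assumes "strongly_measurable M f" "strongly_measurable M g"
    and h: "\<And>X Y x y. X \<longlonglongrightarrow> x \<Longrightarrow> Y \<longlonglongrightarrow> y \<Longrightarrow> (\<lambda>n::nat. h (X n) (Y n)) \<longlonglongrightarrow> h x y"
  shows "(\<lambda>x. h (f x) (g x)) \<in> borel_measurable M"
proof -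
  obtain s where s: "\<And>n. simple_function M (s n)" "\<And>x. x \<in> space M \<Longrightarrow> (\<lambda>n. s n x) \<longlonglongrightarrow> f x"
    using assms(1) unfolding strongly_measurable_def by blast
  obtain t where t: "\<And>n. simple_function M (t n)" "\<And>x. x \<in> space M \<Longrightarrow> (\<lambda>n. t n x) \<longlonglongrightarrow> g x"
    using assms(2) unfolding strongly_measurable_def by blast
  show ?thesis
    by (rule borel_measurable_LIMSEQ_metric[where f="\<lambda>n x. h (s n x) (t n x)"])
       (auto intro!: borel_measurable_simple_function simple_function_compose2[OF s(1) t(1)]
          h s(2) t(2))
qed

lemma borel_measurable_norm_strong:
  assumes "strongly_measurable M f"
  shows "(\<lambda>x. norm (f x)) \<in> borel_measurable M"
  by (rule borel_measurable_bilinear[OF assms assms, where h="\<lambda>x y. norm x"])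
     (rule tendsto_norm)

lemma strongly_measurable_uminus:
  "strongly_measurable M f \<Longrightarrow> strongly_measurable M (\<lambda>x. - f x)"
  by (rule strongly_measurable_compose) auto

lemma strongly_measurable_diff:
  "strongly_measurable M f \<Longrightarrow> strongly_measurable M g \<Longrightarrow> strongly_measurable M (\<lambda>x. f x - g x)"
  using strongly_measurable_add[of M f "\<lambda>x. - g x"] strongly_measurable_uminus[of M g] by simp

lemma strongly_measurable_limit:
  fixes f :: "nat \<Rightarrow> 'a \<Rightarrow> 'b::real_normed_vector"
  assumes f: "\<And>n. strongly_measurable M (f n)"
    and lim: "\<And>x. x \<in> space M \<Longrightarrow> (\<lambda>n. f n x) \<longlonglongrightarrow> g x"
  shows "strongly_measurable M g"
proof (cases "space M = {}")
  case True
  then show ?thesis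
    unfolding strongly_measurable_def
    by (intro exI[of _ "\<lambda>_ _. 0"]) simp
next
  case False
  have "\<exists>s. \<forall>n. (\<forall>k. simple_function M (s n k)) \<and> (\<forall>x\<in>space M. (\<lambda>k. s n k x) \<longlonglongrightarrow> f n x)"
    using f unfolding strongly_measurable_def by (intro choice) blast
  then obtain s where s: "\<And>n k. simple_function M (s n k)"
      "\<And>n x. x \<in> space M \<Longrightarrow> (\<lambda>k. s n k x) \<longlonglongrightarrow> f n x"
    by blast
  define D where "D = (\<Union>n k. s n k ` space M)"
  have cD: "countable D"
    unfolding D_def
    by (intro countable_UN countableI_type countable_finite simple_functionD(1)[OF s(1)])
  have neD: "D \<noteq> {}" using False by (auto simp: D_def)
  define d where "d = from_nat_into D"
  have rd: "range d = D" unfolding d_def by (rule range_from_nat_into[OF neD cD])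
  have dense: "\<exists>k. norm (g x - d k) < e" if x: "x \<in> space M" and e: "e > 0" for x e
  proof -
    obtain n where n: "dist (f n x) (g x) < e/2"
      using LIMSEQ_D[OF lim[OF x], of "e/2"] e by (auto simp: dist_norm)
    obtain k where k: "dist (s n k x) (f n x) < e/2"
      using LIMSEQ_D[OF s(2)[OF x, of n], of "e/2"] e by (auto simp: dist_norm)
    have "s n k x \<in> range d" unfolding rd D_def using x by blast
    then obtain j where j: "s n k x = d j" by blast
    have "norm (g x - d j) = dist (d j) (g x)" by (simp add: dist_norm norm_minus_commute)
    also have "\<dots> < e" using dist_triangle_lt[of "d j" "f n x" "g x" e] n k j
      using dist_triangle_half_l dist_commute by metis
    finally show ?thesis by blast
  qed
  have meas: "(\<lambda>x. norm (g x - d k)) \<in> borel_measurable M" for k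
  proof (rule borel_measurable_LIMSEQ_real[where u="\<lambda>n x. norm (f n x - d k)"])
    show "(\<lambda>n. norm (f n x - d k)) \<longlonglongrightarrow> norm (g x - d k)" if "x \<in> space M" for x
      by (intro tendsto_intros lim that)
    show "(\<lambda>x. norm (f n x - d k)) \<in> borel_measurable M" for n
      by (intro borel_measurable_norm_strong strongly_measurable_diff f strongly_measurable_const)
  qed
  define P where "P = (\<lambda>n x k. k \<le> n \<and> (\<forall>j\<le>n. norm (g x - d k) \<le> norm (g x - d j)))"
  define i where "i = (\<lambda>n x. LEAST k. P n x k)"
  have exP: "\<exists>k. P n x k" for n x
  proof -
    have "finite ((\<lambda>k. norm (g x - d k)) ` {..n})" "(\<lambda>k. norm (g x - d k)) ` {..n} \<noteq> {}" by auto
    then have "Min ((\<lambda>k. norm (g x - d k)) ` {..n}) \<in> (\<lambda>k. norm (g x - d k)) ` {..n}"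
      by (rule Min_in)
    then obtain k where k: "k \<le> n" "Min ((\<lambda>k. norm (g x - d k)) ` {..n}) = norm (g x - d k)"
      by (elim imageE) auto
    have "norm (g x - d k) \<le> norm (g x - d j)" if "j \<le> n" for j
      unfolding k(2)[symmetric] by (rule Min_le) (use that in auto)
    with k(1) show ?thesis unfolding P_def by blast
  qed
  have Pi: "P n x (i n x)" for n x unfolding i_def by (rule LeastI_ex[OF exP])
  have simp_i: "simple_function M (i n)" for n
  proof -
    have [measurable]: "Measurable.pred M (\<lambda>x. P n x k)" for k
      unfolding P_def using meas by measurable
    have "i n \<in> measurable M (count_space UNIV)"
      unfolding i_def by measurable
    moreover have "finite (i n ` space M)"
      by (rule finite_subset[of _ "{..n}"]) (use Pi in \<open>auto simp: P_def\<close>)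
    ultimately show ?thesis
      unfolding simple_function_def by (auto intro: measurable_sets)
  qed
  show ?thesis
    unfolding strongly_measurable_def
  proof (intro exI[of _ "\<lambda>n x. d (i n x)"] conjI allI ballI)
    show "simple_function M (\<lambda>x. d (i n x))" for n
      by (rule simple_function_compose1[OF simp_i])
    show "(\<lambda>n. d (i n x)) \<longlonglongrightarrow> g x" if x: "x \<in> space M" for x
    proof (rule LIMSEQ_I)
      fix e :: real assume "e > 0"
      then obtain k where k: "norm (g x - d k) < e" using dense[OF x] by blast
      have "norm (d (i n x) - g x) < e" if "n \<ge> k" for n
        using Pi[of n x] k that unfolding P_def by (metis norm_minus_commute le_less_trans)
      then show "\<exists>no. \<forall>n\<ge>no. norm (d (i n x) - g x) < e" by blast
    qed
  qed
qed

lemma strongly_measurable_restrict: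
  assumes "strongly_measurable M f" and "A \<in> sets M"
  shows "strongly_measurable M (\<lambda>x. if x \<in> A then f x else 0)"
proof -
  obtain s where s: "\<And>n. simple_function M (s n)" "\<And>x. x \<in> space M \<Longrightarrow> (\<lambda>n. s n x) \<longlonglongrightarrow> f x"
    using assms(1) unfolding strongly_measurable_def by blast
  show ?thesis
    unfolding strongly_measurable_def
    by (rule exI[of _ "\<lambda>n x. if x \<in> A then s n x else 0"])
       (auto intro!: simple_function_If_set s assms(2) sets.sets_into_space
         simp: Int_absorb2[OF sets.sets_into_space[OF assms(2)]] Int_absorb1[OF sets.sets_into_space[OF assms(2)]])
qed

lemma norm_add_sq_le: "(norm (a + b))\<^sup>2 \<le> 2 * (norm a)\<^sup>2 + 2 * (norm b)\<^sup>2"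
  for a b :: "'b::real_normed_vector"
proof -
  have "(norm (a + b))\<^sup>2 \<le> (norm a + norm b)\<^sup>2"
    by (intro power_mono norm_triangle_ineq norm_ge_zero)
  also have "\<dots> \<le> 2 * (norm a)\<^sup>2 + 2 * (norm b)\<^sup>2"
    using sum_squares_bound[of "norm a" "norm b"] by (simp add: power2_sum)
  finally show ?thesis .
qed

lemma square_integrable_add:
  assumes "square_integrable M f" "square_integrable M g"
  shows "square_integrable M (\<lambda>x. f x + g x)"
proof -
  have sm: "strongly_measurable M (\<lambda>x. f x + g x)"
    using assms by (auto simp: square_integrable_def intro: strongly_measurable_add)
  have "integrable M (\<lambda>x. (norm (f x + g x))\<^sup>2)"
  proof (rule Bochner_Integration.integrable_bound)
    show "integrable M (\<lambda>x. 2 * (norm (f x))\<^sup>2 + 2 * (norm (g x))\<^sup>2)"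
      using assms by (auto simp: square_integrable_def)
    show "(\<lambda>x. (norm (f x + g x))\<^sup>2) \<in> borel_measurable M"
      using borel_measurable_norm_strong[OF sm] by measurable
  qed (auto intro!: AE_I2 norm_add_sq_le)
  with sm show ?thesis by (simp add: square_integrable_def)
qed

lemma square_integrable_scaleC:
  "square_integrable M f \<Longrightarrow> square_integrable M (\<lambda>x. c *\<^sub>C f x)"
  for f :: "'a \<Rightarrow> 'b::complex_inner"
  using strongly_measurable_compose[of M f "\<lambda>y. c *\<^sub>C y",
      OF _ linear_continuous_at[OF bounded_linear_scaleC]]
  by (simp add: square_integrable_def norm_scaleC power_mult_distrib)

lemma square_integrable_uminus:
  "square_integrable M f \<Longrightarrow> square_integrable M (\<lambda>x. - f x)"
  by (auto simp: square_integrable_def intro!: strongly_measurable_uminus)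

lemma square_integrable_diff:
  "square_integrable M f \<Longrightarrow> square_integrable M g \<Longrightarrow> square_integrable M (\<lambda>x. f x - g x)"
  using square_integrable_add[of M f "\<lambda>x. - g x"] square_integrable_uminus[of M g] by simp

lemma square_integrable_zero: "square_integrable M (\<lambda>_. 0)"
  by (simp add: square_integrable_def strongly_measurable_const)

lemma integrable_cinner:
  fixes f g :: "'a \<Rightarrow> 'b::complex_inner"
  assumes "square_integrable M f" "square_integrable M g"
  shows "integrable M (\<lambda>x. cinner (f x) (g x))"
proof (rule Bochner_Integration.integrable_bound)
  show "integrable M (\<lambda>x. (norm (f x))\<^sup>2 + (norm (g x))\<^sup>2)"
    using assms by (auto simp: square_integrable_def)
  show "(\<lambda>x. cinner (f x) (g x)) \<in> borel_measurable M"
    using assms unfolding square_integrable_def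
    by (intro borel_measurable_bilinear bounded_bilinear.tendsto[OF bounded_bilinear_cinner]) auto
  have "cmod (cinner a b) \<le> (norm a)\<^sup>2 + (norm b)\<^sup>2" for a b :: 'b
  proof -
    have "2 * (norm a * norm b) \<le> (norm a)\<^sup>2 + (norm b)\<^sup>2"
      using sum_squares_bound[of "norm a" "norm b"] by simp
    moreover have "0 \<le> norm a * norm b" by simp
    ultimately show ?thesis using cmod_cinner_le[of a b] by linarith
  qed
  then show "AE x in M. norm (cinner (f x) (g x)) \<le> norm ((norm (f x))\<^sup>2 + (norm (g x))\<^sup>2)"
    by (auto intro!: AE_I2)
qed

section \<open>The Hilbert spaces of square integrable functions on subsets of the line\<close>

text \<open>The domain of integration is carried by a tag type \<open>'s\<close>.\<close>

class real_domain =
  fixes domain_set :: "'a itself \<Rightarrow> real set"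
  assumes domain_set_borel: "domain_set TYPE('a) \<in> sets borel"

datatype rminus = Rminus
datatype rplus = Rplus

instantiation rminus :: real_domain
begin
definition domain_set_rminus :: "rminus itself \<Rightarrow> real set" where
  "domain_set_rminus _ = {..0}"
instance by standard (simp add: domain_set_rminus_def)
end

instantiation rplus :: real_domain
begin
definition domain_set_rplus :: "rplus itself \<Rightarrow> real set" where
  "domain_set_rplus _ = {0..}"
instance by standard (simp add: domain_set_rplus_def)
end

abbreviation domain_measure :: "'s::real_domain itself \<Rightarrow> real measure" where
  "domain_measure S \<equiv> restrict_space lborel (domain_set S)"

definition L2_rel :: "'s::real_domain itself \<Rightarrow> (real \<Rightarrow> 'e::complex_inner) \<Rightarrow> (real \<Rightarrow> 'e) \<Rightarrow> bool"
  where "L2_rel S f g \<longleftrightarrow> square_integrable (domain_measure S) f \<and>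
     square_integrable (domain_measure S) g \<and> (AE x in domain_measure S. f x = g x)"

lemma L2_rel_sym: "L2_rel S f g \<Longrightarrow> L2_rel S g f"
  by (simp add: L2_rel_def eq_commute)

lemma L2_rel_trans: "L2_rel S f g \<Longrightarrow> L2_rel S g h \<Longrightarrow> L2_rel S f h"
proof -
  assume fg: "L2_rel S f g" and gh: "L2_rel S g h"
  have "AE x in domain_measure S. f x = g x" "AE x in domain_measure S. g x = h x"
    using fg gh by (simp_all add: L2_rel_def)
  then have "AE x in domain_measure S. f x = h x" by eventually_elim simp
  with fg gh show ?thesis by (simp add: L2_rel_def)
qed

lemma L2_rel_map:
  assumes "L2_rel S f f'"
    and "\<And>f. square_integrable (domain_measure S) f \<Longrightarrow>
        square_integrable (domain_measure S) (\<lambda>x. h (f x))"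
  shows "L2_rel S (\<lambda>x. h (f x)) (\<lambda>x. h (f' x))"
proof -
  have "AE x in domain_measure S. f x = f' x" using assms(1) by (simp add: L2_rel_def)
  then have "AE x in domain_measure S. h (f x) = h (f' x)" by eventually_elim simp
  with assms show ?thesis by (simp add: L2_rel_def)
qed

lemma L2_rel_map2:
  assumes "L2_rel S f f'" "L2_rel S g g'"
    and "\<And>f g. square_integrable (domain_measure S) f \<Longrightarrow>
        square_integrable (domain_measure S) g \<Longrightarrow>
        square_integrable (domain_measure S) (\<lambda>x. h (f x) (g x))"
  shows "L2_rel S (\<lambda>x. h (f x) (g x)) (\<lambda>x. h (f' x) (g' x))"
proof -
  have "AE x in domain_measure S. f x = f' x" "AE x in domain_measure S. g x = g' x"
    using assms(1,2) by (simp_all add: L2_rel_def)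
  then have "AE x in domain_measure S. h (f x) (g x) = h (f' x) (g' x)" by eventually_elim simp
  with assms show ?thesis by (simp add: L2_rel_def)
qed

typedef (overloaded) ('s, 'e) L2 =
  "{c. \<exists>f :: real \<Rightarrow> 'e::complex_inner. L2_rel TYPE('s::real_domain) f f \<and>
       c = Collect (L2_rel TYPE('s) f)}"
  morphisms class_of_L2 L2_of_class
  by (rule exI[of _ "Collect (L2_rel TYPE('s) (\<lambda>_. 0))"])
     (auto simp: L2_rel_def square_integrable_zero intro!: exI[of _ "\<lambda>_. 0"])

definition abs_L2 :: "(real \<Rightarrow> 'e) \<Rightarrow> ('s::real_domain, 'e::complex_inner) L2" where
  "abs_L2 f = L2_of_class (Collect (L2_rel TYPE('s) f))"

definition rep_L2 :: "('s::real_domain, 'e::complex_inner) L2 \<Rightarrow> real \<Rightarrow> 'e" where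
  "rep_L2 v = (SOME f. f \<in> class_of_L2 v)"

definition cr_L2 :: "(real \<Rightarrow> 'e) \<Rightarrow> ('s::real_domain, 'e::complex_inner) L2 \<Rightarrow> bool" where
  "cr_L2 f v \<longleftrightarrow> L2_rel TYPE('s) f f \<and> abs_L2 f = v"

lemma abs_L2_eq_iff:
  fixes f g :: "real \<Rightarrow> 'e::complex_inner"
  assumes "L2_rel TYPE('s::real_domain) f f" "L2_rel TYPE('s) g g"
  shows "(abs_L2 f :: ('s, 'e) L2) = abs_L2 g \<longleftrightarrow> L2_rel TYPE('s) f g"
proof -
  have "(abs_L2 f :: ('s, 'e) L2) = abs_L2 g \<longleftrightarrow>
      Collect (L2_rel TYPE('s) f) = Collect (L2_rel TYPE('s) g)"
    unfolding abs_L2_def by (rule L2_of_class_inject) (use assms in auto)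
  also have "\<dots> \<longleftrightarrow> L2_rel TYPE('s) f g"
  proof
    assume "Collect (L2_rel TYPE('s) f) = Collect (L2_rel TYPE('s) g)"
    then have "g \<in> Collect (L2_rel TYPE('s) f)" using assms(2) by simp
    then show "L2_rel TYPE('s) f g" by simp
  next
    assume fg: "L2_rel TYPE('s) f g"
    have "L2_rel TYPE('s) f h \<longleftrightarrow> L2_rel TYPE('s) g h" for h
      using L2_rel_trans[OF fg, of h] L2_rel_trans[OF L2_rel_sym[OF fg], of h] by blast
    then show "Collect (L2_rel TYPE('s) f) = Collect (L2_rel TYPE('s) g)"
      by (intro Collect_cong)
  qed
  finally show ?thesis .
qed

lemma rep_L2_works:
  fixes v :: "('s::real_domain, 'e::complex_inner) L2"
  shows "L2_rel TYPE('s) (rep_L2 v) (rep_L2 v)" "abs_L2 (rep_L2 v) = v"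
proof -
  obtain f where f: "L2_rel TYPE('s) f f" "class_of_L2 v = Collect (L2_rel TYPE('s) f)"
    using class_of_L2[of v, unfolded mem_Collect_eq] by (elim exE conjE) (rule that)
  then have "rep_L2 v \<in> class_of_L2 v"
    unfolding rep_L2_def by (metis mem_Collect_eq someI)
  with f have *: "L2_rel TYPE('s) f (rep_L2 v)" by simp
  show **: "L2_rel TYPE('s) (rep_L2 v) (rep_L2 v)"
    by (rule L2_rel_trans[OF L2_rel_sym[OF *] *])
  have "abs_L2 f = v"
    using class_of_L2_inverse[of v] by (simp add: abs_L2_def f(2)[symmetric])
  then show "abs_L2 (rep_L2 v) = v"
    using abs_L2_eq_iff[OF f(1) **] * by simp
qed

lemma Quotient_L2:
  "Quotient (L2_rel TYPE('s)) abs_L2 rep_L2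
     (cr_L2 :: (real \<Rightarrow> 'e) \<Rightarrow> ('s::real_domain, 'e::complex_inner) L2 \<Rightarrow> bool)"
proof (rule QuotientI)
  fix v :: "('s, 'e) L2" and f g :: "real \<Rightarrow> 'e"
  show "abs_L2 (rep_L2 v) = v" "L2_rel TYPE('s) (rep_L2 v) (rep_L2 v)"
    by (rule rep_L2_works)+
  show "L2_rel TYPE('s) f g \<longleftrightarrow> L2_rel TYPE('s) f f \<and> L2_rel TYPE('s) g g \<and>
      (abs_L2 f :: ('s, 'e) L2) = abs_L2 g"
    using abs_L2_eq_iff[of f g] L2_rel_trans[OF _ L2_rel_sym, of "TYPE('s)" f g f]
      L2_rel_trans[OF L2_rel_sym, of "TYPE('s)" f g g] by blast
  show "(cr_L2 :: _ \<Rightarrow> ('s, 'e) L2 \<Rightarrow> bool) = (\<lambda>x y. L2_rel TYPE('s) x x \<and> abs_L2 x = y)"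
    by (simp add: cr_L2_def fun_eq_iff)
qed

setup_lifting Quotient_L2

instantiation L2 :: (real_domain, complex_inner) complex_inner
begin

lift_definition zero_L2 :: "('a, 'b) L2" is "\<lambda>_. 0"
  by (simp add: L2_rel_def square_integrable_zero)

lift_definition plus_L2 :: "('a, 'b) L2 \<Rightarrow> ('a, 'b) L2 \<Rightarrow> ('a, 'b) L2" is "\<lambda>f g x. f x + g x"
  by (rule L2_rel_map2[OF _ _ square_integrable_add])

lift_definition minus_L2 :: "('a, 'b) L2 \<Rightarrow> ('a, 'b) L2 \<Rightarrow> ('a, 'b) L2" is "\<lambda>f g x. f x - g x"
  by (rule L2_rel_map2[OF _ _ square_integrable_diff])

lift_definition uminus_L2 :: "('a, 'b) L2 \<Rightarrow> ('a, 'b) L2" is "\<lambda>f x. - f x"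
  by (rule L2_rel_map[OF _ square_integrable_uminus])

lift_definition scaleC_L2 :: "complex \<Rightarrow> ('a, 'b) L2 \<Rightarrow> ('a, 'b) L2" is "\<lambda>c f x. c *\<^sub>C f x"
  by (rule L2_rel_map[OF _ square_integrable_scaleC])

lift_definition cinner_L2 :: "('a, 'b) L2 \<Rightarrow> ('a, 'b) L2 \<Rightarrow> complex" is
  "\<lambda>f g. \<integral>x. cinner (f x) (g x) \<partial>domain_measure TYPE('a)"
proof -
  fix f f' g g' :: "real \<Rightarrow> 'b"
  assume fg: "L2_rel TYPE('a) f f'" "L2_rel TYPE('a) g g'"
  have "AE x in domain_measure TYPE('a). f x = f' x" "AE x in domain_measure TYPE('a). g x = g' x"
    using fg by (simp_all add: L2_rel_def)
  then have "AE x in domain_measure TYPE('a). cinner (f x) (g x) = cinner (f' x) (g' x)"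
    by eventually_elim simp
  then show "(\<integral>x. cinner (f x) (g x) \<partial>domain_measure TYPE('a)) =
      (\<integral>x. cinner (f' x) (g' x) \<partial>domain_measure TYPE('a))"
    using fg by (intro integral_cong_AE borel_measurable_integrable integrable_cinner)
      (simp_all add: L2_rel_def)
qed

definition scaleR_L2 :: "real \<Rightarrow> ('a, 'b) L2 \<Rightarrow> ('a, 'b) L2" where
  "scaleR_L2 r v = complex_of_real r *\<^sub>C v"

definition inner_L2 :: "('a, 'b) L2 \<Rightarrow> ('a, 'b) L2 \<Rightarrow> real" where
  "inner_L2 v w = Re (cinner v w)"

definition norm_L2 :: "('a, 'b) L2 \<Rightarrow> real" where
  "norm_L2 v = sqrt (inner v v)"

definition dist_L2 :: "('a, 'b) L2 \<Rightarrow> ('a, 'b) L2 \<Rightarrow> real" where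
  "dist_L2 v w = norm (v - w)"

definition sgn_L2 :: "('a, 'b) L2 \<Rightarrow> ('a, 'b) L2" where
  "sgn_L2 v = inverse (norm v) *\<^sub>R v"

definition uniformity_L2 :: "(('a, 'b) L2 \<times> ('a, 'b) L2) filter" where
  "uniformity_L2 = (INF e\<in>{0 <..}. principal {(x, y). dist x y < e})"

definition open_L2 :: "('a, 'b) L2 set \<Rightarrow> bool" where
  "open_L2 U \<longleftrightarrow> (\<forall>x\<in>U. \<forall>\<^sub>F (x', y) in uniformity. x' = x \<longrightarrow> y \<in> U)"

instance
proof
  fix v w u :: "('a, 'b) L2" and c d :: complex and r r' :: real and U :: "('a, 'b) L2 set"
  show "v + w + u = v + (w + u)" by transfer (auto simp: L2_rel_def square_integrable_add add.assoc)
  show "v + w = w + v" by transfer (auto simp: L2_rel_def square_integrable_add add.commute)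
  show "0 + v = v" by transfer (auto simp: L2_rel_def)
  show "- v + v = 0" by transfer (auto simp: L2_rel_def square_integrable_zero)
  show "v - w = v + - w" by transfer (auto simp: L2_rel_def square_integrable_diff)
  show add_r: "c *\<^sub>C (v + w) = c *\<^sub>C v + c *\<^sub>C w" for c and v w :: "('a, 'b) L2"
    by transfer (auto simp: L2_rel_def scaleC_add_right square_integrable_add square_integrable_scaleC)
  show add_l: "(c + d) *\<^sub>C v = c *\<^sub>C v + d *\<^sub>C v" for c d and v :: "('a, 'b) L2"
    by transfer (auto simp: L2_rel_def scaleC_add_left square_integrable_add square_integrable_scaleC)
  show ss: "c *\<^sub>C d *\<^sub>C v = (c * d) *\<^sub>C v" for c d and v :: "('a, 'b) L2"
    by transfer (auto simp: L2_rel_def scaleC_scaleC square_integrable_scaleC)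
  have one: "1 *\<^sub>C v = v" for v :: "('a, 'b) L2"
  proof transfer
    have "1 *\<^sub>C y = y" for y :: 'b using scaleC_of_real[of 1 y] by simp
    then show "L2_rel TYPE('a) v v \<Longrightarrow> L2_rel TYPE('a) (\<lambda>x. 1 *\<^sub>C v x) v" for v :: "real \<Rightarrow> 'b"
      by simp
  qed
  show "complex_of_real r *\<^sub>C v = r *\<^sub>R v" by (simp add: scaleR_L2_def)
  show "r *\<^sub>R (v + w) = r *\<^sub>R v + r *\<^sub>R w" by (simp add: scaleR_L2_def add_r)
  show "(r + r') *\<^sub>R v = r *\<^sub>R v + r' *\<^sub>R v" by (simp add: scaleR_L2_def add_l)
  show "r *\<^sub>R r' *\<^sub>R v = (r * r') *\<^sub>R v" by (simp add: scaleR_L2_def ss)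
  show "1 *\<^sub>R v = v" by (simp add: scaleR_L2_def one)
  show cadd: "cinner (v + w) u = cinner v u + cinner w u" for v w u :: "('a, 'b) L2"
    by transfer (simp add: L2_rel_def cinner_add_left integrable_cinner)
  show cscale: "cinner (c *\<^sub>C v) w = c * cinner v w" for c and v w :: "('a, 'b) L2"
    by transfer (simp add: cinner_scaleC_left)
  show ccomm: "cinner v w = cnj (cinner w v)" for v w :: "('a, 'b) L2"
    by transfer (subst cinner_commute, simp)
  show "Re (cinner v w) = inner v w" by (simp add: inner_L2_def)
  show "inner v w = inner w v" by (subst (1 2) inner_L2_def) (subst ccomm, simp)
  show "inner (v + w) u = inner v u + inner w u" by (simp add: inner_L2_def cadd)
  show "inner (r *\<^sub>R v) w = r * inner v w" by (simp add: inner_L2_def scaleR_L2_def cscale)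
  have sq: "Re (\<integral>x. cinner (f x) (f x) \<partial>domain_measure TYPE('a)) =
      (\<integral>x. (norm (f x))\<^sup>2 \<partial>domain_measure TYPE('a))" for f :: "real \<Rightarrow> 'b"
    by (simp add: cinner_self flip: of_real_power)
  show "0 \<le> inner v v"
    unfolding inner_L2_def by transfer (simp add: sq)
  show "inner v v = 0 \<longleftrightarrow> v = 0"
    unfolding inner_L2_def
    by transfer (auto simp: sq L2_rel_def square_integrable_zero square_integrable_def
        integral_nonneg_eq_0_iff_AE)
  show "norm v = sqrt (inner v v)" by (simp add: norm_L2_def)
  show "dist v w = norm (v - w)" by (simp add: dist_L2_def)
  show "sgn v = inverse (norm v) *\<^sub>R v" by (simp add: sgn_L2_def)
  show "(uniformity :: (('a, 'b) L2 \<times> ('a, 'b) L2) filter) =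
      (INF e\<in>{0 <..}. principal {(x, y). dist x y < e})" by (simp add: uniformity_L2_def)
  show "open U \<longleftrightarrow> (\<forall>x\<in>U. \<forall>\<^sub>F (x', y) in uniformity. x' = x \<longrightarrow> y \<in> U)"
    by (simp add: open_L2_def)
qed

end

lemma norm_L2_abs:
  fixes f :: "real \<Rightarrow> 'e::complex_inner"
  assumes "square_integrable (domain_measure TYPE('s::real_domain)) f"
  shows "(norm (abs_L2 f :: ('s, 'e) L2))\<^sup>2 = (\<integral>x. (norm (f x))\<^sup>2 \<partial>domain_measure TYPE('s))"
proof -
  have f: "L2_rel TYPE('s) f f" using assms by (simp add: L2_rel_def)
  have "complex_of_real ((norm (abs_L2 f :: ('s, 'e) L2))\<^sup>2) =
      (\<integral>x. cinner (f x) (f x) \<partial>domain_measure TYPE('s))"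
    using cinner_L2.abs_eq[OF f f] by (simp add: cinner_self)
  also have "\<dots> = complex_of_real (\<integral>x. (norm (f x))\<^sup>2 \<partial>domain_measure TYPE('s))"
    by (simp add: cinner_self flip: of_real_power)
  finally show ?thesis using of_real_eq_iff by blast
qed

lemma square_integrable_rep_L2:
  "square_integrable (domain_measure TYPE('s)) (rep_L2 (v :: ('s::real_domain, 'e::complex_inner) L2))"
  using rep_L2_works(1)[of v] by (simp add: L2_rel_def)

lemma nn_integral_norm_L2_diff:
  fixes v w :: "('s::real_domain, 'e::complex_inner) L2"
  shows "(\<integral>\<^sup>+x. ennreal ((norm (rep_L2 v x - rep_L2 w x))\<^sup>2) \<partial>domain_measure TYPE('s)) =
    ennreal ((norm (v - w))\<^sup>2)"
proof -
  have si: "square_integrable (domain_measure TYPE('s)) (\<lambda>x. rep_L2 v x - rep_L2 w x)"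
    by (intro square_integrable_diff square_integrable_rep_L2)
  have "v - w = abs_L2 (\<lambda>x. rep_L2 v x - rep_L2 w x)"
    using minus_L2.abs_eq[OF rep_L2_works(1) rep_L2_works(1), of v w] by (simp add: rep_L2_works)
  then have "(norm (v - w))\<^sup>2 = (\<integral>x. (norm (rep_L2 v x - rep_L2 w x))\<^sup>2 \<partial>domain_measure TYPE('s))"
    using norm_L2_abs[OF si] by simp
  then show ?thesis
    using si by (simp add: square_integrable_def nn_integral_eq_integral)
qed

instance L2 :: (real_domain, complex_hilbert) complex_hilbert
proof
  fix X :: "nat \<Rightarrow> ('a, 'b) L2"
  assume X: "Cauchy X"
  let ?M = "domain_measure TYPE('a)"
  have "\<exists>N. \<forall>m\<ge>N. \<forall>m'\<ge>N. norm (X m - X m') < (1/4) ^ n" for n :: nat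
    using CauchyD[OF X, of "(1/4) ^ n"] by simp
  then obtain N where N: "\<And>n m m'. m \<ge> N n \<Longrightarrow> m' \<ge> N n \<Longrightarrow> norm (X m - X m') < (1/4) ^ n"
    by metis
  have "\<exists>r. \<forall>n::nat. N n \<le> r n \<and> r n < r (Suc n)"
  proof (rule dependent_nat_choice)
    show "\<exists>y. N (Suc n) \<le> y \<and> x < y" for x n
      by (rule exI[of _ "max (N (Suc n)) (Suc x)"]) auto
  qed auto
  then obtain r where r: "\<And>n. N n \<le> r n" "\<And>n. r n < r (Suc n)" by blast
  have mono: "strict_mono r" using r(2) by (simp add: strict_mono_Suc_iff)
  define f where "f = (\<lambda>n. rep_L2 (X (r n)))"
  have si: "square_integrable ?M (f n)" for n
    unfolding f_def by (rule square_integrable_rep_L2)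
  then have sm: "strongly_measurable ?M (f n)" for n by (simp add: square_integrable_def)
  have est: "(\<integral>\<^sup>+x. ennreal ((norm (f m x - f n x))\<^sup>2) \<partial>?M) \<le> ennreal ((1/16) ^ n)"
    if "m \<ge> n" for m n
  proof -
    have "r n \<le> r m" using that mono by (simp add: strict_mono_less_eq)
    then have "norm (X (r m) - X (r n)) < (1/4) ^ n" using N[of n "r m" "r n"] r(1)[of n] by simp
    then have "(norm (X (r m) - X (r n)))\<^sup>2 \<le> ((1/4) ^ n)\<^sup>2" by (intro power_mono) auto
    also have "((1/4) ^ n)\<^sup>2 = ((1/16) ^ n :: real)"
      by (simp add: power_mult[symmetric] mult.commute[of n]) (simp add: power_mult power2_eq_square)
    finally show ?thesis
      unfolding f_def nn_integral_norm_L2_diff by (rule ennreal_leI)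
  qed
  define D where "D = (\<lambda>n x. ennreal (4 ^ n * (norm (f (Suc n) x - f n x))\<^sup>2))"
  have [measurable]: "(\<lambda>x. norm (f m x - f n x)) \<in> borel_measurable ?M" for m n
    by (intro borel_measurable_norm_strong strongly_measurable_diff sm)
  have [measurable]: "D n \<in> borel_measurable ?M" for n
    unfolding D_def by measurable
  have intD: "(\<integral>\<^sup>+x. D n x \<partial>?M) \<le> ennreal ((1/4) ^ n)" for n
  proof -
    have "(\<integral>\<^sup>+x. D n x \<partial>?M) =
        ennreal (4 ^ n) * (\<integral>\<^sup>+x. ennreal ((norm (f (Suc n) x - f n x))\<^sup>2) \<partial>?M)"
      unfolding D_def by (subst nn_integral_cmult[symmetric]) (auto simp: ennreal_mult)
    also have "\<dots> \<le> ennreal (4 ^ n) * ennreal ((1/16) ^ n)"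
      by (intro mult_left_mono est) auto
    also have "\<dots> = ennreal ((1/4) ^ n)"
      by (simp add: ennreal_mult[symmetric] power_mult_distrib[symmetric])
    finally show ?thesis .
  qed
  have "(\<integral>\<^sup>+x. (\<Sum>n. D n x) \<partial>?M) = (\<Sum>n. \<integral>\<^sup>+x. D n x \<partial>?M)"
    by (rule nn_integral_suminf) measurable
  also have "\<dots> \<le> (\<Sum>n. ennreal ((1/4) ^ n))"
    by (intro suminf_le intD) auto
  also have "\<dots> = ennreal (\<Sum>n. (1/4) ^ n)"
    by (intro suminf_ennreal2) auto
  also have "\<dots> < \<infinity>" by simp
  finally have "AE x in ?M. (\<Sum>n. D n x) \<noteq> \<infinity>"
    by (intro nn_integral_PInf_AE) auto
  define A where "A = {x \<in> space ?M. (\<Sum>n. D n x) \<noteq> \<infinity>}"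
  have A: "A \<in> sets ?M" unfolding A_def by measurable
  have AE_A: "AE x in ?M. x \<in> A"
    using \<open>AE x in ?M. (\<Sum>n. D n x) \<noteq> \<infinity>\<close> AE_space by eventually_elim (simp add: A_def)
  define F where "F = (\<lambda>n x. if x \<in> A then f n x else 0)"
  have smF: "strongly_measurable ?M (F n)" for n
    unfolding F_def by (rule strongly_measurable_restrict[OF sm A])
  have conv: "convergent (\<lambda>n. F n x)" for x
  proof (cases "x \<in> A")
    case True
    then have "(\<Sum>n. D n x) \<noteq> \<infinity>" by (simp add: A_def)
    then obtain c where c: "(\<Sum>n. D n x) = ennreal c" "c \<ge> 0"
      by (cases "\<Sum>n. D n x") auto
    have bound: "norm (f (Suc n) x - f n x) \<le> sqrt c * (1/2) ^ n" for n
    proof -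
      have "(\<Sum>i\<in>{n}. D i x) \<le> (\<Sum>n. D n x)" by (rule sum_le_suminf) auto
      then have "D n x \<le> ennreal c" using c(1) by simp
      then have "4 ^ n * (norm (f (Suc n) x - f n x))\<^sup>2 \<le> c"
        unfolding D_def using c(2) by (simp add: ennreal_le_iff)
      then have "(2 ^ n * norm (f (Suc n) x - f n x))\<^sup>2 \<le> c"
        by (simp add: power_mult_distrib power_mult[symmetric] mult.commute[of n]) (simp add: power_mult)
      then have "2 ^ n * norm (f (Suc n) x - f n x) \<le> sqrt c"
        by (rule real_le_rsqrt)
      then show ?thesis by (simp add: field_simps power_one_over)
    qed
    have "summable (\<lambda>n. norm (f (Suc n) x - f n x))"
      by (rule summable_comparison_test'[where g="\<lambda>n. sqrt c * (1/2) ^ n" and N=0])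
         (use bound in \<open>auto intro!: summable_mult summable_geometric\<close>)
    then have "summable (\<lambda>n. f (Suc n) x - f n x)" by (rule summable_norm_cancel)
    then have "convergent (\<lambda>n. \<Sum>i<n. f (Suc i) x - f i x)"
      by (simp add: summable_iff_convergent)
    then have "convergent (\<lambda>n. f n x - f 0 x)"
      unfolding sum_lessThan_telescope[of "\<lambda>i. f i x"] .
    then have "convergent (\<lambda>n. (f n x - f 0 x) + f 0 x)"
      by (intro convergent_add convergent_const)
    then show ?thesis using True by (simp add: F_def)
  qed (simp add: F_def convergent_const)
  define g where "g = (\<lambda>x. lim (\<lambda>n. F n x))"
  have lim: "(\<lambda>n. F n x) \<longlonglongrightarrow> g x" for x
    using conv unfolding g_def by (simp add: convergent_LIMSEQ_iff)
  have smg: "strongly_measurable ?M g"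
    by (rule strongly_measurable_limit[OF smF lim])
  have estF: "(\<integral>\<^sup>+x. ennreal ((norm (F m x - F n x))\<^sup>2) \<partial>?M) \<le> ennreal ((1/16) ^ n)"
    if "m \<ge> n" for m n
  proof -
    have "(\<integral>\<^sup>+x. ennreal ((norm (F m x - F n x))\<^sup>2) \<partial>?M) \<le>
        (\<integral>\<^sup>+x. ennreal ((norm (f m x - f n x))\<^sup>2) \<partial>?M)"
      by (intro nn_integral_mono ennreal_leI) (auto simp: F_def)
    also note est[OF that]
    finally show ?thesis .
  qed
  have estg: "(\<integral>\<^sup>+x. ennreal ((norm (g x - F n x))\<^sup>2) \<partial>?M) \<le> ennreal ((1/16) ^ n)" for n
  proof -
    have [measurable]: "(\<lambda>x. norm (F m x - F n x)) \<in> borel_measurable ?M" for m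
      by (intro borel_measurable_norm_strong strongly_measurable_diff smF)
    have "liminf (\<lambda>m. ennreal ((norm (F m x - F n x))\<^sup>2)) = ennreal ((norm (g x - F n x))\<^sup>2)" for x
      by (intro lim_imp_Liminf tendsto_intros lim tendsto_ennrealI) simp
    then have "(\<integral>\<^sup>+x. ennreal ((norm (g x - F n x))\<^sup>2) \<partial>?M) =
        (\<integral>\<^sup>+x. liminf (\<lambda>m. ennreal ((norm (F m x - F n x))\<^sup>2)) \<partial>?M)" by simp
    also have "\<dots> \<le> liminf (\<lambda>m. \<integral>\<^sup>+x. ennreal ((norm (F m x - F n x))\<^sup>2) \<partial>?M)"
      by (rule nn_integral_liminf) measurable
    also have "\<dots> \<le> liminf (\<lambda>m. ennreal ((1/16) ^ n))"
      by (intro Liminf_mono eventually_mono[OF eventually_ge_at_top[of n]] estF)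
    also have "\<dots> = ennreal ((1/16) ^ n)" by (intro lim_imp_Liminf) auto
    finally show ?thesis .
  qed
  have smgF: "strongly_measurable ?M (\<lambda>x. g x - F n x)" for n
    by (intro strongly_measurable_diff smg smF)
  have sigF: "square_integrable ?M (\<lambda>x. g x - F n x)" for n
  proof -
    have "(\<integral>\<^sup>+x. ennreal ((norm (g x - F n x))\<^sup>2) \<partial>?M) < \<infinity>"
      using estg[of n] by (rule le_less_trans) simp
    moreover have "(\<lambda>x. (norm (g x - F n x))\<^sup>2) \<in> borel_measurable ?M"
      by (intro borel_measurable_power borel_measurable_norm_strong smgF)
    ultimately have "integrable ?M (\<lambda>x. (norm (g x - F n x))\<^sup>2)"
      by (intro integrableI_nonneg) auto
    with smgF show ?thesis by (simp add: square_integrable_def)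
  qed
  have relF: "L2_rel TYPE('a) (F n) (f n)" for n
  proof -
    have ae: "AE x in ?M. F n x = f n x"
      using AE_A by eventually_elim (simp add: F_def)
    have meas: "(\<lambda>x. (norm (F n x))\<^sup>2) \<in> borel_measurable ?M"
      by (intro borel_measurable_power borel_measurable_norm_strong smF)
    have "integrable ?M (\<lambda>x. (norm (f n x))\<^sup>2)"
      using si[of n] by (simp add: square_integrable_def)
    then have "integrable ?M (\<lambda>x. (norm (F n x))\<^sup>2)"
    proof (rule Bochner_Integration.integrable_bound)
      have "norm ((norm (F n x))\<^sup>2) \<le> norm ((norm (f n x))\<^sup>2)" for x
        by (simp add: F_def)
      then show "AE x in ?M. norm ((norm (F n x))\<^sup>2) \<le> norm ((norm (f n x))\<^sup>2)"
        by (rule AE_I2)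
    qed (rule meas)
    with smF si ae show ?thesis by (simp add: L2_rel_def square_integrable_def)
  qed
  then have siF: "square_integrable ?M (F n)" for n by (simp add: L2_rel_def)
  have sig: "square_integrable ?M g"
    using square_integrable_add[OF sigF[of 0] siF[of 0]] by simp
  have "norm (X (r n) - abs_L2 g) \<le> (1/4) ^ n" for n
  proof -
    have "X (r n) = abs_L2 (f n)" by (simp add: f_def rep_L2_works)
    also have "\<dots> = abs_L2 (F n)"
      using abs_L2_eq_iff[of "f n" "F n", where 's='a] L2_rel_sym[OF relF[of n]] si siF
      by (simp add: L2_rel_def)
    finally have "abs_L2 g - X (r n) = abs_L2 (\<lambda>x. g x - F n x)"
      using minus_L2.abs_eq[of g "F n", where 'a='a] sig siF by (simp add: L2_rel_def)
    then have "ennreal ((norm (abs_L2 g - X (r n)))\<^sup>2) =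
        (\<integral>\<^sup>+x. ennreal ((norm (g x - F n x))\<^sup>2) \<partial>?M)"
      using norm_L2_abs[OF sigF[of n]] sigF[of n]
      by (simp add: square_integrable_def nn_integral_eq_integral)
    also note estg[of n]
    finally have "(norm (abs_L2 g - X (r n)))\<^sup>2 \<le> (1/16) ^ n" by (simp add: ennreal_le_iff)
    also have "((1/16) ^ n :: real) = ((1/4) ^ n)\<^sup>2"
      by (simp add: power_mult[symmetric] mult.commute[of n]) (simp add: power_mult power2_eq_square)
    finally have "norm (abs_L2 g - X (r n)) \<le> (1/4) ^ n"
      by (rule power2_le_imp_le) simp
    then show ?thesis by (subst norm_minus_commute)
  qed
  then have "(\<lambda>n. X (r n) - abs_L2 g) \<longlonglongrightarrow> 0"
    by (rule Lim_null_comparison[OF always_eventually[OF allI]]) (rule LIMSEQ_realpow_zero, simp_all)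
  then have "(X \<circ> r) \<longlonglongrightarrow> abs_L2 g" by (simp add: LIM_zero_iff comp_def)
  then show "convergent X"
    using Cauchy_converges_subseq[OF X mono] by (auto simp: convergent_def)
qed

section \<open>Unbounded operators, represented by their graphs\<close>

definition csubspace :: "'a::complex_inner set \<Rightarrow> bool" where
  "csubspace S \<longleftrightarrow> 0 \<in> S \<and> (\<forall>x\<in>S. \<forall>y\<in>S. x + y \<in> S) \<and> (\<forall>c. \<forall>x\<in>S. c *\<^sub>C x \<in> S)"

definition linear_operator :: "('a::complex_inner \<times> 'b::complex_inner) set \<Rightarrow> bool" where
  "linear_operator T \<longleftrightarrow> csubspace T \<and> single_valued T"

definition op_adjoint ::
  "('a::complex_inner \<times> 'b::complex_inner) set \<Rightarrow> ('b \<times> 'a) set" where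
  "op_adjoint T = {(y, z). \<forall>(x, w)\<in>T. cinner w y = cinner x z}"

definition selfadjoint_operator :: "('a::complex_inner \<times> 'a) set \<Rightarrow> bool" where
  "selfadjoint_operator T \<longleftrightarrow>
     linear_operator T \<and> closure (Domain T) = UNIV \<and> op_adjoint T = T"

definition bounded_clinear :: "('a::complex_inner \<Rightarrow> 'b::complex_inner) \<Rightarrow> bool" where
  "bounded_clinear R \<longleftrightarrow> bounded_linear R \<and> (\<forall>c x. R (c *\<^sub>C x) = c *\<^sub>C R x)"

definition bounded_adjoint :: "('a::complex_inner \<Rightarrow> 'b::complex_inner) \<Rightarrow> 'b \<Rightarrow> 'a" where
  "bounded_adjoint R y = (THE z. \<forall>x. cinner (R x) y = cinner x z)"

text \<open>The operator \<open>T - z I\<close>.\<close>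

definition op_shift :: "('a::complex_inner \<times> 'a) set \<Rightarrow> complex \<Rightarrow> ('a \<times> 'a) set" where
  "op_shift T z = {(u, f - z *\<^sub>C u) | u f. (u, f) \<in> T}"

definition resolvent_set :: "('a::complex_inner \<times> 'a) set \<Rightarrow> complex set" where
  "resolvent_set T = {z. \<exists>R. bounded_clinear R \<and> (op_shift T z)\<inverse> = {(h, R h) | h. True}}"

text \<open>\<open>(T - z I)\<^sup>-\<^sup>1 h\<close>; meaningful for \<open>z \<in> resolvent_set T\<close>.\<close>

definition resolvent :: "('a::complex_inner \<times> 'a) set \<Rightarrow> complex \<Rightarrow> 'a \<Rightarrow> 'a" where
  "resolvent T z h = (THE u. (u, h) \<in> op_shift T z)"

section \<open>The boundary triple and the dissipative operator\<close>

text \<open>Here \<open>P\<close> plays the role of \<open>\<Pi>\<close>, and \<open>resolvent A\<^sub>0 0\<close> is the inverse of \<open>A\<^sub>0\<close>.\<close>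

definition op_A :: "('h::complex_inner \<times> 'h) set \<Rightarrow> ('e::complex_inner \<Rightarrow> 'h) \<Rightarrow> ('h \<times> 'h) set"
  where "op_A A\<^sub>0 P = {(resolvent A\<^sub>0 0 f + P \<phi>, f) | f \<phi>. True}"

definition op_\<Gamma>\<^sub>0 :: "('h::complex_inner \<times> 'h) set \<Rightarrow> ('e::complex_inner \<Rightarrow> 'h) \<Rightarrow> ('h \<times> 'e) set"
  where "op_\<Gamma>\<^sub>0 A\<^sub>0 P = {(resolvent A\<^sub>0 0 f + P \<phi>, \<phi>) | f \<phi>. True}"

definition op_\<Gamma>\<^sub>1 :: "('h::complex_inner \<times> 'h) set \<Rightarrow> ('e::complex_inner \<Rightarrow> 'h) \<Rightarrow>
    ('e \<times> 'e) set \<Rightarrow> ('h \<times> 'e) set"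
  where "op_\<Gamma>\<^sub>1 A\<^sub>0 P \<Lambda> =
    {(resolvent A\<^sub>0 0 f + P \<phi>, bounded_adjoint P f + \<psi>) | f \<phi> \<psi>. (\<phi>, \<psi>) \<in> \<Lambda>}"

definition op_L :: "('h::complex_inner \<times> 'h) set \<Rightarrow> ('e::complex_inner \<Rightarrow> 'h) \<Rightarrow>
    ('e \<times> 'e) set \<Rightarrow> ('h \<times> 'h) set"
  where "op_L A\<^sub>0 P \<Lambda> = {(u, f) \<in> op_A A\<^sub>0 P.
    \<exists>g\<^sub>0 g\<^sub>1. (u, g\<^sub>0) \<in> op_\<Gamma>\<^sub>0 A\<^sub>0 P \<and> (u, g\<^sub>1) \<in> op_\<Gamma>\<^sub>1 A\<^sub>0 P \<Lambda> \<and> g\<^sub>1 = \<i> *\<^sub>C g\<^sub>0}"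

section \<open>Sobolev functions on the half-lines\<close>

definition represents :: "(real \<Rightarrow> 'e) \<Rightarrow> ('s::real_domain, 'e::complex_inner) L2 \<Rightarrow> bool" where
  "represents w v \<longleftrightarrow> (AE x in domain_measure TYPE('s). rep_L2 v x = w x)"

text \<open>\<open>W\<^sup>1\<^sub>2\<close> consists of the square integrable functions with a locally absolutely continuous
  representative whose derivative is square integrable. \<open>sobolev_deriv\<close> is the graph of
  \<open>v \<mapsto> v'\<close> with domain \<open>W\<^sup>1\<^sub>2\<close>. For locally Bochner integrable functions, such as
  representatives of elements of \<open>L2\<close>, the Henstock-Kurzweil integral \<open>has_integral\<close> agrees with
  the Bochner integral; the library's version of the latter needs a separable target type.\<close>

definition sobolev_deriv ::
  "(('s::real_domain, 'e::complex_inner) L2 \<times> ('s, 'e) L2) set" where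
  "sobolev_deriv = {(v, v'). \<exists>w g. represents w v \<and> represents g v' \<and>
     (\<forall>a b. a \<le> b \<and> {a..b} \<subseteq> domain_set TYPE('s) \<longrightarrow> (g has_integral (w b - w a)) {a..b})}"

text \<open>The graph of \<open>v \<mapsto> v(0)\<close>, the value at 0 of the continuous representative (both half-lines
  contain their end point, so this representative is unique there).\<close>

definition sobolev_trace :: "(('s::real_domain, 'e::complex_inner) L2 \<times> 'e) set" where
  "sobolev_trace =
     {(v, e). \<exists>w. represents w v \<and> continuous_on (domain_set TYPE('s)) w \<and> w 0 = e}"

section \<open>The dilation\<close>

type_synonym ('h, 'e) dilation_space = "(rminus, 'e) L2 \<times> 'h \<times> (rplus, 'e) L2"

definition embed_H :: "'h \<Rightarrow> ('h::complex_inner, 'e::complex_inner) dilation_space" where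
  "embed_H u = (0, u, 0)"

text \<open>The orthogonal projection onto \<open>range embed_H\<close>, followed by the identification of that
  range with \<open>'h\<close>.\<close>

definition proj_H :: "('h::complex_inner, 'e::complex_inner) dilation_space \<Rightarrow> 'h" where
  "proj_H = (\<lambda>(v\<^sub>m, u, v\<^sub>p). u)"

lemma proj_H_embed_H: "proj_H (embed_H u) = u"
  by (simp add: proj_H_def embed_H_def)

lemma cinner_diff_proj_H: "cinner (V - embed_H (proj_H V)) (embed_H u) = 0"
  by (cases V) (simp add: proj_H_def embed_H_def cinner_prod_def
      bounded_bilinear.zero_left[OF bounded_bilinear_cinner]
      bounded_bilinear.zero_right[OF bounded_bilinear_cinner])

definition dilation_op :: "('h::complex_inner \<times> 'h) set \<Rightarrow> ('e::complex_inner \<Rightarrow> 'h) \<Rightarrow>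
    ('e \<times> 'e) set \<Rightarrow> (('h, 'e) dilation_space \<times> ('h, 'e) dilation_space) set"
  where "dilation_op A\<^sub>0 P \<Lambda> =
    {((v\<^sub>m, u, v\<^sub>p), (\<i> *\<^sub>C v\<^sub>m', f, \<i> *\<^sub>C v\<^sub>p')) | v\<^sub>m v\<^sub>m' u f v\<^sub>p v\<^sub>p'.
       (v\<^sub>m, v\<^sub>m') \<in> sobolev_deriv \<and> (v\<^sub>p, v\<^sub>p') \<in> sobolev_deriv \<and> (u, f) \<in> op_A A\<^sub>0 P \<and>
       (\<exists>g\<^sub>0 g\<^sub>1 e\<^sub>m e\<^sub>p. (u, g\<^sub>0) \<in> op_\<Gamma>\<^sub>0 A\<^sub>0 P \<and> (u, g\<^sub>1) \<in> op_\<Gamma>\<^sub>1 A\<^sub>0 P \<Lambda> \<and>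
          (v\<^sub>m, e\<^sub>m) \<in> sobolev_trace \<and> (v\<^sub>p, e\<^sub>p) \<in> sobolev_trace \<and>
          g\<^sub>1 + \<i> *\<^sub>C g\<^sub>0 = sqrt 2 *\<^sub>R e\<^sub>p \<and> g\<^sub>1 - \<i> *\<^sub>C g\<^sub>0 = sqrt 2 *\<^sub>R e\<^sub>m)}"

end

theory Submission
  imports Defs
begin

text \<open>The dilation equals its adjoint. Symmetry combines Green's identity for the boundary triple with
  integration by parts on the half-lines. Conversely, for \<open>(y\<^sub>-, y, y\<^sub>+)\<close> in the domain of the adjoint
  with image \<open>(k\<^sub>-, k, k\<^sub>+)\<close>, testing with trace-free Sobolev functions shows that \<open>y\<^sub>\<plusminus>\<close> are Sobolev
  functions with \<open>\<i> y\<^sub>\<plusminus>' = k\<^sub>\<plusminus>\<close>. Testing with functions of arbitrary trace then forces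
  \<open>y = A\<^sub>0\<^sup>-\<^sup>1 k + \<Pi> g\<^sub>0\<close>, where \<open>g\<^sub>0\<close> is read off from the traces, and \<open>\<Lambda> = \<Lambda>\<^sup>*\<close> yields the boundary
  conditions. So no perturbation theory for \<open>M z\<close> is needed, and every nonreal number is in the
  resolvent set. The compressed resolvent solves the equation for \<open>L\<close>, because for \<open>Im z < 0\<close> the
  incoming component of the resolvent applied to \<open>\<H>\<close> vanishes. For minimality, if \<open>y\<close> is orthogonal
  to the span, then the resolvents of the dilation map \<open>y\<close> to elements with zero middle component,
  hence with zero traces. Pairing with \<open>exp (- n \<bar>x\<bar>)\<close>, an eigenfunction at a suitable imaginary point,
  gives that the Laplace transforms of \<open>y\<^sub>\<plusminus>\<close> vanish at all positive integers, so \<open>y = 0\<close>.\<close>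

section \<open>Complex inner product spaces\<close>

text \<open>A sign \<sigma> treats both half-lines at once. Elements of \<open>L2\<close> are
  controlled by Lebesgue integrals of norms and inner products, whereas Sobolev derivatives are
  vector-valued gauge integrals. Integration by parts for \<open>cinner\<close> links the two;
  Green's identity, weak derivatives and traces are derived from it by testing with products of a
  scalar function and a vector. The factor \<open>sqrt 2\<close> and the signs in the boundary
  conditions make the boundary form of the triple equal to i times the difference of the trace forms
  at 0, exactly opposite to what the half-lines contribute. Equality with the adjoint is the main
  step for self-adjointness: every adjoint is linear, and density of the domain and
  single-valuedness both amount to the absence of pairs (0, W) with W nonzero. For L - z,
  surjectivity comes from the compression of the dilation, while injectivity and the bound on the
  inverse come from dissipativity.\<close>

lemmas cinner_zero_left [simp] = bounded_bilinear.zero_left[OF bounded_bilinear_cinner]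
  and cinner_zero_right [simp] = bounded_bilinear.zero_right[OF bounded_bilinear_cinner]
  and cinner_diff_left = bounded_bilinear.diff_left[OF bounded_bilinear_cinner]
  and cinner_diff_right = bounded_bilinear.diff_right[OF bounded_bilinear_cinner]
  and cinner_minus_right = bounded_bilinear.minus_right[OF bounded_bilinear_cinner]
  and scaleC_zero_right [simp] = linear_0[OF bounded_linear.linear[OF bounded_linear_scaleC]]
  and scaleC_diff_right = linear_diff[OF bounded_linear.linear[OF bounded_linear_scaleC]]
  and cinner_linear_left = bounded_bilinear.bounded_linear_left[OF bounded_bilinear_cinner]
  and cinner_linear_right = bounded_bilinear.bounded_linear_right[OF bounded_bilinear_cinner]
  and tendsto_cinner = bounded_bilinear.tendsto[OF bounded_bilinear_cinner]

lemma scaleC_zero_left [simp]: "0 *\<^sub>C x = (0::'a::complex_inner)"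
  using scaleC_of_real[of 0 x] by simp

lemma scaleC_one [simp]: "1 *\<^sub>C x = (x::'a::complex_inner)"
  using scaleC_of_real[of 1 x] by simp

lemma scaleC_uminus_one: "(- 1) *\<^sub>C x = - (x::'a::complex_inner)"
  using scaleC_of_real[of "-1" x] by simp

lemma scaleR_scaleC: "r *\<^sub>R x = complex_of_real r *\<^sub>C (x::'a::complex_inner)"
  by (simp add: scaleC_of_real)

lemma cinner_scaleR_left: "cinner (r *\<^sub>R x) y = complex_of_real r * cinner x (y::'a::complex_inner)"
  by (simp add: scaleR_scaleC cinner_scaleC_left)

lemma cinner_scaleR_right: "cinner x (r *\<^sub>R y) = complex_of_real r * cinner x (y::'a::complex_inner)"
  by (simp add: scaleR_scaleC cinner_scaleC_right)

lemma cinner_self_eq_0: "cinner x x = 0 \<longleftrightarrow> x = (0::'a::complex_inner)"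
  by (simp add: cinner_self)

lemma cinner_right_eq_zeroI: "(\<And>x. cinner x y = 0) \<Longrightarrow> y = (0::'a::complex_inner)"
  using cinner_self_eq_0 by blast

lemma cinner_right_eqI: "(\<And>x. cinner x y = cinner x z) \<Longrightarrow> y = (z::'a::complex_inner)"
  using cinner_right_eq_zeroI[of "y - z"] by (simp add: cinner_diff_right)

lemma csubspace_add: "csubspace S \<Longrightarrow> x \<in> S \<Longrightarrow> y \<in> S \<Longrightarrow> x + y \<in> S"
  and csubspace_scaleC: "csubspace S \<Longrightarrow> x \<in> S \<Longrightarrow> c *\<^sub>C x \<in> S"
  and csubspace_zero: "csubspace S \<Longrightarrow> 0 \<in> S"
  by (auto simp: csubspace_def)

lemma csubspace_diff: "csubspace S \<Longrightarrow> x \<in> S \<Longrightarrow> y \<in> S \<Longrightarrow> x - y \<in> S"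
  using csubspace_add[of S x "(-1) *\<^sub>C y"] csubspace_scaleC[of S y "-1"]
  by (simp add: scaleC_uminus_one)

lemma csubspace_hull: "csubspace (csubspace hull X)"
  by (rule hull_in) (auto simp: csubspace_def)

section \<open>Orthogonality and duality in Hilbert spaces\<close>

text \<open>The best multiple of s lowers the squared norm of e by the square of
  \<open>inner e s\<close> divided by \<open>inner s s\<close>, so minimality leaves nothing to
  subtract.\<close>

lemma orthogonal_if_distance_minimal:
  fixes e s :: "'a::real_inner"
  assumes "\<And>t::real. norm e \<le> norm (e - t *\<^sub>R s)"
  shows "inner e s = 0"
proof (cases "s = 0")
  case False
  define t where "t = inner e s / inner s s"
  have ss: "inner s s > 0" using False by simp
  have "(norm (e - t *\<^sub>R s))\<^sup>2 = inner e e - 2 * t * inner e s + t * t * inner s s"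
    by (simp add: power2_norm_eq_inner inner_diff_left inner_diff_right inner_commute algebra_simps)
  also have "\<dots> = (norm e)\<^sup>2 - (inner e s)\<^sup>2 / inner s s"
    unfolding power2_norm_eq_inner t_def using ss by (simp add: field_simps power2_eq_square)
  finally have "(norm (e - t *\<^sub>R s))\<^sup>2 = (norm e)\<^sup>2 - (inner e s)\<^sup>2 / inner s s" .
  moreover have "(norm e)\<^sup>2 \<le> (norm (e - t *\<^sub>R s))\<^sup>2"
    by (intro power_mono assms norm_ge_zero)
  ultimately have "(inner e s)\<^sup>2 / inner s s \<le> 0" by simp
  then have "(inner e s)\<^sup>2 \<le> 0" using ss by (simp add: divide_le_0_iff)
  then show ?thesis by simp
qed simp

text \<open>The subspace need not be closed, so the infimum of the distances is attained only in the
  closure. Competitors p + s with s in S are all that the orthogonality argument compares p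
  with.\<close>

lemma exists_nearest_in_closure:
  fixes S :: "'a::complex_hilbert set"
  assumes S: "csubspace S"
  shows "\<exists>p\<in>closure S. \<forall>s\<in>S. norm (x - p) \<le> norm (x - p - s)"
proof -
  define d where "d = (INF s\<in>S. norm (x - s))"
  have ne: "S \<noteq> {}" using csubspace_zero[OF S] by auto
  have bdd: "bdd_below ((\<lambda>s. norm (x - s)) ` S)" by (rule bdd_belowI[of _ 0]) auto
  have d_le: "d \<le> norm (x - s)" if "s \<in> S" for s
    unfolding d_def by (rule cINF_lower[OF bdd that])
  have d0: "0 \<le> d" unfolding d_def by (rule cINF_greatest[OF ne]) auto
  have "\<exists>s\<in>S. norm (x - s) < d + 1 / Suc n" for n
    using cINF_less_iff[OF ne bdd, of "d + 1 / Suc n"] by (simp add: d_def)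
  then obtain s where s: "\<And>n. s n \<in> S" "\<And>n. norm (x - s n) < d + 1 / Suc n" by metis
  have lim: "(\<lambda>n. norm (x - s n)) \<longlonglongrightarrow> d"
  proof (rule tendsto_sandwich[of "\<lambda>_. d" _ _ "\<lambda>n. d + 1 / Suc n"])
    show "(\<lambda>n. d + 1 / Suc n) \<longlonglongrightarrow> d"
      using tendsto_add[OF tendsto_const[of d] LIMSEQ_inverse_real_of_nat]
      by (simp add: inverse_eq_divide)
  qed (use s d_le in \<open>auto intro!: always_eventually less_imp_le\<close>)
  \<comment> \<open>Parallelogram law: the midpoint of two almost optimal points lies in S and is
    itself no closer than d, so the two points are close to each other.\<close>
  have para: "(norm (s m - s n))\<^sup>2 \<le> 2 * (norm (x - s m))\<^sup>2 + 2 * (norm (x - s n))\<^sup>2 - 4 * d\<^sup>2" for m n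
  proof -
    define c where "c = (1/2) *\<^sub>R (s m + s n)"
    have "c \<in> S" unfolding c_def scaleR_scaleC
      by (intro csubspace_scaleC csubspace_add S s)
    then have "d\<^sup>2 \<le> (norm (x - c))\<^sup>2" by (intro power_mono d_le d0)
    moreover have "(norm (s m - s n))\<^sup>2 + 4 * (norm (x - c))\<^sup>2 = 2 * (norm (x - s m))\<^sup>2 + 2 * (norm (x - s n))\<^sup>2"
      by (simp add: c_def power2_norm_eq_inner inner_diff_left inner_diff_right inner_add_left
          inner_add_right inner_commute algebra_simps)
    ultimately show ?thesis by simp
  qed
  have "Cauchy s"
  proof (rule CauchyI)
    fix e :: real assume e: "e > 0"
    have "(\<lambda>n. (norm (x - s n))\<^sup>2) \<longlonglongrightarrow> d\<^sup>2" by (intro tendsto_intros lim)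
    then have "\<forall>\<^sub>F n in sequentially. (norm (x - s n))\<^sup>2 < d\<^sup>2 + e\<^sup>2 / 4"
      by (rule order_tendstoD) (use e in simp)
    then obtain N where N: "\<And>n. n \<ge> N \<Longrightarrow> (norm (x - s n))\<^sup>2 < d\<^sup>2 + e\<^sup>2 / 4"
      by (auto simp: eventually_sequentially)
    have "norm (s m - s n) < e" if "m \<ge> N" "n \<ge> N" for m n
    proof (rule power2_less_imp_less)
      show "(norm (s m - s n))\<^sup>2 < e\<^sup>2" using para[of m n] N[OF that(1)] N[OF that(2)] by simp
    qed (use e in simp)
    then show "\<exists>M. \<forall>m\<ge>M. \<forall>n\<ge>M. norm (s m - s n) < e" by blast
  qed
  then obtain p where p: "s \<longlonglongrightarrow> p" by (auto simp: Cauchy_convergent_iff convergent_def)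
  have dp: "norm (x - p) = d"
    by (rule LIMSEQ_unique[OF _ lim]) (intro tendsto_intros p)
  have "norm (x - p) \<le> norm (x - p - t)" if "t \<in> S" for t
  proof -
    have "(\<lambda>n. norm (x - (s n + t))) \<longlonglongrightarrow> norm (x - (p + t))" by (intro tendsto_intros p)
    moreover have "d \<le> norm (x - (s n + t))" for n by (intro d_le csubspace_add S s that)
    ultimately have "d \<le> norm (x - (p + t))" by (meson LIMSEQ_le_const)
    then show ?thesis by (simp add: dp algebra_simps)
  qed
  moreover have "p \<in> closure S" using p s(1) closure_sequential by blast
  ultimately show ?thesis by blast
qed

lemma closure_eq_UNIV_if_orthogonal_trivial:
  fixes S :: "'a::complex_hilbert set"
  assumes S: "csubspace S" and "\<And>y. (\<And>x. x \<in> S \<Longrightarrow> cinner x y = 0) \<Longrightarrow> y = 0"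
  shows "closure S = UNIV"
proof -
  have "x \<in> closure S" for x
  proof -
    obtain p where p: "p \<in> closure S" "\<And>s. s \<in> S \<Longrightarrow> norm (x - p) \<le> norm (x - p - s)"
      using exists_nearest_in_closure[OF S, of x] by blast
    have "inner (x - p) s = 0" if "s \<in> S" for s
      by (rule orthogonal_if_distance_minimal)
        (metis p(2) csubspace_scaleC[OF S that] scaleR_scaleC)
    then have re: "Re (cinner s (x - p)) = 0" if "s \<in> S" for s
      using that by (simp add: Re_cinner inner_commute)
    \<comment> \<open>Minimality only controls the real part; the imaginary part for s is, up to
      sign, the real part for \<open>\<i> *\<^sub>C s\<close>.\<close>
    have "cinner s (x - p) = 0" if "s \<in> S" for s
      using re[OF that] re[OF csubspace_scaleC[OF S that, of "\<i>"]]
      by (simp add: cinner_scaleC_left complex_eq_iff)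
    then have "x - p = 0" by (rule assms(2))
    with p(1) show ?thesis by simp
  qed
  then show ?thesis by blast
qed

text \<open>The kernel is closed and proper, hence some nonzero y is orthogonal to it. Subtracting F
  x / F y times y moves x into the kernel, so F is determined by \<open>cinner x y\<close>.\<close>

lemma riesz_representation:
  fixes F :: "'a::complex_hilbert \<Rightarrow> complex"
  assumes F: "bounded_linear F" and hom: "\<And>c x. F (c *\<^sub>C x) = c * F x"
  shows "\<exists>z. \<forall>x. F x = cinner x z"
proof (cases "\<forall>x. F x = 0")
  case True then show ?thesis by (intro exI[of _ 0]) simp
next
  case False
  interpret F: bounded_linear F by (rule F)
  define N where "N = {x. F x = 0}"
  have N: "csubspace N" by (auto simp: N_def csubspace_def F.add F.zero hom)
  have "closed (F -` {0})" by (intro continuous_closed_vimage F.isCont) auto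
  then have "closure N = N" by (simp add: N_def vimage_def closure_closed)
  then have "closure N \<noteq> UNIV" using False by (auto simp: N_def)
  then obtain y where y: "\<And>x. x \<in> N \<Longrightarrow> cinner x y = 0" "y \<noteq> 0"
    using closure_eq_UNIV_if_orthogonal_trivial[OF N] by blast
  have Fy: "F y \<noteq> 0" using y cinner_self_eq_0 by (auto simp: N_def)
  have "F x = cinner x ((cnj (F y) / cinner y y) *\<^sub>C y)" for x
  proof -
    have "x - (F x / F y) *\<^sub>C y \<in> N" using Fy by (simp add: N_def F.diff hom)
    from y(1)[OF this] have "cinner x y = F x / F y * cinner y y"
      by (simp add: cinner_diff_left cinner_scaleC_left)
    then show ?thesis
      using Fy y(2) by (simp add: cinner_scaleC_right cinner_commute[of y y, symmetric] cinner_self_eq_0)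
  qed
  then show ?thesis by blast
qed

lemma cinner_bounded_adjoint:
  fixes R :: "'a::complex_hilbert \<Rightarrow> 'b::complex_inner"
  assumes R: "bounded_clinear R"
  shows "cinner (R x) y = cinner x (bounded_adjoint R y)"
proof -
  have "bounded_linear (\<lambda>x. cinner (R x) y)"
    using R bounded_linear_compose[OF cinner_linear_left] by (auto simp: bounded_clinear_def)
  moreover have "cinner (R (c *\<^sub>C x)) y = c * cinner (R x) y" for c x
    using R by (simp add: bounded_clinear_def cinner_scaleC_left)
  ultimately obtain z where z: "\<And>x. cinner (R x) y = cinner x z"
    using riesz_representation[of "\<lambda>x. cinner (R x) y"] by auto
  have "bounded_adjoint R y = z"
    unfolding bounded_adjoint_def
    by (rule the_equality) (auto simp: z intro: cinner_right_eqI)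
  with z show ?thesis by simp
qed

section \<open>Resolvents of operator graphs\<close>

text \<open>Through this, equality of the dilation with its adjoint already makes its graph
  linear.\<close>

lemma csubspace_op_adjoint: "csubspace (op_adjoint T)"
  by (fastforce simp: csubspace_def op_adjoint_def cinner_add_right cinner_scaleC_right
      scaleC_prod_def zero_prod_def)

lemma selfadjoint_symmetric:
  "selfadjoint_operator T \<Longrightarrow> (u, f) \<in> T \<Longrightarrow> (v, g) \<in> T \<Longrightarrow> cinner f v = cinner u g"
  unfolding selfadjoint_operator_def op_adjoint_def by blast

lemma selfadjoint_memI:
  "selfadjoint_operator T \<Longrightarrow> (\<And>x w. (x, w) \<in> T \<Longrightarrow> cinner w y = cinner x z) \<Longrightarrow> (y, z) \<in> T"
  unfolding selfadjoint_operator_def op_adjoint_def by blast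

lemma selfadjoint_csubspace: "selfadjoint_operator T \<Longrightarrow> csubspace T"
  by (simp add: selfadjoint_operator_def linear_operator_def)

lemma csubspace_graph_add: "csubspace T \<Longrightarrow> (u, f) \<in> T \<Longrightarrow> (v, g) \<in> T \<Longrightarrow> (u + v, f + g) \<in> T"
  using csubspace_add[of T "(u, f)" "(v, g)"] by simp

lemma csubspace_graph_diff: "csubspace T \<Longrightarrow> (u, f) \<in> T \<Longrightarrow> (v, g) \<in> T \<Longrightarrow> (u - v, f - g) \<in> T"
  using csubspace_diff[of T "(u, f)" "(v, g)"] by simp

lemma csubspace_graph_scaleC: "csubspace T \<Longrightarrow> (u, f) \<in> T \<Longrightarrow> (c *\<^sub>C u, c *\<^sub>C f) \<in> T"
  using csubspace_scaleC[of T "(u, f)" c] by (simp add: scaleC_prod_def)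

lemma csubspace_Domain:
  assumes T: "csubspace T"
  shows "csubspace (Domain T)"
  unfolding csubspace_def
proof (intro conjI ballI allI)
  show "0 \<in> Domain T" using csubspace_zero[OF T] by (auto simp: zero_prod_def)
  fix x c assume "x \<in> Domain T"
  then obtain f where f: "(x, f) \<in> T" by blast
  then show "c *\<^sub>C x \<in> Domain T" using csubspace_graph_scaleC[OF T f, of c] by blast
  fix y assume "y \<in> Domain T"
  then obtain g where "(y, g) \<in> T" by blast
  then show "x + y \<in> Domain T" using csubspace_graph_add[OF T f] by blast
qed

lemma mem_op_shift_iff: "(u, h) \<in> op_shift T z \<longleftrightarrow> (u, h + z *\<^sub>C u) \<in> T"
  by (force simp: op_shift_def)

text \<open>The lower bound makes solutions unique, so any choice of solutions is automatically
  linear, and it bounds the choice by 1 / c. Applied to self-adjoint operators and to L.\<close>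

lemma resolvent_setI:
  fixes T :: "('a::complex_inner \<times> 'a) set"
  assumes T: "csubspace T" and c: "c > 0"
    and low: "\<And>u f. (u, f) \<in> T \<Longrightarrow> c * norm u \<le> norm (f - z *\<^sub>C u)"
    and surj: "\<And>h. \<exists>u. (u, h + z *\<^sub>C u) \<in> T"
  shows "z \<in> resolvent_set T"
proof -
  obtain R where R: "\<And>h. (R h, h + z *\<^sub>C R h) \<in> T" using surj by metis
  have uniq: "u = R h" if "(u, h + z *\<^sub>C u) \<in> T" for u h
  proof -
    have "(u - R h, z *\<^sub>C (u - R h)) \<in> T"
      using csubspace_graph_diff[OF T that R[of h]] by (simp add: scaleC_diff_right)
    from low[OF this] have "c * norm (u - R h) \<le> 0" by simp
    then show ?thesis using c by (simp add: mult_le_0_iff)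
  qed
  have add: "R (x + y) = R x + R y" for x y
    by (rule uniq[symmetric])
       (use csubspace_graph_add[OF T R[of x] R[of y]] in \<open>simp add: scaleC_add_right algebra_simps\<close>)
  have scale: "R (d *\<^sub>C x) = d *\<^sub>C R x" for d x
    by (rule uniq[symmetric])
       (use csubspace_graph_scaleC[OF T R[of x], of d] in
         \<open>simp add: scaleC_add_right scaleC_scaleC mult.commute\<close>)
  have "bounded_linear R"
  proof (rule bounded_linear_intro[where K="1 / c"])
    show "norm (R x) \<le> norm x * (1 / c)" for x
      using low[OF R[of x]] c by (simp add: field_simps)
  qed (simp_all add: add scale scaleR_scaleC)
  then have "bounded_clinear R" by (simp add: bounded_clinear_def scale)
  moreover have "(op_shift T z)\<inverse> = {(h, R h) | h. True}"
    using R uniq by (auto simp: mem_op_shift_iff)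
  ultimately show ?thesis unfolding resolvent_set_def by blast
qed

lemma
  fixes T :: "('a::complex_inner \<times> 'a) set"
  assumes z: "z \<in> resolvent_set T"
  shows resolvent_mem: "(resolvent T z h, h + z *\<^sub>C resolvent T z h) \<in> T"
    and resolvent_eqI: "(u, h + z *\<^sub>C u) \<in> T \<Longrightarrow> resolvent T z h = u"
    and bounded_clinear_resolvent: "bounded_clinear (resolvent T z)"
proof -
  obtain R where R: "bounded_clinear R" "(op_shift T z)\<inverse> = {(h, R h) | h. True}"
    using z by (auto simp: resolvent_set_def)
  have iff: "(u, h) \<in> op_shift T z \<longleftrightarrow> u = R h" for u h
  proof -
    have "(u, h) \<in> op_shift T z \<longleftrightarrow> (h, u) \<in> (op_shift T z)\<inverse>" by simp
    also have "\<dots> \<longleftrightarrow> u = R h" unfolding R(2) by auto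
    finally show ?thesis .
  qed
  have eq: "resolvent T z = R" by (simp add: resolvent_def iff fun_eq_iff)
  show "(resolvent T z h, h + z *\<^sub>C resolvent T z h) \<in> T"
    using iff[of "R h" h] by (simp add: eq mem_op_shift_iff)
  show "(u, h + z *\<^sub>C u) \<in> T \<Longrightarrow> resolvent T z h = u"
    using iff[of u h] by (simp add: eq mem_op_shift_iff)
  show "bounded_clinear (resolvent T z)" by (simp add: eq R)
qed

text \<open>Cauchy-Schwarz bounds the imaginary part by the product of the norms, and one factor
  \<open>norm u\<close> cancels. This turns a numerical range estimate into a lower bound for T -
  z.\<close>

lemma norm_le_if_Im_cinner:
  fixes u h :: "'a::complex_inner"
  assumes "c * (norm u)\<^sup>2 \<le> \<bar>Im (cinner h u)\<bar>"
  shows "c * norm u \<le> norm h"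
proof (cases "u = 0")
  case False
  have "c * (norm u)\<^sup>2 \<le> norm h * norm u"
    using assms abs_Im_le_cmod[of "cinner h u"] cmod_cinner_le[of h u] by linarith
  then have "(c * norm u) * norm u \<le> norm h * norm u" by (simp add: power2_eq_square mult_ac)
  then show ?thesis using False by simp
qed simp

lemma selfadjoint_lower_bound:
  assumes T: "selfadjoint_operator T" and uf: "(u, f) \<in> T"
  shows "\<bar>Im z\<bar> * norm u \<le> norm (f - z *\<^sub>C u)"
proof (rule norm_le_if_Im_cinner)
  have "cinner f u = cnj (cinner f u)"
    using selfadjoint_symmetric[OF T uf uf] cinner_commute[of u f] by simp
  then have "Im (cinner f u) = 0" by (simp add: complex_eq_iff)
  then have "Im (cinner (f - z *\<^sub>C u) u) = - (Im z * (norm u)\<^sup>2)"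
    by (simp add: cinner_diff_left cinner_scaleC_left cinner_self flip: of_real_power)
  then show "\<bar>Im z\<bar> * (norm u)\<^sup>2 \<le> \<bar>Im (cinner (f - z *\<^sub>C u) u)\<bar>" by (simp add: abs_mult)
qed

text \<open>A vector orthogonal to the range of T - z is an eigenvector of the adjoint, that is of
  T, for \<open>cnj z\<close>, and the lower bound excludes it; so the range is dense. The lower
  bound also makes preimages of a Cauchy sequence Cauchy, and their limit stays in the graph because
  an adjoint is closed.\<close>

lemma nonreal_in_resolvent_set:
  fixes T :: "('a::complex_hilbert \<times> 'a) set"
  assumes T: "selfadjoint_operator T" and z: "Im z \<noteq> 0"
  shows "z \<in> resolvent_set T"
proof (rule resolvent_setI[where c="\<bar>Im z\<bar>"])
  note sub = selfadjoint_csubspace[OF T]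
  show "csubspace T" by (rule sub)
  show "\<bar>Im z\<bar> > 0" using z by simp
  show "\<And>u f. (u, f) \<in> T \<Longrightarrow> \<bar>Im z\<bar> * norm u \<le> norm (f - z *\<^sub>C u)"
    by (rule selfadjoint_lower_bound[OF T])
  fix h
  define S where "S = {f - z *\<^sub>C u | u f. (u, f) \<in> T}"
  have S: "csubspace S"
    unfolding csubspace_def
  proof (intro conjI ballI allI)
    have "(0, 0) \<in> T" using csubspace_zero[OF sub] by (simp add: zero_prod_def)
    then show "0 \<in> S" unfolding S_def mem_Collect_eq by (intro exI[of _ 0]) simp
    fix x c assume "x \<in> S"
    then obtain u f where uf: "x = f - z *\<^sub>C u" "(u, f) \<in> T" by (auto simp: S_def)
    have "c *\<^sub>C x = c *\<^sub>C f - z *\<^sub>C (c *\<^sub>C u)"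
      by (simp add: uf scaleC_diff_right scaleC_scaleC mult.commute)
    then show "c *\<^sub>C x \<in> S" unfolding S_def using csubspace_graph_scaleC[OF sub uf(2)] by blast
    fix y assume "y \<in> S"
    then obtain v g where vg: "y = g - z *\<^sub>C v" "(v, g) \<in> T" by (auto simp: S_def)
    have "x + y = (f + g) - z *\<^sub>C (u + v)" by (simp add: uf vg scaleC_add_right)
    then show "x + y \<in> S" unfolding S_def using csubspace_graph_add[OF sub uf(2) vg(2)] by blast
  qed
  have "closure S = UNIV"
  proof (rule closure_eq_UNIV_if_orthogonal_trivial[OF S])
    fix y assume y: "\<And>x. x \<in> S \<Longrightarrow> cinner x y = 0"
    have "(y, cnj z *\<^sub>C y) \<in> T"
    proof (rule selfadjoint_memI[OF T])
      fix x w assume "(x, w) \<in> T"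
      then have "cinner (w - z *\<^sub>C x) y = 0" using y by (auto simp: S_def)
      then show "cinner w y = cinner x (cnj z *\<^sub>C y)"
        by (simp add: cinner_diff_left cinner_scaleC_left cinner_scaleC_right)
    qed
    from selfadjoint_lower_bound[OF T this, of "cnj z"] show "y = 0"
      using z by (simp add: mult_le_0_iff)
  qed
  then have "h \<in> closure S" by simp
  then obtain k where k: "\<And>n. k n \<in> S" "k \<longlonglongrightarrow> h" using closure_sequential by metis
  have "\<forall>n. \<exists>u. (u, k n + z *\<^sub>C u) \<in> T"
  proof
    fix n
    obtain u f where "k n = f - z *\<^sub>C u" "(u, f) \<in> T" using k(1)[of n] by (auto simp: S_def)
    then show "\<exists>u. (u, k n + z *\<^sub>C u) \<in> T" by (intro exI[of _ u]) simp
  qed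
  then obtain u where u: "\<And>n. (u n, k n + z *\<^sub>C u n) \<in> T" by metis
  have diff: "\<bar>Im z\<bar> * norm (u m - u n) \<le> norm (k m - k n)" for m n
    using selfadjoint_lower_bound[OF T csubspace_graph_diff[OF sub u[of m] u[of n]], of z]
    by (simp add: scaleC_diff_right algebra_simps)
  have "Cauchy u"
  proof (rule CauchyI)
    fix e :: real assume e: "e > 0"
    have "Cauchy k" by (rule LIMSEQ_imp_Cauchy[OF k(2)])
    then obtain M where M: "\<And>m n. m \<ge> M \<Longrightarrow> n \<ge> M \<Longrightarrow> norm (k m - k n) < \<bar>Im z\<bar> * e"
      using CauchyD[of k "\<bar>Im z\<bar> * e"] e z by auto
    have "norm (u m - u n) < e" if "m \<ge> M" "n \<ge> M" for m n
    proof -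
      have "\<bar>Im z\<bar> * norm (u m - u n) < \<bar>Im z\<bar> * e" using diff[of m n] M[OF that] by simp
      then show ?thesis using z by simp
    qed
    then show "\<exists>M. \<forall>m\<ge>M. \<forall>n\<ge>M. norm (u m - u n) < e" by blast
  qed
  then obtain v where v: "u \<longlonglongrightarrow> v" by (auto simp: Cauchy_convergent_iff convergent_def)
  have "(v, h + z *\<^sub>C v) \<in> T"
  proof (rule selfadjoint_memI[OF T])
    fix x w assume xw: "(x, w) \<in> T"
    have eq: "cinner w (u n) = cinner x (k n + z *\<^sub>C u n)" for n
      by (rule selfadjoint_symmetric[OF T xw u])
    have "(\<lambda>n. cinner w (u n)) \<longlonglongrightarrow> cinner w v" by (intro tendsto_cinner tendsto_intros v)
    moreover have "(\<lambda>n. cinner x (k n + z *\<^sub>C u n)) \<longlonglongrightarrow> cinner x (h + z *\<^sub>C v)"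
      by (intro tendsto_cinner tendsto_intros k v bounded_linear.tendsto[OF bounded_linear_scaleC])
    ultimately show "cinner w v = cinner x (h + z *\<^sub>C v)"
      unfolding eq by (rule LIMSEQ_unique)
  qed
  then show "\<exists>u. (u, h + z *\<^sub>C u) \<in> T" by blast
qed

section \<open>Integration of strongly measurable functions on intervals\<close>

abbreviation lborel_on :: "real set \<Rightarrow> real measure" where
  "lborel_on A \<equiv> restrict_space lborel A"

text \<open>Bridge from the Lebesgue integrals behind \<open>L2\<close> to the gauge integral behind
  \<open>sobolev_deriv\<close>, for scalar and other Euclidean targets.\<close>

lemma has_integral_lborel_on:
  fixes f :: "real \<Rightarrow> 'b::euclidean_space"
  assumes "A \<in> sets borel" "integrable (lborel_on A) f"
  shows "(f has_integral (\<integral>x. f x \<partial>lborel_on A)) A"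
proof -
  have "set_integrable lborel A f"
    using assms by (simp add: set_integrable_def integrable_restrict_space)
  moreover have "(\<integral>x. f x \<partial>lborel_on A) = (LINT x:A|lborel. f x)"
    using assms(1) by (simp add: integral_restrict_space set_lebesgue_integral_def)
  ultimately show ?thesis
    using set_borel_integral_eq_integral[of A f] by (auto simp: has_integral_integrable_integral)
qed

lemma integrable_lborel_on_subset:
  fixes f :: "real \<Rightarrow> 'b::euclidean_space"
  assumes "integrable (lborel_on B) f" "A \<subseteq> B" "A \<in> sets borel" "B \<in> sets borel"
  shows "integrable (lborel_on A) f"
  using set_integrable_subset[of lborel B f A] assms
  by (simp add: set_integrable_def integrable_restrict_space)

lemma strongly_measurable_lborel_on_subset:
  assumes "strongly_measurable (lborel_on B) f" "A \<subseteq> B"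
  shows "strongly_measurable (lborel_on A) f"
proof -
  have id: "(\<lambda>x. x) \<in> measurable (lborel_on A) (lborel_on B)"
    by (rule measurable_restrict_space3) (use assms(2) in auto)
  obtain s where s: "\<And>n. simple_function (lborel_on B) (s n)"
    "\<And>x. x \<in> space (lborel_on B) \<Longrightarrow> (\<lambda>n. s n x) \<longlonglongrightarrow> f x"
    using assms(1) unfolding strongly_measurable_def by blast
  have "(\<lambda>n. s n x) \<longlonglongrightarrow> f x" if "x \<in> space (lborel_on A)" for x
    using that assms(2) by (intro s(2)) (auto simp: space_restrict_space)
  with simple_function_comp[OF id s(1)] show ?thesis
    unfolding strongly_measurable_def by (intro exI[of _ s]) simp
qed

lemma strongly_measurable_cong:
  assumes "strongly_measurable M f" "\<And>x. x \<in> space M \<Longrightarrow> f x = g x"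
  shows "strongly_measurable M g"
proof -
  obtain s where s: "\<And>n. simple_function M (s n)" "\<And>x. x \<in> space M \<Longrightarrow> (\<lambda>n. s n x) \<longlonglongrightarrow> f x"
    using assms(1) unfolding strongly_measurable_def by blast
  have "(\<lambda>n. s n x) \<longlonglongrightarrow> g x" if "x \<in> space M" for x
    using s(2)[OF that] unfolding assms(2)[OF that] .
  with s(1) show ?thesis unfolding strongly_measurable_def by (intro exI[of _ s]) simp
qed

text \<open>Composing with the retraction extends u continuously to the whole line, and simple
  approximants of the identity then give simple approximants of u. Used for compact intervals and
  for half-lines.\<close>

lemma strongly_measurable_continuous_retract:
  fixes u :: "real \<Rightarrow> 'b::real_normed_vector"
  assumes "continuous_on A u" and r: "continuous_on UNIV r" "range r \<subseteq> A" "\<And>x. x \<in> A \<Longrightarrow> r x = x"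
  shows "strongly_measurable (lborel_on A) u"
proof (rule strongly_measurable_cong)
  have "(\<lambda>x. x) \<in> borel_measurable (lborel_on A)" by (simp add: measurable_restrict_space1)
  from borel_measurable_implies_sequence_metric[OF this]
  have id: "strongly_measurable (lborel_on A) (\<lambda>x. x)"
    unfolding strongly_measurable_def by blast
  have "continuous_on UNIV (\<lambda>x. u (r x))"
    using continuous_on_compose2[OF assms(1) r(1,2)] .
  then have "isCont (\<lambda>x. u (r x)) x" for x by (simp add: continuous_on_eq_continuous_at)
  from strongly_measurable_compose[OF id this]
  show "strongly_measurable (lborel_on A) (\<lambda>x. u (r x))" .
qed (simp add: space_restrict_space r(3))

lemma strongly_measurable_continuous:
  fixes u :: "real \<Rightarrow> 'b::real_normed_vector"
  assumes "continuous_on {a..b} u" "a \<le> b"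
  shows "strongly_measurable (lborel_on {a..b}) u"
  by (rule strongly_measurable_continuous_retract[OF assms(1), of "\<lambda>x. max a (min b x)"])
    (use assms(2) in \<open>auto intro!: continuous_intros\<close>)

text \<open>Riemann sums of f and of s n differ in norm by at most a Riemann sum of
  \<open>norm (f x - s n x)\<close>, which is close to a small integral. With e / 8 for that
  integral and for both gauges, every fine sum of f is within 3 e / 8 of the integral of s n, which
  gives the Cauchy criterion.\<close>

lemma integrable_on_L1_limit:
  fixes f :: "real \<Rightarrow> 'b::banach"
  assumes s: "\<And>n. s n integrable_on {a..b}"
    and d: "\<And>n. (\<lambda>x. norm (f x - s n x)) integrable_on {a..b}"
    and lim: "(\<lambda>n. integral {a..b} (\<lambda>x. norm (f x - s n x))) \<longlonglongrightarrow> 0"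
  shows "f integrable_on {a..b}"
  unfolding box_real(2)[symmetric] integrable_Cauchy
proof (intro allI impI)
  fix e :: real assume e: "e > 0"
  have "\<forall>\<^sub>F n in sequentially. integral {a..b} (\<lambda>x. norm (f x - s n x)) < e / 8"
    by (rule order_tendstoD[OF lim]) (use e in simp)
  then obtain n where n: "integral {a..b} (\<lambda>x. norm (f x - s n x)) < e / 8"
    by (auto simp: eventually_sequentially)
  have n': "integral (cbox a b) (\<lambda>x. norm (f x - s n x)) < e / 8" using n by simp
  have e8: "e / 8 > 0" using e by simp
  obtain \<gamma>1 where 1: "gauge \<gamma>1" "\<And>\<D>. \<D> tagged_division_of cbox a b \<Longrightarrow> \<gamma>1 fine \<D> \<Longrightarrow>
      norm ((\<Sum>(x,K)\<in>\<D>. measure lborel K *\<^sub>R norm (f x - s n x)) -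
        integral (cbox a b) (\<lambda>x. norm (f x - s n x))) < e / 8"
    by (rule has_integralD[OF integrable_integral[OF d[of n, folded box_real(2)]] e8]) (rule that)
  obtain \<gamma>2 where 2: "gauge \<gamma>2" "\<And>\<D>. \<D> tagged_division_of cbox a b \<Longrightarrow> \<gamma>2 fine \<D> \<Longrightarrow>
      norm ((\<Sum>(x,K)\<in>\<D>. measure lborel K *\<^sub>R s n x) - integral (cbox a b) (s n)) < e / 8"
    by (rule has_integralD[OF integrable_integral[OF s[of n, folded box_real(2)]] e8]) (rule that)
  have est: "norm ((\<Sum>(x,K)\<in>\<D>. measure lborel K *\<^sub>R f x) - integral (cbox a b) (s n)) < 3 * e / 8"
    if D: "\<D> tagged_division_of cbox a b" "\<gamma>1 fine \<D>" "\<gamma>2 fine \<D>" for \<D>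
  proof -
    have "(\<Sum>(x,K)\<in>\<D>. measure lborel K *\<^sub>R f x) - (\<Sum>(x,K)\<in>\<D>. measure lborel K *\<^sub>R s n x) =
        (\<Sum>(x,K)\<in>\<D>. measure lborel K *\<^sub>R (f x - s n x))"
      by (simp add: sum_subtractf[symmetric] split_beta scaleR_diff_right)
    also have "norm \<dots> \<le> (\<Sum>(x,K)\<in>\<D>. measure lborel K *\<^sub>R norm (f x - s n x))"
      by (rule order_trans[OF norm_sum]) (auto intro!: sum_mono)
    also have "\<dots> < e / 4" using 1(2)[OF D(1,2)] n' by (simp only: real_norm_def abs_less_iff) linarith
    finally have "norm ((\<Sum>(x,K)\<in>\<D>. measure lborel K *\<^sub>R f x) - (\<Sum>(x,K)\<in>\<D>. measure lborel K *\<^sub>R s n x)) < e / 4" .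
    from norm_diff_triangle_less[OF this 2(2)[OF D(1,3)]] show ?thesis by simp
  qed
  show "\<exists>\<gamma>. gauge \<gamma> \<and> (\<forall>\<D>1 \<D>2. \<D>1 tagged_division_of cbox a b \<and> \<gamma> fine \<D>1 \<and>
      \<D>2 tagged_division_of cbox a b \<and> \<gamma> fine \<D>2 \<longrightarrow>
      norm ((\<Sum>(x,K)\<in>\<D>1. measure lborel K *\<^sub>R f x) - (\<Sum>(x,K)\<in>\<D>2. measure lborel K *\<^sub>R f x)) < e)"
  proof (intro exI[of _ "\<lambda>x. \<gamma>1 x \<inter> \<gamma>2 x"] conjI allI impI)
    show "gauge (\<lambda>x. \<gamma>1 x \<inter> \<gamma>2 x)" by (intro gauge_Int 1 2)
    fix \<D>1 \<D>2
    assume "\<D>1 tagged_division_of cbox a b \<and> (\<lambda>x. \<gamma>1 x \<inter> \<gamma>2 x) fine \<D>1 \<and>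
      \<D>2 tagged_division_of cbox a b \<and> (\<lambda>x. \<gamma>1 x \<inter> \<gamma>2 x) fine \<D>2"
    then have 12: "norm ((\<Sum>(x,K)\<in>\<D>1. measure lborel K *\<^sub>R f x) - integral (cbox a b) (s n)) < 3 * e / 8"
      "norm ((\<Sum>(x,K)\<in>\<D>2. measure lborel K *\<^sub>R f x) - integral (cbox a b) (s n)) < 3 * e / 8"
      by (intro est; simp add: fine_Int)+
    from norm_diff_triangle_less[OF 12(1) 12(2)[unfolded norm_minus_commute[of _ "integral (cbox a b) (s n)"]]] e
    show "norm ((\<Sum>(x,K)\<in>\<D>1. measure lborel K *\<^sub>R f x) - (\<Sum>(x,K)\<in>\<D>2. measure lborel K *\<^sub>R f x)) < e"
      by linarith
  qed
qed

lemma simple_function_integrable_on: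
  fixes s :: "real \<Rightarrow> 'b::banach"
  assumes s: "simple_function (lborel_on {a..b}) s"
  shows "s integrable_on {a..b}"
proof -
  define A where "A = (\<lambda>y. s -` {y} \<inter> {a..b})"
  have fin: "finite (s ` {a..b})" using s by (simp add: simple_function_def space_restrict_space)
  have "A y \<in> sets borel" if "y \<in> s ` {a..b}" for y
    using s that by (auto simp: simple_function_def space_restrict_space sets_restrict_space_iff A_def)
  then have "(\<lambda>x. indicator (A y) x :: real) integrable_on {a..b}" if "y \<in> s ` {a..b}" for y
  proof (intro set_borel_integral_eq_integral(1))
    have A: "A y \<in> sets lborel" "A y \<subseteq> {a..b}" using that \<open>\<And>y. y \<in> s ` {a..b} \<Longrightarrow> A y \<in> sets borel\<close>
      by (auto simp: A_def)
    have "emeasure lborel (A y) \<le> emeasure lborel {a..b}" by (rule emeasure_mono) (use A in auto)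
    also have "\<dots> < \<infinity>" by (simp add: emeasure_lborel_Icc_eq)
    finally show "set_integrable lborel {a..b} (\<lambda>x. indicator (A y) x :: real)"
      unfolding set_integrable_def
      by (intro integrable_mult_indicator integrable_real_indicator A) auto
  qed
  then have "(\<lambda>x. \<Sum>y\<in>s ` {a..b}. indicator (A y) x *\<^sub>R y) integrable_on {a..b}"
    by (intro integrable_sum fin integrable_on_scaleR_left) auto
  moreover have "(\<Sum>y\<in>s ` {a..b}. indicator (A y) x *\<^sub>R y) = s x" if "x \<in> {a..b}" for x
  proof -
    have "(\<Sum>y\<in>s ` {a..b}. indicator (A y) x *\<^sub>R y) = (\<Sum>y\<in>s ` {a..b}. if y = s x then s x else 0)"
      using that by (intro sum.cong) (auto simp: A_def indicator_def)
    also have "\<dots> = s x" using fin that by simp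
    finally show ?thesis .
  qed
  ultimately show ?thesis by (rule integrable_eq)
qed

text \<open>The simple approximants converge only pointwise. Setting s n to 0 wherever its norm
  exceeds twice that of f keeps the limit, also where f vanishes, and bounds the error by three
  times the norm of f; dominated convergence then gives convergence in L1.\<close>

lemma strongly_measurable_integrable_on:
  fixes f :: "real \<Rightarrow> 'b::banach"
  assumes f: "strongly_measurable (lborel_on {a..b}) f" "integrable (lborel_on {a..b}) (\<lambda>x. norm (f x))"
  shows "f integrable_on {a..b}"
proof -
  let ?M = "lborel_on {a..b}"
  obtain s where s: "\<And>n. simple_function ?M (s n)" "\<And>x. x \<in> space ?M \<Longrightarrow> (\<lambda>n. s n x) \<longlonglongrightarrow> f x"
    using f(1) unfolding strongly_measurable_def by blast
  define t where "t = (\<lambda>n x. if norm (s n x) \<le> 2 * norm (f x) then s n x else 0)"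
  have [measurable]: "(\<lambda>x. norm (f x)) \<in> borel_measurable ?M"
    by (rule borel_measurable_norm_strong[OF f(1)])
  have sm: "strongly_measurable ?M (s n)" for n
    unfolding strongly_measurable_def using s(1) by (intro exI[of _ "\<lambda>_. s n"]) simp
  have [measurable]: "(\<lambda>x. norm (s n x)) \<in> borel_measurable ?M" for n
    by (rule borel_measurable_norm_strong[OF sm])
  have t: "simple_function ?M (t n)" for n
    unfolding t_def by (rule simple_function_If[OF s(1)]) (simp, measurable)
  have tm: "strongly_measurable ?M (t n)" for n
    unfolding strongly_measurable_def using t by (intro exI[of _ "\<lambda>_. t n"]) simp
  have [measurable]: "(\<lambda>x. norm (f x - t n x)) \<in> borel_measurable ?M" for n
    by (intro borel_measurable_norm_strong strongly_measurable_diff f tm)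
  have bound: "norm (f x - t n x) \<le> 3 * norm (f x)" for n x
    using norm_triangle_ineq4[of "f x" "t n x"] by (auto simp: t_def)
  have lim: "(\<lambda>n. norm (f x - t n x)) \<longlonglongrightarrow> 0" if x: "x \<in> space ?M" for x
  proof (cases "f x = 0")
    case True then show ?thesis by (simp add: t_def cong: if_cong)
  next
    case False
    have "(\<lambda>n. norm (s n x)) \<longlonglongrightarrow> norm (f x)" by (intro tendsto_norm s(2) x)
    then have "\<forall>\<^sub>F n in sequentially. norm (s n x) < 2 * norm (f x)"
      by (rule order_tendstoD) (use False in simp)
    then have "\<forall>\<^sub>F n in sequentially. s n x = t n x" by eventually_elim (simp add: t_def)
    then have "(\<lambda>n. t n x) \<longlonglongrightarrow> f x" by (rule Lim_transform_eventually[OF s(2)[OF x]])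
    then have "(\<lambda>n. f x - t n x) \<longlonglongrightarrow> f x - f x" by (intro tendsto_intros)
    then show ?thesis by (simp add: tendsto_norm_zero_iff)
  qed
  have int: "integrable ?M (\<lambda>x. norm (f x - t n x))" for n
    by (rule Bochner_Integration.integrable_bound[OF integrable_mult_right[OF f(2), of 3]])
      (use bound in auto)
  have "(\<lambda>n. \<integral>x. norm (f x - t n x) \<partial>?M) \<longlonglongrightarrow> (\<integral>x. 0 \<partial>?M)"
    by (rule integral_dominated_convergence[where w="\<lambda>x. 3 * norm (f x)"])
      (use bound lim f(2) in auto)
  moreover have "integral {a..b} (\<lambda>x. norm (f x - t n x)) = (\<integral>x. norm (f x - t n x) \<partial>?M)" for n
    by (rule integral_unique[OF has_integral_lborel_on[OF _ int]]) simp
  ultimately have "(\<lambda>n. integral {a..b} (\<lambda>x. norm (f x - t n x))) \<longlonglongrightarrow> 0" by simp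
  then show ?thesis
    by (rule integrable_on_L1_limit[rotated 2])
      (use simple_function_integrable_on[OF t] has_integral_lborel_on[OF _ int] in auto)
qed

section \<open>Primitives and integration by parts on compact intervals\<close>

lemma continuous_on_if_has_integral:
  fixes g w :: "real \<Rightarrow> 'b::banach"
  assumes "\<And>x y. a \<le> x \<Longrightarrow> x \<le> y \<Longrightarrow> y \<le> b \<Longrightarrow> (g has_integral (w y - w x)) {x..y}"
  shows "continuous_on {a..b} w"
proof (cases "a \<le> b")
  case True
  have "continuous_on {a..b} (\<lambda>x. w a + integral {a..x} g)"
    using assms[of a b] True by (intro continuous_intros indefinite_integral_continuous_1) auto
  moreover have "w x = w a + integral {a..x} g" if "x \<in> {a..b}" for x
    using assms[of a x] that by (auto dest: integral_unique)
  ultimately show ?thesis by (subst continuous_on_cong[OF refl, of _ w "\<lambda>x. w a + integral {a..x} g"])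
qed simp

text \<open>Cutting the interval into equal pieces shorter than d makes both sides
  telescope.\<close>

lemma norm_diff_le_if_locally:
  fixes \<Phi> :: "real \<Rightarrow> 'b::real_normed_vector" and N :: "real \<Rightarrow> real"
  assumes ab: "a \<le> b" and d: "d > 0"
    and loc: "\<And>x y. a \<le> x \<Longrightarrow> x \<le> y \<Longrightarrow> y \<le> b \<Longrightarrow> y - x < d \<Longrightarrow> norm (\<Phi> y - \<Phi> x) \<le> N y - N x"
  shows "norm (\<Phi> b - \<Phi> a) \<le> N b - N a"
proof -
  obtain n :: nat where n: "n > 0" "(b - a) / n < d"
  proof -
    obtain m :: nat where m: "(b - a) / d < m" using reals_Archimedean2 by blast
    have "0 \<le> (b - a) / d" using ab d by simp
    with m have "m > 0" by (cases m) auto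
    with m d have "(b - a) / m < d" by (simp add: field_simps)
    with \<open>m > 0\<close> show thesis by (rule that)
  qed
  define p where "p = (\<lambda>i::nat. a + (b - a) * i / n)"
  have p0: "p 0 = a" "p n = b" using n by (auto simp: p_def)
  have step: "p (Suc i) - p i = (b - a) / n" for i
    by (simp add: p_def distrib_left add_divide_distrib)
  have range: "a \<le> p i" for i using ab by (simp add: p_def)
  have range2: "p i \<le> b" if "i \<le> n" for i
  proof -
    have "(b - a) * i / n \<le> (b - a) * n / n"
      using that ab by (intro divide_right_mono mult_left_mono) auto
    then show ?thesis using n by (simp add: p_def)
  qed
  have "norm (\<Phi> b - \<Phi> a) = norm (\<Sum>i<n. \<Phi> (p (Suc i)) - \<Phi> (p i))"
    by (simp add: sum_lessThan_telescope[of "\<lambda>i. \<Phi> (p i)"] p0)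
  also have "\<dots> \<le> (\<Sum>i<n. norm (\<Phi> (p (Suc i)) - \<Phi> (p i)))" by (rule norm_sum)
  also have "\<dots> \<le> (\<Sum>i<n. N (p (Suc i)) - N (p i))"
  proof (intro sum_mono loc range range2)
    fix i assume "i \<in> {..<n}"
    then show "Suc i \<le> n" by simp
    have "0 \<le> (b - a) / n" using ab by simp
    then show "p i \<le> p (Suc i)" using step[of i] by linarith
    show "p (Suc i) - p i < d" using step[of i] n by simp
  qed
  also have "\<dots> = N b - N a" by (simp add: sum_lessThan_telescope[of "\<lambda>i. N (p i)"] p0)
  finally show ?thesis .
qed

text \<open>Henstock's lemma is not available for vector-valued integrals; instead the increments of the two
  sides over short intervals are compared by uniform continuity.\<close>

lemma cinner_integration_by_parts:
  fixes g h w u :: "real \<Rightarrow> 'e::complex_hilbert"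
  assumes ab: "a \<le> b"
    and g: "strongly_measurable (lborel_on {a..b}) g" "integrable (lborel_on {a..b}) (\<lambda>t. norm (g t))"
    and h: "strongly_measurable (lborel_on {a..b}) h" "integrable (lborel_on {a..b}) (\<lambda>t. norm (h t))"
    and w: "\<And>x y. a \<le> x \<Longrightarrow> x \<le> y \<Longrightarrow> y \<le> b \<Longrightarrow> (g has_integral (w y - w x)) {x..y}"
    and u: "\<And>x y. a \<le> x \<Longrightarrow> x \<le> y \<Longrightarrow> y \<le> b \<Longrightarrow> (h has_integral (u y - u x)) {x..y}"
  shows "integrable (lborel_on {a..b}) (\<lambda>t. cinner (g t) (u t) + cinner (w t) (h t))"
    and "cinner (w b) (u b) - cinner (w a) (u a) =
      (\<integral>t. cinner (g t) (u t) + cinner (w t) (h t) \<partial>lborel_on {a..b})"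
proof -
  let ?M = "lborel_on {a..b}"
  define H where "H = (\<lambda>t. cinner (g t) (u t) + cinner (w t) (h t))"
  define n where "n = (\<lambda>t. norm (g t) + norm (h t))"
  have cw: "continuous_on {a..b} w" and cu: "continuous_on {a..b} u"
    by (rule continuous_on_if_has_integral, erule (2) w u)+
  note smw = strongly_measurable_continuous[OF cw ab] and smu = strongly_measurable_continuous[OF cu ab]
  have "bounded (w ` {a..b})" "bounded (u ` {a..b})"
    by (intro compact_imp_bounded compact_continuous_image cw cu compact_Icc)+
  then have "bounded (w ` {a..b} \<union> u ` {a..b})" by simp
  then obtain B where "\<forall>x\<in>w ` {a..b} \<union> u ` {a..b}. norm x \<le> B" unfolding bounded_iff by blast
  then have B: "norm (w t) \<le> B" "norm (u t) \<le> B" if "t \<in> {a..b}" for t using that by auto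
  have int_n: "integrable ?M n" unfolding n_def by (intro Bochner_Integration.integrable_add g h)
  have int_H: "integrable ?M H"
  proof (rule Bochner_Integration.integrable_bound)
    show "integrable ?M (\<lambda>t. B * n t)" by (intro integrable_mult_right int_n)
    show "H \<in> borel_measurable ?M"
      unfolding H_def
      by (intro borel_measurable_add borel_measurable_bilinear[OF g(1) smu]
          borel_measurable_bilinear[OF smw h(1)] tendsto_cinner)
    have "norm (H t) \<le> norm (B * n t)" if "t \<in> {a..b}" for t
    proof -
      have "norm (H t) \<le> norm (g t) * norm (u t) + norm (w t) * norm (h t)"
        unfolding H_def by (rule order_trans[OF norm_triangle_ineq]) (intro add_mono cmod_cinner_le)
      also have "\<dots> \<le> norm (g t) * B + B * norm (h t)"
        by (intro add_mono mult_left_mono mult_right_mono B that) auto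
      also have "\<dots> \<le> norm (B * n t)" by (simp add: n_def algebra_simps)
      finally show ?thesis .
    qed
    then show "AE t in ?M. norm (H t) \<le> norm (B * n t)" by (intro AE_I2) (simp add: space_restrict_space)
  qed
  have H_on: "H integrable_on {x..y}" and n_on: "n integrable_on {x..y}" if "a \<le> x" "y \<le> b" for x y
    using has_integral_integrable[OF has_integral_lborel_on[OF _ int_H]]
      has_integral_integrable[OF has_integral_lborel_on[OF _ int_n]] that
    by (auto intro: integrable_subinterval_real[of _ a b])
  \<comment> \<open>The defect in the product rule. Its increments are at most e times those of the
    integral of n for every e > 0, so it is constant.\<close>
  define \<Phi> where "\<Phi> = (\<lambda>t. cinner (w t) (u t) - integral {a..t} H)"
  have "norm (\<Phi> b - \<Phi> a) \<le> e * integral {a..b} n" if e: "e > 0" for e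
  proof -
    have uc: "uniformly_continuous_on {a..b} w" "uniformly_continuous_on {a..b} u"
      by (intro compact_uniformly_continuous cw cu compact_Icc)+
    obtain d1 where d1: "d1 > 0"
      "\<And>t s. t \<in> {a..b} \<Longrightarrow> s \<in> {a..b} \<Longrightarrow> dist s t < d1 \<Longrightarrow> dist (w s) (w t) < e"
      by (rule uniformly_continuous_onE[OF uc(1) e]) (rule that, assumption, blast)
    obtain d2 where d2: "d2 > 0"
      "\<And>t s. t \<in> {a..b} \<Longrightarrow> s \<in> {a..b} \<Longrightarrow> dist s t < d2 \<Longrightarrow> dist (u s) (u t) < e"
      by (rule uniformly_continuous_onE[OF uc(2) e]) (rule that, assumption, blast)
    have "norm (\<Phi> b - \<Phi> a) \<le> e * integral {a..b} n - e * integral {a..a} n"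
    proof (rule norm_diff_le_if_locally[OF ab, of "min d1 d2"])
      show "min d1 d2 > 0" using d1 d2 by simp
      fix x y assume xy: "a \<le> x" "x \<le> y" "y \<le> b" "y - x < min d1 d2"
      \<comment> \<open>The integrand H with u frozen at the right end and w at the left end.
        Pairing with a fixed vector is bounded and linear, so K can be integrated exactly, and this
        choice of end points makes the cross terms cancel.\<close>
      define K where "K = (\<lambda>t. cinner (g t) (u y) + cinner (w x) (h t))"
      have K: "(K has_integral (cinner (w y) (u y) - cinner (w x) (u x))) {x..y}"
      proof -
        have "(K has_integral (cinner (w y - w x) (u y) + cinner (w x) (u y - u x))) {x..y}"
          unfolding K_def
          using has_integral_linear[OF w[OF xy(1-3)] cinner_linear_left[of "u y"]]
            has_integral_linear[OF u[OF xy(1-3)] cinner_linear_right[of "w x"]]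
          by (intro has_integral_add) (simp_all add: o_def)
        then show ?thesis by (simp add: cinner_diff_left cinner_diff_right)
      qed
      have Hxy: "H integrable_on {x..y}" by (rule H_on) (use xy in auto)
      have "\<Phi> y - \<Phi> x = integral {x..y} K - integral {x..y} H"
        using Henstock_Kurzweil_Integration.integral_combine[of a x y H] H_on[of a y] xy
        by (simp add: \<Phi>_def integral_unique[OF K] algebra_simps)
      also have "\<dots> = integral {x..y} (\<lambda>t. K t - H t)"
        by (rule Henstock_Kurzweil_Integration.integral_diff[symmetric]) (use K Hxy in auto)
      also have "norm \<dots> \<le> integral {x..y} (\<lambda>t. e * n t)"
      proof (rule integral_norm_bound_integral)
        show "(\<lambda>t. K t - H t) integrable_on {x..y}"
          by (rule Henstock_Kurzweil_Integration.integrable_diff) (use K Hxy in auto)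
        show "(\<lambda>t. e * n t) integrable_on {x..y}"
          using n_on[of x y] xy by (intro integrable_on_mult_right) auto
        fix t assume t: "t \<in> {x..y}"
        have "K t - H t = cinner (g t) (u y - u t) + cinner (w x - w t) (h t)"
          by (simp add: K_def H_def cinner_diff_left cinner_diff_right)
        also have "norm \<dots> \<le> norm (g t) * norm (u y - u t) + norm (w x - w t) * norm (h t)"
          by (rule order_trans[OF norm_triangle_ineq]) (intro add_mono cmod_cinner_le)
        also have "\<dots> \<le> norm (g t) * e + e * norm (h t)"
        proof (intro add_mono mult_left_mono mult_right_mono norm_ge_zero)
          show "norm (u y - u t) \<le> e" using d2(2)[of t y] xy t by (auto simp: dist_norm)
          show "norm (w x - w t) \<le> e" using d1(2)[of t x] xy t by (auto simp: dist_norm)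
        qed
        finally show "norm (K t - H t) \<le> e * n t" by (simp add: n_def algebra_simps)
      qed
      also have "\<dots> = e * integral {a..y} n - e * integral {a..x} n"
        using Henstock_Kurzweil_Integration.integral_combine[of a x y n] n_on[of a y] xy
        by (simp add: right_diff_distrib[symmetric])
      finally show "norm (\<Phi> y - \<Phi> x) \<le> e * integral {a..y} n - e * integral {a..x} n" .
    qed
    then show ?thesis by simp
  qed
  then have bound: "norm (\<Phi> b - \<Phi> a) \<le> e * integral {a..b} n" if "e > 0" for e using that .
  have "norm (\<Phi> b - \<Phi> a) \<le> 0"
  proof (rule field_le_epsilon)
    fix e :: real assume e: "e > 0"
    \<comment> \<open>The added 1 keeps the divisor positive when the integral is zero.\<close>
    define I where "I = \<bar>integral {a..b} n\<bar> + 1"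
    have "I > 0" "integral {a..b} n \<le> I" by (auto simp: I_def)
    then have "e / I * integral {a..b} n \<le> e / I * I" using e by (intro mult_left_mono) auto
    then show "norm (\<Phi> b - \<Phi> a) \<le> 0 + e"
      using bound[of "e / I"] \<open>I > 0\<close> e by simp
  qed
  then have "cinner (w b) (u b) - cinner (w a) (u a) = integral {a..b} H"
    by (simp add: \<Phi>_def algebra_simps)
  then show "cinner (w b) (u b) - cinner (w a) (u a) =
      (\<integral>t. cinner (g t) (u t) + cinner (w t) (h t) \<partial>lborel_on {a..b})"
    using integral_unique[OF has_integral_lborel_on[OF _ int_H]] by (simp add: H_def)
  show "integrable (lborel_on {a..b}) (\<lambda>t. cinner (g t) (u t) + cinner (w t) (h t))"
    using int_H by (simp add: H_def)
qed

section \<open>Functions with vanishing integrals\<close>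

text \<open>The rays \<open>{..a}\<close> are closed under intersection and generate the Borel sets.
  The property of having integral zero passes to disjoint unions, and to complements because the
  integral over the whole line is a limit over rays.\<close>

lemma AE_zero_if_integral_atMost_zero:
  fixes f :: "real \<Rightarrow> complex"
  assumes f: "integrable lborel f" and zero: "\<And>a. (LINT x:{..a}|lborel. f x) = 0"
  shows "AE x in lborel. f x = 0"
proof (rule sigma_finite_measure.density_zero[OF lborel.sigma_finite_measure_axioms f])
  fix A assume "A \<in> sets (lborel :: real measure)"
  then have "A \<in> sets (borel :: real measure)" by simp
  then have A: "A \<in> sigma_sets UNIV (range (\<lambda>a::real. {..a}))"
    by (simp add: borel_eq_atMost)
  have sets: "A \<in> sets lborel" if "A \<in> sigma_sets UNIV (range (\<lambda>a::real. {..a}))" for A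
    using that by (simp add: borel_eq_atMost)
  have int: "set_integrable lborel A f" if "A \<in> sets lborel" for A
    unfolding set_integrable_def using integrable_mult_indicator[OF that f] .
  have stable: "Int_stable (range (\<lambda>a::real. {..a}))"
    unfolding Int_stable_def by auto
  have pow: "range (\<lambda>a::real. {..a}) \<subseteq> Pow UNIV" by simp
  have total: "(LINT x:UNIV|lborel. f x) = 0"
  proof (rule LIMSEQ_unique)
    show "(\<lambda>n::nat. LINT x:{..real n}|lborel. f x) \<longlonglongrightarrow> (LINT x:UNIV|lborel. f x)"
      unfolding set_lebesgue_integral_def
    proof (rule integral_dominated_convergence[where w="\<lambda>x. norm (f x)"])
      show "AE x in lborel. (\<lambda>n. indicat_real {..real n} x *\<^sub>R f x) \<longlonglongrightarrow> indicat_real UNIV x *\<^sub>R f x"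
      proof (rule AE_I2)
        fix x :: real
        obtain N :: nat where "x \<le> N" using real_arch_simple by blast
        then have "\<forall>\<^sub>F n in sequentially. f x = indicat_real {..real n} x *\<^sub>R f x"
          by (intro eventually_sequentiallyI[of N]) (auto simp: indicator_def)
        from Lim_transform_eventually[OF tendsto_const this]
        show "(\<lambda>n. indicat_real {..real n} x *\<^sub>R f x) \<longlonglongrightarrow> indicat_real UNIV x *\<^sub>R f x" by simp
      qed
    qed (use f in \<open>auto simp: indicator_def\<close>)
  qed (simp add: zero)
  show "(LINT x:A|lborel. f x) = 0"
    using stable pow A
  proof (induction rule: sigma_sets_induct_disjoint)
    case (basic A) then show ?case by (auto simp: zero)
  next
    case empty then show ?case by (simp add: set_lebesgue_integral_def)
  next
    case (compl A)
    have "(LINT x:A \<union> (UNIV - A)|lborel. f x) = (LINT x:A|lborel. f x) + (LINT x:UNIV - A|lborel. f x)"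
      using sets[OF compl(1)] by (intro set_integral_Un int) auto
    then show ?case using compl total by simp
  next
    case (union A)
    have "(LINT x:(\<Union>i. A i)|lborel. f x) = (\<Sum>i. LINT x:A i|lborel. f x)"
    proof (rule lebesgue_integral_countable_add)
      have A: "A i \<in> sets lborel" for i using union(2) by (intro sets) auto
      then show "A i \<in> sets lborel" for i .
      show "A i \<inter> A j = {}" if "i \<noteq> j" for i j
        using union(1) that by (simp add: disjoint_family_on_def)
      show "set_integrable lborel (\<Union>i. A i) f" by (intro int sets.countable_UN) (use A in auto)
    qed
    then show ?case using union(3) by simp
  qed
qed

text \<open>The exceptional null set depends on e. Taking for e the countably many values of the
  simple approximants of h leaves one null set, and \<open>h x\<close> is a limit of such values,
  hence orthogonal to itself.\<close>

lemma AE_zero_if_cinner_AE_zero: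
  fixes h :: "'x \<Rightarrow> 'e::complex_inner"
  assumes h: "strongly_measurable M h" and zero: "\<And>e. AE x in M. cinner (h x) e = 0"
  shows "AE x in M. h x = 0"
proof -
  obtain s where s: "\<And>n. simple_function M (s n)" "\<And>x. x \<in> space M \<Longrightarrow> (\<lambda>n. s n x) \<longlonglongrightarrow> h x"
    using h unfolding strongly_measurable_def by blast
  define D where "D = (\<Union>n. s n ` space M)"
  have "countable D"
    unfolding D_def by (intro countable_UN countableI_type countable_finite simple_functionD(1)[OF s(1)])
  then have "AE x in M. \<forall>d\<in>D. cinner (h x) d = 0"
    using zero by (subst AE_ball_countable) auto
  then show ?thesis
    using AE_space
  proof eventually_elim
    fix x assume x: "\<forall>d\<in>D. cinner (h x) d = 0" "x \<in> space M"
    have "(\<lambda>n. cinner (h x) (s n x)) \<longlonglongrightarrow> cinner (h x) (h x)"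
      by (intro tendsto_cinner tendsto_const s(2) x)
    moreover have "cinner (h x) (s n x) = 0" for n using x by (auto simp: D_def)
    ultimately have "cinner (h x) (h x) = 0" by (simp add: LIMSEQ_const_iff)
    then show "h x = 0" by (simp add: cinner_self_eq_0)
  qed
qed

section \<open>Sobolev functions on a half-line\<close>

text \<open>On the domain \<sigma> * x is the distance of x from the end point 0, so
  \<open>seg b\<close> below is the part within distance b, and the outward direction is \<sigma>
  for both half-lines.\<close>

locale half_line =
  fixes S :: "'s::real_domain itself" and \<sigma> :: real
  assumes domain: "domain_set TYPE('s) = {x. 0 \<le> \<sigma> * x}" and \<sigma>: "\<sigma> = 1 \<or> \<sigma> = - 1"
begin

definition primitive :: "(real \<Rightarrow> 'b::real_normed_vector) \<Rightarrow> (real \<Rightarrow> 'b) \<Rightarrow> bool" where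
  "primitive g w \<longleftrightarrow>
    (\<forall>a b. a \<le> b \<and> {a..b} \<subseteq> domain_set TYPE('s) \<longrightarrow> (g has_integral (w b - w a)) {a..b})"

lemma primitiveD:
  "primitive g w \<Longrightarrow> a \<le> b \<Longrightarrow> {a..b} \<subseteq> domain_set TYPE('s) \<Longrightarrow> (g has_integral (w b - w a)) {a..b}"
  by (simp add: primitive_def)

definition seg :: "real \<Rightarrow> real set" where "seg b = {min 0 (\<sigma> * b)..max 0 (\<sigma> * b)}"

lemma mem_D: "x \<in> domain_set TYPE('s) \<longleftrightarrow> 0 \<le> \<sigma> * x" by (simp add: domain)

lemma D_borel: "domain_set TYPE('s) \<in> sets borel" by (rule domain_set_borel)

lemma seg_borel [measurable, simp]: "seg b \<in> sets borel" by (simp add: seg_def)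

lemma \<sigma>_sq [simp]: "\<sigma> * \<sigma> = 1" "\<sigma> * (\<sigma> * x) = x" using \<sigma> by auto

lemma abs_\<sigma> [simp]: "\<bar>\<sigma>\<bar> = 1" using \<sigma> by auto

lemma mem_seg: "b \<ge> 0 \<Longrightarrow> x \<in> seg b \<longleftrightarrow> 0 \<le> \<sigma> * x \<and> \<sigma> * x \<le> b"
  using \<sigma> by (auto simp: seg_def)

lemma seg_subset: "b \<ge> 0 \<Longrightarrow> seg b \<subseteq> domain_set TYPE('s)" by (auto simp: mem_seg mem_D)

lemma interval_subset: "a \<in> domain_set TYPE('s) \<Longrightarrow> b \<in> domain_set TYPE('s) \<Longrightarrow> {a..b} \<subseteq> domain_set TYPE('s)"
  using \<sigma> by (auto simp: mem_D)

lemma zero_mem_D [simp]: "0 \<in> domain_set TYPE('s)" by (simp add: mem_D)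

lemma space_domain_measure: "space (domain_measure TYPE('s)) = domain_set TYPE('s)"
  by (simp add: space_restrict_space)

text \<open>Cut f to one segment and apply the criterion for rays: a ray meets the segment in a set
  whose integral is determined by segments. Countably many segments exhaust the half-line.\<close>

lemma AE_zero_if_integral_seg_zero:
  fixes f :: "real \<Rightarrow> complex"
  assumes f: "\<And>b. b > 0 \<Longrightarrow> integrable (lborel_on (seg b)) f"
    and zero: "\<And>b. b > 0 \<Longrightarrow> (\<integral>x. f x \<partial>lborel_on (seg b)) = 0"
  shows "AE x in domain_measure TYPE('s). f x = 0"
proof -
  have hk: "(f has_integral 0) (seg b)" if "b \<ge> 0" for b
  proof (cases "b = 0")
    case True then show ?thesis using has_integral_refl(2)[of f 0] by (simp add: seg_def)
  next
    case False then show ?thesis using has_integral_lborel_on[OF _ f[of b]] zero[of b] that by simp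
  qed
  have AE_seg: "AE x in lborel. x \<in> seg b \<longrightarrow> f x = 0" if b: "b > 0" for b
  proof -
    define g where "g = (\<lambda>x. indicat_real (seg b) x *\<^sub>R f x)"
    have g: "integrable lborel g"
      using f[OF b] by (simp add: g_def integrable_restrict_space)
    have "(LINT x:{..a}|lborel. g x) = 0" for a
    proof -
      have "set_integrable lborel {..a} g"
        unfolding set_integrable_def by (intro integrable_mult_indicator g) simp
      then have "(g has_integral (LINT x:{..a}|lborel. g x)) {..a}"
        using set_borel_integral_eq_integral[of "{..a}" g] by (simp add: has_integral_integrable_integral)
      then have "(f has_integral (LINT x:{..a}|lborel. g x)) ({..a} \<inter> seg b)"
        by (simp add: g_def indicator_scaleR_eq_if has_integral_restrict_Int Int_commute)
      moreover have "(f has_integral 0) ({..a} \<inter> seg b)"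
      proof (cases "\<sigma> = 1")
        case True
        then have seg1: "seg b' = {0..b'}" if "b' \<ge> 0" for b' unfolding seg_def using that by simp
        have "{..a} \<inter> {0..b} = (if a < 0 then {} else {0..min a b})" by auto
        then show ?thesis using hk[of "min a b"] b by (simp add: seg1 split: if_splits)
      next
        case False
        then have "\<sigma> = -1" using \<sigma> by simp
        then have seg2: "seg b' = {-b'..0}" if "b' \<ge> 0" for b' unfolding seg_def using that by simp
        show ?thesis
        proof (cases "- b \<le> a \<and> a \<le> 0")
          case True
          \<comment> \<open>On the left half-line the interval from -b to a does not touch 0; its
            integral is the difference of those over two segments ending at 0.\<close>
          have "f integrable_on {-b..0}" using has_integral_integrable[OF hk[of b]] b by (simp add: seg2)
          from Henstock_Kurzweil_Integration.integral_combine[OF _ _ this, of a] True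
          have "integral {-b..a} f = integral {-b..0} f - integral {a..0} f" by (simp add: eq_diff_eq)
          also have "\<dots> = 0"
            using integral_unique[OF hk[of b]] integral_unique[OF hk[of "-a"]] b True by (simp add: seg2)
          finally have "integral {-b..a} f = 0" .
          moreover have "f integrable_on {-b..a}"
            using integrable_subinterval_real[OF \<open>f integrable_on {-b..0}\<close>, of "-b" a] True by auto
          moreover have "{..a} \<inter> seg b = {-b..a}" using True b by (auto simp: seg2)
          ultimately show ?thesis by (simp add: has_integral_integrable_integral)
        next
          case False
          then have "{..a} \<inter> seg b = (if a < 0 then {} else seg b)"
            using b by (auto simp: seg2)
          then show ?thesis using hk[of b] b by simp
        qed
      qed
      ultimately show ?thesis by (rule has_integral_unique)
    qed
    from AE_zero_if_integral_atMost_zero[OF g this] show ?thesis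
      by eventually_elim (auto simp: g_def)
  qed
  have "AE x in lborel. \<forall>n::nat. x \<in> seg (Suc n) \<longrightarrow> f x = 0"
    by (subst AE_all_countable) (auto intro: AE_seg)
  then have "AE x in lborel. x \<in> domain_set TYPE('s) \<longrightarrow> f x = 0"
  proof eventually_elim
    fix x assume x: "\<forall>n::nat. x \<in> seg (Suc n) \<longrightarrow> f x = 0"
    obtain n :: nat where "\<sigma> * x \<le> n" using real_arch_simple by blast
    then have "x \<in> domain_set TYPE('s) \<Longrightarrow> x \<in> seg (Suc n)" by (simp add: mem_seg mem_D)
    with x show "x \<in> domain_set TYPE('s) \<longrightarrow> f x = 0" by blast
  qed
  then show ?thesis by (simp add: AE_restrict_space_iff D_borel)
qed

lemma AE_zero_if_cinner_integral_seg_zero: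
  fixes h :: "real \<Rightarrow> 'e::complex_inner"
  assumes "strongly_measurable (domain_measure TYPE('s)) h"
    and "\<And>b e. b > 0 \<Longrightarrow> integrable (lborel_on (seg b)) (\<lambda>x. cinner (h x) e)"
    and "\<And>b e. b > 0 \<Longrightarrow> (\<integral>x. cinner (h x) e \<partial>lborel_on (seg b)) = 0"
  shows "AE x in domain_measure TYPE('s). h x = 0"
  by (intro AE_zero_if_cinner_AE_zero AE_zero_if_integral_seg_zero assms)

section \<open>Continuous representatives and traces\<close>

lemma continuous_on_D_if_seg:
  assumes "\<And>b. b \<ge> 0 \<Longrightarrow> continuous_on (seg b) w"
  shows "continuous_on (domain_set TYPE('s)) (w :: real \<Rightarrow> 'b::real_normed_vector)"
  unfolding continuous_on_iff
proof (intro ballI allI impI)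
  fix x e :: real assume x: "x \<in> domain_set TYPE('s)" and e: "e > 0"
  have x': "x \<in> seg (\<bar>x\<bar> + 1)" using x \<sigma> by (auto simp: mem_seg mem_D)
  have "continuous_on (seg (\<bar>x\<bar> + 1)) w" by (rule assms) simp
  then obtain d where d: "d > 0" "\<And>y. y \<in> seg (\<bar>x\<bar> + 1) \<Longrightarrow> dist y x < d \<Longrightarrow> dist (w y) (w x) < e"
    using x' e unfolding continuous_on_iff by blast
  have "dist (w y) (w x) < e" if "y \<in> domain_set TYPE('s)" "dist y x < min d 1" for y
    by (rule d(2)) (use that \<sigma> in \<open>auto simp: mem_seg mem_D dist_real_def\<close>)
  then show "\<exists>d>0. \<forall>x'\<in>domain_set TYPE('s). dist x' x < d \<longrightarrow> dist (w x') (w x) < e"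
    using d(1) by (intro exI[of _ "min d 1"]) auto
qed

lemma represents_unique:
  fixes v :: "('s, 'e::complex_inner) L2"
  assumes w: "represents w v" "continuous_on (domain_set TYPE('s)) w" and w': "represents w' v" "continuous_on (domain_set TYPE('s)) w'"
    and x: "x \<in> domain_set TYPE('s)"
  shows "w x = w' x"
proof (rule ccontr)
  assume ne: "w x \<noteq> w' x"
  have "AE y in domain_measure TYPE('s). w y = w' y"
    using w(1) w'(1) unfolding represents_def by eventually_elim simp
  then have ae: "AE y in lborel. y \<in> domain_set TYPE('s) \<longrightarrow> w y = w' y"
    by (simp add: AE_restrict_space_iff D_borel)
  have "continuous_on (domain_set TYPE('s)) (\<lambda>y. norm (w y - w' y))" by (intro continuous_intros w w')
  then obtain d where d: "d > 0" "\<And>y. y \<in> domain_set TYPE('s) \<Longrightarrow> dist y x < d \<Longrightarrow>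
      dist (norm (w y - w' y)) (norm (w x - w' x)) < norm (w x - w' x)"
    using x ne unfolding continuous_on_iff by (metis right_minus_eq zero_less_norm_iff)
  \<comment> \<open>J leaves x in the outward direction \<sigma>, so it stays in the half-line even
    when x is the end point. It has positive length, and w and w' differ on all of it.\<close>
  define J where "J = {min x (x + \<sigma> * (d/2))..max x (x + \<sigma> * (d/2))}"
  have J: "y \<in> domain_set TYPE('s)" "dist y x < d" if "y \<in> J" for y
    using \<sigma> that x d(1) by (elim disjE; simp add: J_def mem_D dist_real_def)+
  have "AE y in lborel. y \<notin> J"
    using ae
  proof eventually_elim
    fix y assume "y \<in> domain_set TYPE('s) \<longrightarrow> w y = w' y"
    then show "y \<notin> J" using d(2)[of y] J[of y] by auto
  qed
  then have "emeasure lborel J = 0" by (subst (asm) AE_iff_measurable[of J]) (auto simp: J_def)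
  moreover have "emeasure lborel J = ennreal (d / 2)"
    using \<sigma> d(1) by (elim disjE) (simp_all add: J_def emeasure_lborel_Icc_eq)
  ultimately show False using d(1) by simp
qed

lemma rep_L2_strongly_measurable:
  fixes v :: "('s, 'e::complex_inner) L2"
  assumes "A \<subseteq> domain_set TYPE('s)"
  shows "strongly_measurable (lborel_on A) (rep_L2 v)"
  using square_integrable_rep_L2[of v] assms
  by (auto simp: square_integrable_def intro: strongly_measurable_lborel_on_subset)

lemma rep_L2_norm_integrable:
  fixes v :: "('s, 'e::complex_inner) L2"
  assumes "{a..b} \<subseteq> domain_set TYPE('s)"
  shows "integrable (lborel_on {a..b}) (\<lambda>x. norm (rep_L2 v x))"
proof (rule Bochner_Integration.integrable_bound)
  have "integrable (lborel_on {a..b}) (\<lambda>x. (norm (rep_L2 v x))\<^sup>2)"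
    using square_integrable_rep_L2[of v] assms
    by (auto simp: square_integrable_def D_borel intro: integrable_lborel_on_subset)
  moreover have "integrable (lborel_on {a..b}) (\<lambda>x. 1 :: real)"
    by (simp add: integrable_restrict_space emeasure_lborel_Icc_eq)
  ultimately show "integrable (lborel_on {a..b}) (\<lambda>x. 1 + (norm (rep_L2 v x))\<^sup>2)"
    by (intro Bochner_Integration.integrable_add)
  show "(\<lambda>x. norm (rep_L2 v x)) \<in> borel_measurable (lborel_on {a..b})"
    by (intro borel_measurable_norm_strong rep_L2_strongly_measurable assms)
  have "r \<le> 1 + r\<^sup>2" for r :: real
    using zero_le_power2[of "r - 1/2"] by (simp add: power2_eq_square algebra_simps)
  then show "AE x in lborel_on {a..b}. norm (norm (rep_L2 v x)) \<le> norm (1 + (norm (rep_L2 v x))\<^sup>2)"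
    by (intro AE_I2) auto
qed

lemma primitive_continuous:
  fixes w :: "real \<Rightarrow> 'b::banach"
  assumes "primitive g w"
  shows "continuous_on (domain_set TYPE('s)) w"
proof -
  have "continuous_on (seg b) w" if "b \<ge> 0" for b
    unfolding seg_def
  proof (rule continuous_on_if_has_integral)
    fix x y assume "min 0 (\<sigma> * b) \<le> x" "x \<le> y" "y \<le> max 0 (\<sigma> * b)"
    moreover from this have "{x..y} \<subseteq> seg b" by (auto simp: seg_def)
    ultimately show "(g has_integral (w y - w x)) {x..y}"
      using seg_subset[OF that] by (intro primitiveD[OF assms]) auto
  qed
  then show ?thesis by (rule continuous_on_D_if_seg)
qed

text \<open>The gauge integral ignores null sets, so the derivative may be taken to be the canonical
  representative, whose strong measurability and local integrability are known.\<close>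

lemma sobolev_derivE:
  fixes v v' :: "('s, 'e::complex_hilbert) L2"
  assumes "(v, v') \<in> sobolev_deriv"
  obtains w where "represents w v" "primitive (rep_L2 v') w"
proof -
  obtain w g where w: "represents w v" "represents g v'"
    "\<And>a b. a \<le> b \<Longrightarrow> {a..b} \<subseteq> domain_set TYPE('s) \<Longrightarrow> (g has_integral (w b - w a)) {a..b}"
    using assms by (auto simp: sobolev_deriv_def)
  have rep: "(rep_L2 v' has_integral (w b - w a)) {a..b}"
    if "a \<le> b" "{a..b} \<subseteq> domain_set TYPE('s)" for a b
  proof -
    have "AE x in lborel. x \<in> domain_set TYPE('s) \<longrightarrow> rep_L2 v' x = g x"
      using w(2) by (simp add: represents_def AE_restrict_space_iff D_borel)
    then have "AE x in lborel. x \<in> {a..b} \<longrightarrow> rep_L2 v' x = g x"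
      by eventually_elim (use that in auto)
    from has_integral_AE[OF this] w(3)[OF that] show ?thesis by simp
  qed
  then have "primitive (rep_L2 v') w" unfolding primitive_def by blast
  with w(1) show thesis by (rule that)
qed

lemma AE_domain_iff:
  "(AE x in domain_measure TYPE('s). Q x) \<longleftrightarrow> (AE x in lborel. x \<in> domain_set TYPE('s) \<longrightarrow> Q x)"
  by (rule AE_restrict_space_iff) (simp add: D_borel)

lemma L2_rel_self_iff: "L2_rel TYPE('s) f f \<longleftrightarrow> square_integrable (domain_measure TYPE('s)) f"
  by (simp add: L2_rel_def)

lemma represents_abs_L2:
  fixes f :: "real \<Rightarrow> 'e::complex_inner"
  assumes "square_integrable (domain_measure TYPE('s)) f"
  shows "represents f (abs_L2 f :: ('s, 'e) L2)"
  using abs_L2_eq_iff[of "rep_L2 (abs_L2 f :: ('s, 'e) L2)" f] rep_L2_works[of "abs_L2 f :: ('s, 'e) L2"] assms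
  by (auto simp: represents_def L2_rel_def)

lemma cinner_abs_L2:
  fixes f :: "real \<Rightarrow> 'e::complex_inner"
  assumes "square_integrable (domain_measure TYPE('s)) f"
  shows "cinner (abs_L2 f :: ('s, 'e) L2) v = (\<integral>x. cinner (f x) (rep_L2 v x) \<partial>domain_measure TYPE('s))"
  using cinner_L2.abs_eq[OF _ rep_L2_works(1), of f v] assms by (simp add: L2_rel_self_iff rep_L2_works(2))

lemma cinner_L2_rep:
  fixes v w :: "('s, 'e::complex_inner) L2"
  shows "cinner v w = (\<integral>x. cinner (rep_L2 v x) (rep_L2 w x) \<partial>domain_measure TYPE('s))"
  using cinner_abs_L2[OF square_integrable_rep_L2[of v], of w] by (simp add: rep_L2_works(2))

lemma L2_eq_zeroI:
  fixes v :: "('s, 'e::complex_inner) L2"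
  assumes "AE x in domain_measure TYPE('s). rep_L2 v x = 0"
  shows "v = 0"
proof -
  have "cinner v v = (\<integral>x. 0 \<partial>domain_measure TYPE('s))"
    unfolding cinner_L2_rep
  proof (rule integral_cong_AE)
    show "AE x in domain_measure TYPE('s). cinner (rep_L2 v x) (rep_L2 v x) = 0"
      using assms by eventually_elim simp
  qed (use integrable_cinner[OF square_integrable_rep_L2[of v] square_integrable_rep_L2[of v]] in auto)
  then show ?thesis by (simp add: cinner_self_eq_0)
qed

lemma represents_zero: "represents (\<lambda>_. 0) (0 :: ('s, 'e::complex_inner) L2)"
  using represents_abs_L2[OF square_integrable_zero, where ?'e='e] by (simp add: zero_L2_def)

lemma sobolev_memI:
  fixes w :: "real \<Rightarrow> 'e::complex_hilbert" and v v' :: "('s, 'e) L2"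
  assumes "represents w v"
    and "primitive (rep_L2 v') w"
  shows "(v, v') \<in> sobolev_deriv" "(v, w 0) \<in> sobolev_trace"
proof -
  show "(v, v') \<in> sobolev_deriv"
    unfolding sobolev_deriv_def mem_Collect_eq case_prod_conv
    by (intro exI[of _ w] exI[of _ "rep_L2 v'"] conjI assms) (use assms(2) in \<open>auto simp: represents_def primitive_def\<close>)
  show "(v, w 0) \<in> sobolev_trace"
    using assms primitive_continuous[OF assms(2)] by (auto simp: sobolev_trace_def)
qed

text \<open>Derivative and trace are defined through possibly different representatives; both are
  continuous, hence equal, so a single w serves for both.\<close>

lemma sobolev_traceE:
  fixes v v' :: "('s, 'e::complex_hilbert) L2"
  assumes "(v, v') \<in> sobolev_deriv" "(v, e) \<in> sobolev_trace"
  obtains w where "represents w v" "primitive (rep_L2 v') w" "w 0 = e"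
proof -
  obtain w where w: "represents w v" "primitive (rep_L2 v') w"
    using sobolev_derivE[OF assms(1)] .
  obtain w' where w': "represents w' v" "continuous_on (domain_set TYPE('s)) w'" "w' 0 = e"
    using assms(2) by (auto simp: sobolev_trace_def)
  have "w 0 = e" using represents_unique[OF w(1) primitive_continuous[OF w(2)] w'(1,2), of 0] w'(3) by simp
  with w show thesis by (intro that)
qed

section \<open>Integration by parts and Green's identity on a half-line\<close>

lemma seg_integration_by_parts:
  fixes g h w u :: "real \<Rightarrow> 'e::complex_hilbert"
  assumes b: "b \<ge> 0"
    and g: "strongly_measurable (lborel_on (seg b)) g" "integrable (lborel_on (seg b)) (\<lambda>t. norm (g t))"
    and h: "strongly_measurable (lborel_on (seg b)) h" "integrable (lborel_on (seg b)) (\<lambda>t. norm (h t))"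
    and w: "primitive g w"
    and u: "primitive h u"
  shows "integrable (lborel_on (seg b)) (\<lambda>t. cinner (g t) (u t) + cinner (w t) (h t))"
    and "cinner (w (\<sigma> * b)) (u (\<sigma> * b)) - cinner (w 0) (u 0) =
      \<sigma> * (\<integral>t. cinner (g t) (u t) + cinner (w t) (h t) \<partial>lborel_on (seg b))"
proof -
  have sub: "{x..y} \<subseteq> domain_set TYPE('s)" if "min 0 (\<sigma> * b) \<le> x" "y \<le> max 0 (\<sigma> * b)" for x y
  proof -
    have "{x..y} \<subseteq> seg b" using that by (auto simp: seg_def)
    then show ?thesis using seg_subset[OF b] by blast
  qed
  have le: "min 0 (\<sigma> * b) \<le> max 0 (\<sigma> * b)" by simp
  note ibp = cinner_integration_by_parts[OF le g[unfolded seg_def] h[unfolded seg_def] primitiveD[OF w] primitiveD[OF u]]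
  show "integrable (lborel_on (seg b)) (\<lambda>t. cinner (g t) (u t) + cinner (w t) (h t))"
    unfolding seg_def by (rule ibp(1); (assumption | rule sub); assumption)
  have eq: "cinner (w (max 0 (\<sigma> * b))) (u (max 0 (\<sigma> * b))) - cinner (w (min 0 (\<sigma> * b))) (u (min 0 (\<sigma> * b))) =
      (\<integral>t. cinner (g t) (u t) + cinner (w t) (h t) \<partial>lborel_on (seg b))" (is "_ = ?I")
    unfolding seg_def by (rule ibp(2); (assumption | rule sub); assumption)
  \<comment> \<open>For \<sigma> = -1 the point 0 is the right end of the segment, which reverses
    the boundary difference.\<close>
  show "cinner (w (\<sigma> * b)) (u (\<sigma> * b)) - cinner (w 0) (u 0) = \<sigma> * ?I"
  proof (cases "\<sigma> = 1")
    case True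
    then have "max 0 (\<sigma> * b) = \<sigma> * b" "min 0 (\<sigma> * b) = 0" "complex_of_real \<sigma> * ?I = ?I" using b by auto
    with eq show ?thesis by metis
  next
    case False
    then have s: "\<sigma> = -1" using \<sigma> by simp
    then have "max 0 (\<sigma> * b) = 0" "min 0 (\<sigma> * b) = \<sigma> * b" "complex_of_real \<sigma> * ?I = - ?I" using b by auto
    with eq show ?thesis by (metis minus_diff_eq)
  qed
qed

text \<open>With a nonzero limit L, the norm of F exceeds \<open>norm L / 2\<close> on a whole outer
  ray. Integrability would give this ray finite measure, yet it contains intervals of any
  length.\<close>

lemma limit_zero_if_integrable:
  fixes F :: "real \<Rightarrow> complex"
  assumes F: "integrable (domain_measure TYPE('s)) F'"
    and eq: "AE x in domain_measure TYPE('s). F x = F' x"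
    and lim: "((\<lambda>t. F (\<sigma> * t)) \<longlongrightarrow> L) at_top"
  shows "L = (0 :: complex)"
proof (rule ccontr)
  assume L: "L \<noteq> 0"
  have "\<forall>\<^sub>F t in at_top. norm L / 2 < norm (F (\<sigma> * t))"
    by (rule order_tendstoD[OF tendsto_norm[OF lim]]) (use L in simp)
  then obtain K where K: "\<And>t. t \<ge> K \<Longrightarrow> norm L / 2 < norm (F (\<sigma> * t))"
    by (auto simp: eventually_at_top_linorder)
  define T where "T = {x. \<sigma> * x \<ge> max K 0}"
  have T: "T \<in> sets borel" unfolding T_def by measurable
  have int: "integrable lborel (\<lambda>x. indicator (domain_set TYPE('s)) x *\<^sub>R F' x)"
    using F by (simp add: integrable_restrict_space D_borel)
  have "integrable lborel (\<lambda>x. indicat_real T x * (norm L / 2))"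
  proof (rule Bochner_Integration.integrable_bound[OF int])
    have "AE x in lborel. x \<in> domain_set TYPE('s) \<longrightarrow> F x = F' x"
      using eq by (simp add: AE_restrict_space_iff D_borel)
    then show "AE x in lborel. norm (indicat_real T x * (norm L / 2)) \<le>
        norm (indicator (domain_set TYPE('s)) x *\<^sub>R F' x)"
    proof eventually_elim
      fix x assume x: "x \<in> domain_set TYPE('s) \<longrightarrow> F x = F' x"
      show "norm (indicat_real T x * (norm L / 2)) \<le> norm (indicator (domain_set TYPE('s)) x *\<^sub>R F' x)"
      proof (cases "x \<in> T")
        case True
        then have "x \<in> domain_set TYPE('s)" "norm L / 2 < norm (F (\<sigma> * (\<sigma> * x)))"
          using K[of "\<sigma> * x"] by (auto simp: T_def mem_D)
        then show ?thesis using x True by simp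
      qed simp
    qed
  qed (use T in simp)
  from integrable_mult_left[OF this, of "2 / norm L"]
  have "integrable lborel (\<lambda>x. indicat_real T x)" using L by simp
  then have fin: "emeasure lborel T < \<infinity>" using T by (simp add: integrable_indicator_iff)
  then obtain c where c: "emeasure lborel T = ennreal c" "c \<ge> 0" by (cases "emeasure lborel T") auto
  obtain n :: nat where n: "c < n" using reals_Archimedean2 by blast
  define J where "J = {min (\<sigma> * max K 0) (\<sigma> * (max K 0 + n))..max (\<sigma> * max K 0) (\<sigma> * (max K 0 + n))}"
  have "J \<subseteq> T" using \<sigma> by (elim disjE) (auto simp: J_def T_def)
  then have "emeasure lborel J \<le> emeasure lborel T" by (intro emeasure_mono) (use T in auto)
  moreover have "emeasure lborel J = ennreal n"
    using \<sigma> by (elim disjE) (simp_all add: J_def emeasure_lborel_Icc_eq)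
  ultimately show False using c n by (simp add: ennreal_le_iff)
qed

lemma tendsto_integral_seg:
  fixes G :: "real \<Rightarrow> complex"
  assumes G: "integrable (domain_measure TYPE('s)) G"
  shows "((\<lambda>t. \<integral>x. G x \<partial>lborel_on (seg t)) \<longlongrightarrow> (\<integral>x. G x \<partial>domain_measure TYPE('s))) at_top"
proof -
  define H where "H = (\<lambda>x. indicat_real (domain_set TYPE('s)) x *\<^sub>R G x)"
  have H: "integrable lborel H"
    using G by (simp add: integrable_restrict_space D_borel H_def)
  then have [measurable]: "H \<in> borel_measurable lborel" by simp
  have "((\<lambda>t. \<integral>x. indicat_real (seg t) x *\<^sub>R H x \<partial>lborel) \<longlongrightarrow> (\<integral>x. H x \<partial>lborel)) at_top"
  proof (rule integral_dominated_convergence_at_top[where w="\<lambda>x. norm (H x)"])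
    show "AE x in lborel. ((\<lambda>t. indicat_real (seg t) x *\<^sub>R H x) \<longlongrightarrow> H x) at_top"
    proof (rule AE_I2)
      fix x :: real
      have "\<forall>\<^sub>F t in at_top. H x = indicat_real (seg t) x *\<^sub>R H x"
        using eventually_ge_at_top[of "max 0 (\<sigma> * x)"]
        by eventually_elim (auto simp: H_def mem_seg mem_D indicator_def)
      from Lim_transform_eventually[OF tendsto_const this]
      show "((\<lambda>t. indicat_real (seg t) x *\<^sub>R H x) \<longlongrightarrow> H x) at_top" .
    qed
  qed (use H in \<open>auto simp: indicator_def\<close>)
  moreover have "\<forall>\<^sub>F t in at_top. (\<integral>x. indicat_real (seg t) x *\<^sub>R H x \<partial>lborel) = (\<integral>x. G x \<partial>lborel_on (seg t))"
    using eventually_ge_at_top[of 0]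
  proof eventually_elim
    fix t :: real assume "t \<ge> 0"
    then have "indicat_real (seg t) x *\<^sub>R H x = indicat_real (seg t) x *\<^sub>R G x" for x
      using seg_subset[of t] by (auto simp: H_def indicator_def)
    then have "(\<integral>x. indicat_real (seg t) x *\<^sub>R H x \<partial>lborel) = (\<integral>x. indicat_real (seg t) x *\<^sub>R G x \<partial>lborel)"
      by (rule Bochner_Integration.integral_cong[OF refl])
    also have "\<dots> = (\<integral>x. G x \<partial>lborel_on (seg t))"
      by (rule integral_restrict_space[symmetric]) simp
    finally show "(\<integral>x. indicat_real (seg t) x *\<^sub>R H x \<partial>lborel) = (\<integral>x. G x \<partial>lborel_on (seg t))" .
  qed
  ultimately show ?thesis
    by (simp add: integral_restrict_space D_borel H_def tendsto_cong)
qed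

text \<open>Integration by parts over \<open>seg t\<close> shows that the inner product of the
  representatives converges as t grows. It agrees almost everywhere with an integrable function, so
  the limit is 0 and only the boundary term at the end point survives.\<close>

lemma sobolev_green:
  fixes v v' y y' :: "('s, 'e::complex_hilbert) L2"
  assumes v: "(v, v') \<in> sobolev_deriv" "(v, e) \<in> sobolev_trace"
    and y: "(y, y') \<in> sobolev_deriv" "(y, d) \<in> sobolev_trace"
  shows "cinner v' y + cinner v y' = - \<sigma> * cinner e d"
proof -
  let ?M = "domain_measure TYPE('s)"
  obtain w where w: "represents w v" "primitive (rep_L2 v') w" "w 0 = e"
    using sobolev_traceE[OF v] .
  obtain u where u: "represents u y" "primitive (rep_L2 y') u" "u 0 = d"
    using sobolev_traceE[OF y] .
  define G where "G = (\<lambda>x. cinner (rep_L2 v' x) (rep_L2 y x) + cinner (rep_L2 v x) (rep_L2 y' x))"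
  define H where "H = (\<lambda>x. cinner (rep_L2 v' x) (u x) + cinner (w x) (rep_L2 y' x))"
  define F where "F = (\<lambda>x. cinner (w x) (u x))"
  note int = integrable_cinner[OF square_integrable_rep_L2 square_integrable_rep_L2]
  have G: "integrable ?M G" unfolding G_def by (intro Bochner_Integration.integrable_add int)
  have intG: "(\<integral>x. G x \<partial>?M) = cinner v' y + cinner v y'"
    unfolding G_def cinner_L2_rep by (intro Bochner_Integration.integral_add int)
  have ae: "AE x in ?M. rep_L2 v x = w x \<and> rep_L2 y x = u x"
    using w(1) u(1) by (auto simp: represents_def)
  have FH: "F (\<sigma> * t) = F 0 + \<sigma> * (\<integral>x. G x \<partial>lborel_on (seg t))" if t: "t \<ge> 0" for t
  proof -
    have sub: "seg t \<subseteq> domain_set TYPE('s)" by (rule seg_subset[OF t])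
    note ibp = seg_integration_by_parts[OF t rep_L2_strongly_measurable[OF sub]
        rep_L2_norm_integrable[OF sub[unfolded seg_def], folded seg_def]
        rep_L2_strongly_measurable[OF sub]
        rep_L2_norm_integrable[OF sub[unfolded seg_def], folded seg_def] w(2) u(2)]
    have "AE x in lborel. x \<in> domain_set TYPE('s) \<longrightarrow> rep_L2 v x = w x \<and> rep_L2 y x = u x"
      using ae unfolding AE_domain_iff .
    then have "AE x in lborel. x \<in> seg t \<longrightarrow> H x = G x"
      by eventually_elim (use sub in \<open>auto simp: H_def G_def\<close>)
    then have "AE x in lborel_on (seg t). H x = G x"
      by (simp add: AE_restrict_space_iff)
    then have "(\<integral>x. H x \<partial>lborel_on (seg t)) = (\<integral>x. G x \<partial>lborel_on (seg t))"
      using ibp(1) integrable_lborel_on_subset[OF G sub] 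
      by (intro integral_cong_AE borel_measurable_integrable) (simp_all add: H_def D_borel)
    then show ?thesis using ibp(2) by (simp add: F_def H_def algebra_simps)
  qed
  have "((\<lambda>t. F 0 + \<sigma> * (\<integral>x. G x \<partial>lborel_on (seg t))) \<longlongrightarrow> F 0 + \<sigma> * (\<integral>x. G x \<partial>?M)) at_top"
    by (intro tendsto_intros tendsto_integral_seg G)
  moreover have "\<forall>\<^sub>F t in at_top. F 0 + \<sigma> * (\<integral>x. G x \<partial>lborel_on (seg t)) = F (\<sigma> * t)"
    using eventually_ge_at_top[of 0] by eventually_elim (simp add: FH)
  ultimately have lim: "((\<lambda>t. F (\<sigma> * t)) \<longlongrightarrow> F 0 + \<sigma> * (\<integral>x. G x \<partial>?M)) at_top"
    by (rule Lim_transform_eventually)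
  have "F 0 + \<sigma> * (\<integral>x. G x \<partial>?M) = 0"
  proof (rule limit_zero_if_integrable[OF _ _ lim])
    show "integrable ?M (\<lambda>x. cinner (rep_L2 v x) (rep_L2 y x))" by (rule int)
    show "AE x in ?M. F x = cinner (rep_L2 v x) (rep_L2 y x)"
      using ae by eventually_elim (simp add: F_def)
  qed
  \<comment> \<open>Multiplying by \<sigma>, whose square is 1, solves for the integral of
    G.\<close>
  then have "\<sigma> * F 0 + (complex_of_real \<sigma> * complex_of_real \<sigma>) * (\<integral>x. G x \<partial>?M) = 0"
    unfolding mult.assoc distrib_left[symmetric] by simp
  moreover have "complex_of_real \<sigma> * complex_of_real \<sigma> = 1" using \<sigma> by auto
  ultimately have "(\<integral>x. G x \<partial>?M) = - \<sigma> * F 0"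
    by (simp add: eq_neg_iff_add_eq_0 add.commute)
  then show ?thesis by (simp add: intG F_def w u)
qed

text \<open>The continuous representative of 0 vanishes identically, so the derivative integrates to
  0 over every segment. Needed for single-valuedness of the dilation.\<close>

lemma sobolev_deriv_zero:
  fixes v' :: "('s, 'e::complex_hilbert) L2"
  assumes "(0, v') \<in> sobolev_deriv"
  shows "v' = 0"
proof (rule L2_eq_zeroI, rule AE_zero_if_cinner_integral_seg_zero)
  obtain w where w: "represents w (0 :: ('s, 'e) L2)" "primitive (rep_L2 v') w"
    using sobolev_derivE[OF assms] .
  have w0: "w x = 0" if "x \<in> domain_set TYPE('s)" for x
    using represents_unique[OF w(1) primitive_continuous[OF w(2)] represents_zero _ that] by simp
  show "strongly_measurable (domain_measure TYPE('s)) (rep_L2 v')"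
    by (rule rep_L2_strongly_measurable) simp
  fix b :: real and e assume b: "b > 0"
  have sub: "seg b \<subseteq> domain_set TYPE('s)" using b by (intro seg_subset) simp
  show int: "integrable (lborel_on (seg b)) (\<lambda>x. cinner (rep_L2 v' x) e)"
  proof (rule Bochner_Integration.integrable_bound)
    show "integrable (lborel_on (seg b)) (\<lambda>x. norm (rep_L2 v' x) * norm e)"
      using rep_L2_norm_integrable[OF sub[unfolded seg_def], folded seg_def]
      by (intro integrable_mult_left)
    show "(\<lambda>x. cinner (rep_L2 v' x) e) \<in> borel_measurable (lborel_on (seg b))"
      by (rule borel_measurable_bilinear[OF rep_L2_strongly_measurable[OF sub] strongly_measurable_const tendsto_cinner])
  qed (auto intro!: cmod_cinner_le)
  have "(rep_L2 v' has_integral (w (max 0 (\<sigma> * b)) - w (min 0 (\<sigma> * b)))) (seg b)"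
    using primitiveD[OF w(2) _ sub[unfolded seg_def]] by (simp add: seg_def)
  moreover have "w (max 0 (\<sigma> * b)) = 0" "w (min 0 (\<sigma> * b)) = 0"
    by (rule w0, use sub in \<open>force simp: seg_def\<close>)+
  ultimately have "(rep_L2 v' has_integral 0) (seg b)" by simp
  from has_integral_linear[OF this cinner_linear_left[of e]]
  have "((\<lambda>x. cinner (rep_L2 v' x) e) has_integral 0) (seg b)" by (simp add: o_def)
  from has_integral_unique[OF has_integral_lborel_on[OF _ int] this]
  show "(\<integral>x. cinner (rep_L2 v' x) e \<partial>lborel_on (seg b)) = 0" by simp
qed

section \<open>Scalar test functions\<close>

text \<open>Elementary products of a scalar function and a vector; they reduce derivatives, traces
  and pairings to scalar calculus.\<close>

definition test :: "(real \<Rightarrow> real) \<Rightarrow> 'e \<Rightarrow> ('s, 'e::complex_hilbert) L2" where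
  "test \<phi> e = abs_L2 (\<lambda>x. \<phi> x *\<^sub>R e)"

definition scalar_sobolev :: "(real \<Rightarrow> real) \<Rightarrow> (real \<Rightarrow> real) \<Rightarrow> bool" where
  "scalar_sobolev \<phi> \<phi>' \<longleftrightarrow> square_integrable (domain_measure TYPE('s)) \<phi> \<and>
     square_integrable (domain_measure TYPE('s)) \<phi>' \<and> primitive \<phi>' \<phi>"

lemma strongly_measurable_if_borel:
  fixes \<phi> :: "'x \<Rightarrow> 'b::{real_normed_vector, second_countable_topology}"
  assumes "\<phi> \<in> borel_measurable M"
  shows "strongly_measurable M \<phi>"
  using borel_measurable_implies_sequence_metric[OF assms] unfolding strongly_measurable_def by blast

lemma square_integrable_scaleR:
  fixes \<phi> :: "'x \<Rightarrow> real" and e :: "'e::real_normed_vector"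
  assumes "square_integrable M \<phi>"
  shows "square_integrable M (\<lambda>x. \<phi> x *\<^sub>R e)"
proof -
  have "isCont (\<lambda>r. r *\<^sub>R e) r" for r :: real
    by (rule linear_continuous_at[OF bounded_linear_scaleR_left])
  with assms have "strongly_measurable M (\<lambda>x. \<phi> x *\<^sub>R e)"
    using strongly_measurable_compose[of M \<phi> "\<lambda>r. r *\<^sub>R e"] by (auto simp: square_integrable_def)
  then show ?thesis using assms by (simp add: square_integrable_def power_mult_distrib)
qed

text \<open>Boundedness in e lets Riesz representation turn a family of pairings into a trace
  vector.\<close>

lemma bounded_clinear_test:
  assumes \<phi>: "square_integrable (domain_measure TYPE('s)) \<phi>"
  shows "bounded_clinear (test \<phi> :: 'e::complex_hilbert \<Rightarrow> ('s, 'e) L2)"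
proof -
  let ?M = "domain_measure TYPE('s)"
  have rel: "L2_rel TYPE('s) (\<lambda>x. \<phi> x *\<^sub>R e) (\<lambda>x. \<phi> x *\<^sub>R e)" for e :: 'e
    by (simp add: L2_rel_self_iff square_integrable_scaleR[OF \<phi>])
  have add: "test \<phi> (d + e) = test \<phi> d + test \<phi> e" for d e :: 'e
    using plus_L2.abs_eq[OF rel[of d] rel[of e]] by (simp only: test_def scaleR_add_right)
  have scale: "test \<phi> (c *\<^sub>C e) = c *\<^sub>C test \<phi> e" for c and e :: 'e
  proof -
    have "(\<lambda>x. \<phi> x *\<^sub>R c *\<^sub>C e) = (\<lambda>x. c *\<^sub>C \<phi> x *\<^sub>R e)"
      by (simp only: scaleR_scaleC scaleC_scaleC mult.commute)
    then show ?thesis using scaleC_L2.abs_eq[OF rel[of e], of c] by (simp only: test_def)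
  qed
  have "bounded_linear (test \<phi> :: 'e \<Rightarrow> ('s, 'e) L2)"
  proof (rule bounded_linear_intro)
    fix e :: 'e
    define I where "I = (\<integral>x. (norm (\<phi> x))\<^sup>2 \<partial>?M)"
    have "0 \<le> I" unfolding I_def by (rule Bochner_Integration.integral_nonneg) simp
    have "(norm (test \<phi> e :: ('s, 'e) L2))\<^sup>2 = (\<integral>x. (norm (\<phi> x))\<^sup>2 * (norm e)\<^sup>2 \<partial>?M)"
      unfolding test_def norm_L2_abs[OF square_integrable_scaleR[OF \<phi>]]
      by (simp only: norm_scaleR real_norm_def power_mult_distrib)
    then have "(norm (test \<phi> e :: ('s, 'e) L2))\<^sup>2 = I * (norm e)\<^sup>2"
      unfolding I_def by (simp only: integral_mult_left_zero)
    then have "(norm (test \<phi> e :: ('s, 'e) L2))\<^sup>2 \<le> (norm e * sqrt I)\<^sup>2"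
      using real_sqrt_pow2[OF \<open>0 \<le> I\<close>] by (simp only: power_mult_distrib mult.commute order_refl)
    moreover have "0 \<le> norm e * sqrt I" using \<open>0 \<le> I\<close> by simp
    ultimately show "norm (test \<phi> e :: ('s, 'e) L2) \<le> norm e * sqrt (\<integral>x. (norm (\<phi> x))\<^sup>2 \<partial>?M)"
      unfolding I_def by (rule power2_le_imp_le)
    show "test \<phi> (r *\<^sub>R e) = r *\<^sub>R test \<phi> e" for r by (simp only: scale scaleR_scaleC)
  qed (rule add)
  with scale show ?thesis by (simp add: bounded_clinear_def)
qed

lemma cinner_test:
  fixes \<phi> :: "real \<Rightarrow> real"
  assumes "square_integrable (domain_measure TYPE('s)) \<phi>"
  shows "cinner (test \<phi> e) v = (\<integral>x. \<phi> x * cinner e (rep_L2 v x) \<partial>domain_measure TYPE('s))"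
  unfolding test_def cinner_abs_L2[OF square_integrable_scaleR[OF assms]] by (simp add: cinner_scaleR_left)

lemma integrable_cinner_test:
  fixes v :: "('s, 'e::complex_hilbert) L2" and \<phi> :: "real \<Rightarrow> real"
  assumes "square_integrable (domain_measure TYPE('s)) \<phi>"
  shows "integrable (domain_measure TYPE('s)) (\<lambda>x. \<phi> x * cinner e (rep_L2 v x))"
  using integrable_cinner[OF square_integrable_scaleR[OF assms, of e] square_integrable_rep_L2[of v]]
  by (simp add: cinner_scaleR_left)

lemma primitive_scaleR:
  fixes e :: "'e::real_normed_vector"
  assumes "primitive \<phi>' \<phi>"
  shows "primitive (\<lambda>x. \<phi>' x *\<^sub>R e) (\<lambda>x. \<phi> x *\<^sub>R e)"
  unfolding primitive_def
proof (intro allI impI)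
  fix a b :: real assume "a \<le> b \<and> {a..b} \<subseteq> domain_set TYPE('s)"
  then have "(\<phi>' has_integral (\<phi> b - \<phi> a)) {a..b}" by (intro primitiveD[OF assms]) auto
  from has_integral_scaleR_left[OF this, of e]
  show "((\<lambda>x. \<phi>' x *\<^sub>R e) has_integral (\<phi> b *\<^sub>R e - \<phi> a *\<^sub>R e)) {a..b}"
    by (simp add: scaleR_diff_left)
qed

lemma test_sobolev:
  assumes "scalar_sobolev \<phi> \<phi>'"
  shows "(test \<phi> e, test \<phi>' e) \<in> sobolev_deriv" "(test \<phi> e, \<phi> 0 *\<^sub>R e) \<in> sobolev_trace"
proof -
  have \<phi>: "square_integrable (domain_measure TYPE('s)) \<phi>" "square_integrable (domain_measure TYPE('s)) \<phi>'"
    "primitive \<phi>' \<phi>" using assms by (auto simp: scalar_sobolev_def)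
  note rep = represents_abs_L2[OF square_integrable_scaleR[OF \<phi>(1), of e], folded test_def]
    represents_abs_L2[OF square_integrable_scaleR[OF \<phi>(2), of e], folded test_def]
  show "(test \<phi> e, test \<phi>' e) \<in> sobolev_deriv"
    unfolding sobolev_deriv_def mem_Collect_eq case_prod_conv
    using rep primitive_scaleR[OF \<phi>(3), of e] unfolding primitive_def by blast
  show "(test \<phi> e, \<phi> 0 *\<^sub>R e) \<in> sobolev_trace"
    unfolding sobolev_trace_def mem_Collect_eq case_prod_conv
    using rep(1) primitive_continuous[OF \<phi>(3)] by (intro exI conjI) (auto intro!: continuous_intros)
qed

lemma scalar_sobolev_lincomb:
  assumes "scalar_sobolev \<phi> \<phi>'" "scalar_sobolev \<psi> \<psi>'"
  shows "scalar_sobolev (\<lambda>x. \<phi> x - c * \<psi> x) (\<lambda>x. \<phi>' x - c * \<psi>' x)"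
proof -
  have mult: "square_integrable M (\<lambda>x. c * f x)" if "square_integrable M f" for f :: "real \<Rightarrow> real" and M
    using square_integrable_scaleR[OF that, of c] by (simp add: mult.commute)
  have "primitive (\<lambda>x. \<phi>' x - c * \<psi>' x) (\<lambda>x. \<phi> x - c * \<psi> x)"
    unfolding primitive_def
  proof (intro allI impI)
    fix a b :: real assume ab: "a \<le> b \<and> {a..b} \<subseteq> domain_set TYPE('s)"
    have "((\<lambda>x. \<phi>' x - c * \<psi>' x) has_integral (\<phi> b - \<phi> a) - c * (\<psi> b - \<psi> a)) {a..b}"
      using assms ab unfolding scalar_sobolev_def
      by (intro has_integral_diff has_integral_mult_right primitiveD) auto
    then show "((\<lambda>x. \<phi>' x - c * \<psi>' x) has_integral \<phi> b - c * \<psi> b - (\<phi> a - c * \<psi> a)) {a..b}"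
      by (simp add: algebra_simps)
  qed
  then show ?thesis
    using assms by (auto simp: scalar_sobolev_def intro!: square_integrable_diff mult)
qed

text \<open>A ramp of value b at the end point that vanishes beyond \<open>seg b\<close>. Its slope
  there is constant, so pairing with the derivative yields plain integrals over segments, and these
  determine a function almost everywhere.\<close>

definition tent :: "real \<Rightarrow> real \<Rightarrow> real" where "tent b x = max 0 (b - \<sigma> * x)"

definition tent' :: "real \<Rightarrow> real \<Rightarrow> real" where "tent' b x = - \<sigma> * indicat_real (seg b) x"

lemma square_integrable_if_bounded_seg:
  fixes \<phi> :: "real \<Rightarrow> real"
  assumes [measurable]: "\<phi> \<in> borel_measurable borel" and b: "b \<ge> 0"
    and bound: "\<And>x. x \<in> domain_set TYPE('s) \<Longrightarrow> \<bar>\<phi> x\<bar> \<le> C * indicat_real (seg b) x"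
  shows "square_integrable (domain_measure TYPE('s)) \<phi>"
  unfolding square_integrable_def
proof
  show "strongly_measurable (domain_measure TYPE('s)) \<phi>"
    by (intro strongly_measurable_if_borel measurable_restrict_space1) simp
  have "integrable lborel (\<lambda>x. indicat_real (domain_set TYPE('s)) x *\<^sub>R (norm (\<phi> x))\<^sup>2)"
  proof (rule Bochner_Integration.integrable_bound)
    show "integrable lborel (\<lambda>x. C\<^sup>2 * indicat_real (seg b) x)"
      by (intro integrable_mult_right integrable_real_indicator) (simp_all add: seg_def emeasure_lborel_Icc_eq)
    show "(\<lambda>x. indicat_real (domain_set TYPE('s)) x *\<^sub>R (norm (\<phi> x))\<^sup>2) \<in> borel_measurable lborel"
      using D_borel by measurable
    have "norm (indicat_real (domain_set TYPE('s)) x *\<^sub>R (norm (\<phi> x))\<^sup>2) \<le> norm (C\<^sup>2 * indicat_real (seg b) x)" for x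
    proof (cases "x \<in> domain_set TYPE('s)")
      case True
      then have "(\<bar>\<phi> x\<bar>)\<^sup>2 \<le> (C * indicat_real (seg b) x)\<^sup>2" by (intro power_mono bound) auto
      then show ?thesis using True by (cases "x \<in> seg b") (simp_all add: power_mult_distrib)
    qed simp
    then show "AE x in lborel. norm (indicat_real (domain_set TYPE('s)) x *\<^sub>R (norm (\<phi> x))\<^sup>2) \<le> norm (C\<^sup>2 * indicat_real (seg b) x)"
      by (intro AE_I2)
  qed
  then show "integrable (domain_measure TYPE('s)) (\<lambda>x. (norm (\<phi> x))\<^sup>2)"
    by (simp add: integrable_restrict_space D_borel)
qed

lemma scalar_sobolev_tent:
  assumes b: "b > 0"
  shows "scalar_sobolev (tent b) (tent' b)"
  unfolding scalar_sobolev_def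
proof (intro conjI)
  show "square_integrable (domain_measure TYPE('s)) (tent b)"
  proof (rule square_integrable_if_bounded_seg[where C=b and b=b])
    show "tent b \<in> borel_measurable borel" unfolding tent_def[abs_def] by measurable
    show "\<bar>tent b x\<bar> \<le> b * indicat_real (seg b) x" if "x \<in> domain_set TYPE('s)" for x
      using that b by (auto simp: tent_def mem_seg mem_D indicator_def)
  qed (use b in simp)
  show "square_integrable (domain_measure TYPE('s)) (tent' b)"
  proof (rule square_integrable_if_bounded_seg[where C=1 and b=b])
    show "tent' b \<in> borel_measurable borel" unfolding tent'_def[abs_def] by measurable
    show "\<bar>tent' b x\<bar> \<le> 1 * indicat_real (seg b) x" for x
      by (simp add: tent'_def abs_mult indicator_def)
  qed (use b in simp)
  show "primitive (tent' b) (tent b)"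
    unfolding primitive_def
  proof (intro allI impI)
    fix x y :: real assume xy: "x \<le> y \<and> {x..y} \<subseteq> domain_set TYPE('s)"
    show "(tent' b has_integral tent b y - tent b x) {x..y}"
    \<comment> \<open>The tent has a kink at \<sigma> * b; leaving out 0 makes \<sigma> * t strictly
      positive at the remaining points.\<close>
    proof (rule fundamental_theorem_of_calculus_interior_strong[where S="{0, \<sigma> * b}"])
      show "continuous_on {x..y} (tent b)"
        unfolding tent_def[abs_def] by (intro continuous_intros)
      fix t assume t: "t \<in> {x<..<y} - {0, \<sigma> * b}"
      then have "t \<in> domain_set TYPE('s)" using xy by auto
      then have t0: "0 < \<sigma> * t" using t \<sigma> by (auto simp: mem_D)
      have tb: "\<sigma> * t \<noteq> b" using t \<sigma> by auto
      show "(tent b has_vector_derivative tent' b t) (at t)"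
      proof (cases "\<sigma> * t < b")
        case True
        have "((\<lambda>t. b - \<sigma> * t) has_vector_derivative - \<sigma>) (at t)"
          by (auto intro!: derivative_eq_intros)
        moreover have "open {s. \<sigma> * s < b}" by (intro open_Collect_less continuous_intros)
        ultimately have "(tent b has_vector_derivative - \<sigma>) (at t)"
          by (rule has_vector_derivative_transform_within_open) (use True in \<open>auto simp: tent_def\<close>)
        then show ?thesis using t0 True b by (simp add: tent'_def mem_seg)
      next
        case False
        then have tb': "b < \<sigma> * t" using tb by simp
        have "((\<lambda>t. 0) has_vector_derivative 0) (at t)" by simp
        moreover have "open {s. b < \<sigma> * s}" by (intro open_Collect_less continuous_intros)
        ultimately have "(tent b has_vector_derivative 0) (at t)"
          by (rule has_vector_derivative_transform_within_open) (use tb' in \<open>auto simp: tent_def\<close>)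
        then show ?thesis using tb' b by (simp add: tent'_def mem_seg)
      qed
    qed (use xy in auto)
  qed
qed

definition decay :: "real \<Rightarrow> real \<Rightarrow> real" where "decay s x = exp (- s * (\<sigma> * x))"

lemma integrable_decay:
  assumes s: "s > 0"
  shows "integrable (domain_measure TYPE('s)) (decay s)"
proof -
  have "((\<lambda>x. exp (- s * x)) has_integral exp (- s * 0) / s) {0..}"
    by (rule has_integral_exp_minus_to_infinity[OF s])
  then have "(\<lambda>x. exp (- s * x)) absolutely_integrable_on {0..}"
    by (intro nonnegative_absolutely_integrable_1) auto
  then have "integrable lborel (\<lambda>x. indicat_real {0..} x * exp (- s * x))"
    by (simp add: set_integrable_def integrable_completion)
  from lborel_integrable_real_affine[OF this, of \<sigma> 0]
  have "integrable lborel (\<lambda>x. indicat_real {0..} (\<sigma> * x) * exp (- s * (\<sigma> * x)))"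
    using \<sigma> by auto
  moreover have "indicat_real {0..} (\<sigma> * x) * exp (- s * (\<sigma> * x)) =
      indicat_real (domain_set TYPE('s)) x *\<^sub>R decay s x" for x
    by (simp add: decay_def indicator_def mem_D)
  ultimately show ?thesis by (simp add: integrable_restrict_space D_borel)
qed

lemma square_integrable_decay:
  assumes s: "s > 0"
  shows "square_integrable (domain_measure TYPE('s)) (decay s)"
  unfolding square_integrable_def
proof
  have "decay s \<in> borel_measurable borel" unfolding decay_def[abs_def] by measurable
  then show "strongly_measurable (domain_measure TYPE('s)) (decay s)"
    by (intro strongly_measurable_if_borel measurable_restrict_space1) simp
  have "(norm (decay s x))\<^sup>2 = decay (2 * s) x" for x
    by (simp add: decay_def power2_eq_square exp_add[symmetric])
  then show "integrable (domain_measure TYPE('s)) (\<lambda>x. (norm (decay s x))\<^sup>2)"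
    using integrable_decay[of "2 * s"] s by simp
qed

lemma scalar_sobolev_decay:
  assumes s: "s > 0"
  shows "scalar_sobolev (decay s) (\<lambda>x. (- s * \<sigma>) * decay s x)"
  unfolding scalar_sobolev_def
proof (intro conjI square_integrable_decay s)
  show "square_integrable (domain_measure TYPE('s)) (\<lambda>x. (- s * \<sigma>) * decay s x)"
    using square_integrable_scaleR[OF square_integrable_decay[OF s], of "- s * \<sigma>"] by (simp add: mult.commute)
  show "primitive (\<lambda>x. (- s * \<sigma>) * decay s x) (decay s)"
    unfolding primitive_def
  proof (intro allI impI)
    fix x y :: real assume "x \<le> y \<and> {x..y} \<subseteq> domain_set TYPE('s)"
    then show "((\<lambda>x. (- s * \<sigma>) * decay s x) has_integral decay s y - decay s x) {x..y}"
      unfolding decay_def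
      by (intro fundamental_theorem_of_calculus)
        (auto intro!: derivative_eq_intros simp: has_real_derivative_iff_has_vector_derivative[symmetric])
  qed
qed

section \<open>Weak derivatives\<close>

lemma tent_zero: "b > 0 \<Longrightarrow> tent b 0 = b" by (simp add: tent_def)

lemma tent_eq_zero: "x \<in> domain_set TYPE('s) \<Longrightarrow> b > 0 \<Longrightarrow> x \<notin> seg b \<Longrightarrow> tent b x = 0"
  by (auto simp: tent_def mem_seg mem_D)

lemma integral_domain_seg:
  fixes f :: "real \<Rightarrow> complex"
  assumes b: "b > 0" and f: "\<And>x. x \<in> domain_set TYPE('s) \<Longrightarrow> x \<notin> seg b \<Longrightarrow> f x = 0"
  shows "(\<integral>x. f x \<partial>domain_measure TYPE('s)) = (\<integral>x. f x \<partial>lborel_on (seg b))"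
proof -
  have "indicat_real (domain_set TYPE('s)) x *\<^sub>R f x = indicat_real (seg b) x *\<^sub>R f x" for x
  proof (cases "x \<in> seg b")
    case True
    then have "x \<in> domain_set TYPE('s)" using seg_subset[of b] b by auto
    with True show ?thesis by simp
  next
    case False
    then show ?thesis using f[of x] by (cases "x \<in> domain_set TYPE('s)") auto
  qed
  then have "(\<integral>x. indicat_real (domain_set TYPE('s)) x *\<^sub>R f x \<partial>lborel) = (\<integral>x. indicat_real (seg b) x *\<^sub>R f x \<partial>lborel)"
    by (rule Bochner_Integration.integral_cong[OF refl])
  moreover have "(\<integral>x. f x \<partial>domain_measure TYPE('s)) = (\<integral>x. indicat_real (domain_set TYPE('s)) x *\<^sub>R f x \<partial>lborel)"
    by (rule integral_restrict_space) (simp add: D_borel)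
  moreover have "(\<integral>x. f x \<partial>lborel_on (seg b)) = (\<integral>x. indicat_real (seg b) x *\<^sub>R f x \<partial>lborel)"
    by (rule integral_restrict_space) simp
  ultimately show ?thesis by simp
qed

text \<open>The factor \<sigma> orients the integral from 0 to x on either half-line.\<close>

lemma primitive_integral:
  fixes k :: "('s, 'e::complex_hilbert) L2" and e :: 'e
  defines "w \<equiv> \<lambda>x. e + \<sigma> *\<^sub>R integral (seg (\<sigma> * x)) (rep_L2 k)"
  shows "primitive (rep_L2 k) w" "w 0 = e"
proof -
  have int: "rep_L2 k integrable_on {a..b}" if "{a..b} \<subseteq> domain_set TYPE('s)" for a b
    by (intro strongly_measurable_integrable_on rep_L2_strongly_measurable rep_L2_norm_integrable that)
  show "w 0 = e" by (simp add: w_def seg_def)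
  show "primitive (rep_L2 k) w"
    unfolding primitive_def
  proof (intro allI impI)
    fix a b :: real assume ab: "a \<le> b \<and> {a..b} \<subseteq> domain_set TYPE('s)"
    then have abD: "a \<in> domain_set TYPE('s)" "b \<in> domain_set TYPE('s)" by auto
    have "integral {a..b} (rep_L2 k) = w b - w a"
    proof (cases "\<sigma> = 1")
      case True
      have "seg (\<sigma> * b) = {0..b}" "seg (\<sigma> * a) = {0..a}" "0 \<le> a"
        using abD unfolding seg_def mem_D by (auto simp: True)
      moreover have "{0..b} \<subseteq> domain_set TYPE('s)" by (rule interval_subset) (use abD in auto)
      ultimately show ?thesis
        using Henstock_Kurzweil_Integration.integral_combine[of 0 a b "rep_L2 k"] ab int[of 0 b]
        by (simp add: w_def True algebra_simps)
    next
      case False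
      then have s: "\<sigma> = -1" using \<sigma> by simp
      have "seg (\<sigma> * b) = {b..0}" "seg (\<sigma> * a) = {a..0}" "b \<le> 0"
        using abD unfolding seg_def mem_D by (auto simp: s)
      moreover have "{a..0} \<subseteq> domain_set TYPE('s)" by (rule interval_subset) (use abD in auto)
      ultimately show ?thesis
        using Henstock_Kurzweil_Integration.integral_combine[of a b 0 "rep_L2 k"] ab int[of a 0]
        by (simp add: w_def s algebra_simps)
    qed
    with int[of a b] ab show "(rep_L2 k has_integral w b - w a) {a..b}"
      by (simp only: has_integral_integrable_integral)
  qed
qed

lemma strongly_measurable_domain_continuous:
  fixes w :: "real \<Rightarrow> 'b::real_normed_vector"
  assumes "continuous_on (domain_set TYPE('s)) w"
  shows "strongly_measurable (domain_measure TYPE('s)) w"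
proof (rule strongly_measurable_continuous_retract[OF assms, of "\<lambda>x. \<sigma> * max 0 (\<sigma> * x)"])
  show "\<sigma> * max 0 (\<sigma> * x) = x" if "x \<in> domain_set TYPE('s)" for x
    using that by (simp add: mem_D max_def)
qed (auto simp: mem_D intro!: continuous_intros)

text \<open>Compare y with the primitive w of k that starts at d. Integration by parts gives w the
  same identity against tents as the assumption gives y, so w - y has zero integral over every
  segment and w represents y.\<close>

lemma sobolev_if_weak_derivative:
  fixes y k :: "('s, 'e::complex_hilbert) L2"
  assumes weak: "\<And>b e. b > 0 \<Longrightarrow>
    cinner (test (tent' b) e) y + cinner (test (tent b) e) k = - \<sigma> * b * cinner e d"
  shows "(y, k) \<in> sobolev_deriv" "(y, d) \<in> sobolev_trace"
proof -
  define w where "w = (\<lambda>x. d + \<sigma> *\<^sub>R integral (seg (\<sigma> * x)) (rep_L2 k))"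
  have w: "primitive (rep_L2 k) w" "w 0 = d" unfolding w_def by (rule primitive_integral)+
  have cw: "continuous_on (domain_set TYPE('s)) w" by (rule primitive_continuous[OF w(1)])
  have smw: "strongly_measurable (domain_measure TYPE('s)) w"
    by (rule strongly_measurable_domain_continuous[OF cw])
  have smd: "strongly_measurable (domain_measure TYPE('s)) (\<lambda>x. w x - rep_L2 y x)"
    by (intro strongly_measurable_diff smw rep_L2_strongly_measurable) simp
  have int_zero: "integrable (lborel_on (seg b)) (\<lambda>x. cinner (w x - rep_L2 y x) e) \<and>
      (\<integral>x. cinner (w x - rep_L2 y x) e \<partial>lborel_on (seg b)) = 0" if b: "b > 0" for b and e :: 'e
  proof -
    let ?M = "lborel_on (seg b)"
    have sub: "seg b \<subseteq> domain_set TYPE('s)" using seg_subset[of b] b by simp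
    have sob: "scalar_sobolev (tent b) (tent' b)" by (rule scalar_sobolev_tent[OF b])
    then have sq: "square_integrable (domain_measure TYPE('s)) (tent b)"
      "square_integrable (domain_measure TYPE('s)) (tent' b)" "primitive (tent' b) (tent b)"
      by (auto simp: scalar_sobolev_def)
    note on_seg = integrable_lborel_on_subset[OF _ sub seg_borel D_borel]
    define Y where "Y = (\<lambda>x. tent' b x * cinner e (rep_L2 y x))"
    define K where "K = (\<lambda>x. tent b x * cinner e (rep_L2 k x))"
    define W where "W = (\<lambda>x. tent' b x * cinner e (w x))"
    have intY: "integrable ?M Y" and intK: "integrable ?M K"
      unfolding Y_def K_def by (intro on_seg integrable_cinner_test sq)+
    have bm: "tent' b \<in> borel_measurable ?M"
      unfolding tent'_def[abs_def] by (intro measurable_restrict_space1) measurable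
    have "strongly_measurable ?M (\<lambda>x. tent' b x *\<^sub>R e)"
      using square_integrable_scaleR[OF sq(2), of e] sub
      by (auto simp: square_integrable_def intro: strongly_measurable_lborel_on_subset)
    moreover have "integrable ?M (\<lambda>x. norm (tent' b x *\<^sub>R e))"
    proof (rule Bochner_Integration.integrable_bound)
      show "integrable ?M (\<lambda>x. norm e)"
        by (simp add: integrable_restrict_space seg_def emeasure_lborel_Icc_eq)
      show "(\<lambda>x. norm (tent' b x *\<^sub>R e)) \<in> borel_measurable ?M" using bm by simp
    qed (auto simp: tent'_def abs_mult indicator_def)
    ultimately have ibp: "integrable ?M (\<lambda>x. cinner (tent' b x *\<^sub>R e) (w x) + cinner (tent b x *\<^sub>R e) (rep_L2 k x))"
      "cinner (tent b (\<sigma> * b) *\<^sub>R e) (w (\<sigma> * b)) - cinner (tent b 0 *\<^sub>R e) (w 0) =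
        \<sigma> * (\<integral>x. cinner (tent' b x *\<^sub>R e) (w x) + cinner (tent b x *\<^sub>R e) (rep_L2 k x) \<partial>?M)"
      using seg_integration_by_parts[OF less_imp_le[OF b] _ _ rep_L2_strongly_measurable[OF sub]
        rep_L2_norm_integrable[OF sub[unfolded seg_def], folded seg_def] primitive_scaleR[OF sq(3)] w(1)] by auto
    have intWK: "integrable ?M (\<lambda>x. W x + K x)"
      using ibp(1) by (simp add: W_def K_def cinner_scaleR_left)
    have intW: "integrable ?M W"
      using Bochner_Integration.integrable_diff[OF intWK intK] by simp
    have "- (b * cinner e d) = \<sigma> * (\<integral>x. W x + K x \<partial>?M)"
      using ibp(2) b by (simp add: W_def K_def cinner_scaleR_left w(2) tent_def)
    then have 1: "\<sigma> * (\<integral>x. W x \<partial>?M) + \<sigma> * (\<integral>x. K x \<partial>?M) = - (b * cinner e d)"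
      by (simp add: Bochner_Integration.integral_add[OF intW intK] distrib_left)
    have "cinner (test (tent' b) e) y = (\<integral>x. Y x \<partial>?M)"
      unfolding cinner_test[OF sq(2)] Y_def
      by (rule integral_domain_seg[OF b]) (simp add: tent'_def)
    moreover have "cinner (test (tent b) e) k = (\<integral>x. K x \<partial>?M)"
      unfolding cinner_test[OF sq(1)] K_def
      by (rule integral_domain_seg[OF b]) (simp add: tent_eq_zero[OF _ b])
    ultimately have 2: "(\<integral>x. Y x \<partial>?M) + (\<integral>x. K x \<partial>?M) = - \<sigma> * b * cinner e d"
      using weak[OF b, of e] by simp
    have s2: "complex_of_real \<sigma> * complex_of_real \<sigma> = 1" using \<sigma> by auto
    have "\<sigma> * (\<integral>x. Y x \<partial>?M) + \<sigma> * (\<integral>x. K x \<partial>?M) = - ((complex_of_real \<sigma> * complex_of_real \<sigma>) * (b * cinner e d))"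
      unfolding distrib_left[symmetric] 2 by (simp add: mult.assoc)
    then have "\<sigma> * (\<integral>x. W x \<partial>?M) + \<sigma> * (\<integral>x. K x \<partial>?M) = \<sigma> * (\<integral>x. Y x \<partial>?M) + \<sigma> * (\<integral>x. K x \<partial>?M)"
      by (simp only: 1 s2 mult_1_left)
    then have 3: "\<sigma> * (\<integral>x. W x \<partial>?M) = \<sigma> * (\<integral>x. Y x \<partial>?M)" by (simp only: add_right_cancel)
    \<comment> \<open>On \<open>seg b\<close> the derivative of the tent is the constant -\<sigma>,
      so the difference of the two pairings is, up to sign, the integral of w - y against e.\<close>
    have WY: "W x - Y x = - \<sigma> * cinner e (w x - rep_L2 y x)" if "x \<in> seg b" for x
      using that by (simp add: W_def Y_def tent'_def cinner_diff_right algebra_simps)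
    have "integrable ?M (\<lambda>x. (- \<sigma>) * (W x - Y x))"
      by (intro integrable_mult_right Bochner_Integration.integrable_diff intW intY)
    moreover have eq: "(- \<sigma>) * (W x - Y x) = cinner e (w x - rep_L2 y x)" if "x \<in> space ?M" for x
    proof -
      have "(- \<sigma>) * (W x - Y x) = (complex_of_real \<sigma> * complex_of_real \<sigma>) * cinner e (w x - rep_L2 y x)"
        using WY[of x] that by (simp add: space_restrict_space)
      then show ?thesis by (simp add: s2)
    qed
    ultimately have int: "integrable ?M (\<lambda>x. cinner e (w x - rep_L2 y x))"
      using Bochner_Integration.integrable_cong[OF refl eq, of ?M] by simp
    have "(\<integral>x. cinner e (w x - rep_L2 y x) \<partial>?M) = (\<integral>x. (- \<sigma>) * (W x - Y x) \<partial>?M)"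
      by (rule Bochner_Integration.integral_cong[OF refl eq[symmetric]])
    also have "\<dots> = (- \<sigma>) * ((\<integral>x. W x \<partial>?M) - (\<integral>x. Y x \<partial>?M))"
      by (simp only: integral_mult_right_zero Bochner_Integration.integral_diff[OF intW intY])
    also have "\<dots> = 0" using 3 \<sigma> by auto
    finally have "(\<integral>x. cinner e (w x - rep_L2 y x) \<partial>?M) = 0" .
    then have "(\<integral>x. cnj (cinner e (w x - rep_L2 y x)) \<partial>?M) = 0"
      by (simp only: Bochner_Integration.integral_cnj complex_cnj_zero)
    moreover have "integrable ?M (\<lambda>x. cnj (cinner e (w x - rep_L2 y x)))"
      using int by simp
    ultimately show ?thesis by (simp only: cinner_commute[of _ e, symmetric])
  qed
  have "AE x in domain_measure TYPE('s). w x - rep_L2 y x = 0"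
    by (rule AE_zero_if_cinner_integral_seg_zero[OF smd]) (use int_zero in blast)+
  then have "represents w y" unfolding represents_def by eventually_elim simp
  from sobolev_memI[OF this w(1)] show "(y, k) \<in> sobolev_deriv" "(y, d) \<in> sobolev_trace"
    by (simp_all add: w(2))
qed

lemma cinner_test_lincomb:
  assumes "square_integrable (domain_measure TYPE('s)) \<phi>" "square_integrable (domain_measure TYPE('s)) \<psi>"
    and "square_integrable (domain_measure TYPE('s)) (\<lambda>x. \<phi> x - c * \<psi> x)"
  shows "cinner (test (\<lambda>x. \<phi> x - c * \<psi> x) e) v = cinner (test \<phi> e) v - c * cinner (test \<psi> e) v"
proof -
  note int = integrable_cinner_test[OF assms(1), of e v] integrable_cinner_test[OF assms(2), of e v]
  have "cinner (test (\<lambda>x. \<phi> x - c * \<psi> x) e) v =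
      (\<integral>x. \<phi> x * cinner e (rep_L2 v x) - c * (\<psi> x * cinner e (rep_L2 v x)) \<partial>domain_measure TYPE('s))"
    unfolding cinner_test[OF assms(3)]
    by (rule Bochner_Integration.integral_cong[OF refl]) (simp add: algebra_simps)
  also have "\<dots> = cinner (test \<phi> e) v - c * cinner (test \<psi> e) v"
    unfolding cinner_test[OF assms(1)] cinner_test[OF assms(2)]
    by (subst Bochner_Integration.integral_diff) (use int in \<open>auto intro!: integrable_mult_right\<close>)
  finally show ?thesis .
qed

text \<open>Only test functions with trace zero are admitted here; comparing \<open>tent b\<close> with \<open>b\<close> times
  \<open>tent 1\<close> shows that the boundary term of \<open>tent b\<close> is \<open>b\<close> times a bounded functional, and
  Riesz representation of the latter yields the trace.\<close>

lemma sobolev_adjoint: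
  fixes y k :: "('s, 'e::complex_hilbert) L2"
  assumes adj: "\<And>v v'. (v, v') \<in> sobolev_deriv \<Longrightarrow> (v, 0) \<in> sobolev_trace \<Longrightarrow>
      cinner (\<i> *\<^sub>C v') y = cinner v k"
  shows "\<exists>d. (y, - \<i> *\<^sub>C k) \<in> sobolev_deriv \<and> (y, d) \<in> sobolev_trace"
proof -
  \<comment> \<open>The equation i y' = k suggests the derivative \<open>- \<i> *\<^sub>C k\<close>;
    J is the left-hand side of Green's identity for that derivative and should reduce to the
    boundary term.\<close>
  define J where "J = (\<lambda>b e. cinner (test (tent' b) e) y + cinner (test (tent b) e) (- \<i> *\<^sub>C k))"
  have sob: "scalar_sobolev (tent b) (tent' b)" if "b > 0" for b by (rule scalar_sobolev_tent[OF that])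
  have sq: "square_integrable (domain_measure TYPE('s)) (tent b)"
      "square_integrable (domain_measure TYPE('s)) (tent' b)" if "b > 0" for b
    using sob[OF that] by (auto simp: scalar_sobolev_def)
  have J: "J b e = b * J 1 e" if b: "b > 0" for b e
  proof -
    let ?\<phi> = "\<lambda>x. tent b x - b * tent 1 x" and ?\<phi>' = "\<lambda>x. tent' b x - b * tent' 1 x"
    have s: "scalar_sobolev ?\<phi> ?\<phi>'" by (intro scalar_sobolev_lincomb sob b) simp
    then have sq': "square_integrable (domain_measure TYPE('s)) ?\<phi>" "square_integrable (domain_measure TYPE('s)) ?\<phi>'"
      by (auto simp: scalar_sobolev_def)
    have "(test ?\<phi> e, 0) \<in> sobolev_trace" using test_sobolev(2)[OF s, of e] b by (simp add: tent_zero)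
    from adj[OF test_sobolev(1)[OF s] this]
    have "cinner (test ?\<phi> e) k = \<i> * cinner (test ?\<phi>' e) y" by (simp add: cinner_scaleC_left)
    then have "cinner (test ?\<phi>' e) y + cinner (test ?\<phi> e) (- \<i> *\<^sub>C k) = 0"
      by (simp add: cinner_scaleC_right flip: mult.assoc)
    then show ?thesis
      by (simp add: J_def cinner_test_lincomb[OF sq(1)[OF b] sq(1) sq'(1)]
          cinner_test_lincomb[OF sq(2)[OF b] sq(2) sq'(2)] algebra_simps)
  qed
  have bl: "bounded_clinear (test (tent 1) :: 'e \<Rightarrow> ('s, 'e) L2)"
    "bounded_clinear (test (tent' 1) :: 'e \<Rightarrow> ('s, 'e) L2)"
    by (intro bounded_clinear_test sq; simp)+
  have "bounded_linear (J 1)"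
    unfolding J_def using bl
    by (intro bounded_linear_add bounded_linear_compose[OF cinner_linear_left]) (auto simp: bounded_clinear_def)
  moreover have "J 1 (c *\<^sub>C e) = c * J 1 e" for c e
    using bl by (simp add: J_def bounded_clinear_def cinner_scaleC_left distrib_left)
  ultimately obtain z where z: "\<And>e. J 1 e = cinner e z"
    using riesz_representation[of "J 1"] by auto
  \<comment> \<open>Green's identity requires J 1 e to be -\<sigma> times the pairing of e with the
    trace, and \<sigma> has square 1, so the trace is -\<sigma> times z.\<close>
  have "(y, - \<i> *\<^sub>C k) \<in> sobolev_deriv \<and> (y, - \<sigma> *\<^sub>R z) \<in> sobolev_trace"
  proof (intro conjI sobolev_if_weak_derivative)
    fix b :: real and e :: 'e assume b: "b > 0"
    have s2: "complex_of_real \<sigma> * complex_of_real \<sigma> = 1" using \<sigma> by auto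
    have "cinner (test (tent' b) e) y + cinner (test (tent b) e) (- \<i> *\<^sub>C k) = b * cinner e z"
      using J[OF b, of e] z by (simp add: J_def)
    also have "\<dots> = (complex_of_real \<sigma> * complex_of_real \<sigma>) * (b * cinner e z)" by (simp add: s2)
    also have "\<dots> = - \<sigma> * b * cinner e (- \<sigma> *\<^sub>R z)" by (simp add: cinner_scaleR_right cinner_minus_right mult_ac)
    finally show "cinner (test (tent' b) e) y + cinner (test (tent b) e) (- \<i> *\<^sub>C k) = - \<sigma> * b * cinner e (- \<sigma> *\<^sub>R z)" .
    then show "cinner (test (tent' b) e) y + cinner (test (tent b) e) (- \<i> *\<^sub>C k) = - \<sigma> * b * cinner e (- \<sigma> *\<^sub>R z)" .
  qed
  then show ?thesis by blast
qed

section \<open>Uniqueness of Laplace transforms\<close>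

text \<open>On the half-line \<open>decay 1\<close> takes values in the unit interval, where
  polynomials approximate q uniformly. For polynomials the integral is a combination of the
  vanishing moments.\<close>

lemma integral_continuous_decay_zero:
  fixes \<psi> :: "real \<Rightarrow> complex" and q :: "real \<Rightarrow> real"
  assumes \<psi>: "integrable (domain_measure TYPE('s)) \<psi>"
    and mom: "\<And>n::nat. (\<integral>x. (decay 1 x) ^ n * \<psi> x \<partial>domain_measure TYPE('s)) = 0"
    and q: "continuous_on UNIV q"
  shows "(\<integral>x. q (decay 1 x) * \<psi> x \<partial>domain_measure TYPE('s)) = 0"
proof -
  let ?M = "domain_measure TYPE('s)"
  have dm: "decay 1 \<in> borel_measurable ?M"
    unfolding decay_def[abs_def] by (intro measurable_restrict_space1) measurable
  have d01: "decay 1 x \<in> {0..1}" if "x \<in> space ?M" for x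
    using that by (simp add: decay_def space_domain_measure mem_D)
  have int: "integrable ?M (\<lambda>x. f (decay 1 x) * \<psi> x)" if f: "continuous_on UNIV f" for f :: "real \<Rightarrow> real"
  proof -
    have "compact (f ` {0..1})" by (intro compact_continuous_image continuous_on_subset[OF f]) auto
    then have "bounded (f ` {0..1})" by (rule compact_imp_bounded)
    then obtain B where B: "\<forall>y\<in>f ` {0..1}. norm y \<le> B" unfolding bounded_iff by blast
    show ?thesis
    proof (rule Bochner_Integration.integrable_bound)
      show "integrable ?M (\<lambda>x. B * norm (\<psi> x))" using \<psi> by simp
      have "(\<lambda>x. f (decay 1 x)) \<in> borel_measurable ?M"
        using measurable_compose[OF dm borel_measurable_continuous_onI[OF f]] .
      then show "(\<lambda>x. complex_of_real (f (decay 1 x)) * \<psi> x) \<in> borel_measurable ?M"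
        using \<psi> by (intro borel_measurable_times borel_measurable_of_real) auto
      have "norm (complex_of_real (f (decay 1 x)) * \<psi> x) \<le> norm (B * norm (\<psi> x))" if "x \<in> space ?M" for x
      proof -
        have "\<bar>f (decay 1 x)\<bar> \<le> B" using B d01[OF that] by auto
        then have "\<bar>f (decay 1 x)\<bar> * norm (\<psi> x) \<le> B * norm (\<psi> x)" by (intro mult_right_mono) auto
        then show ?thesis by (simp add: norm_mult)
      qed
      then show "AE x in ?M. norm (complex_of_real (f (decay 1 x)) * \<psi> x) \<le> norm (B * norm (\<psi> x))"
        by (intro AE_I2)
    qed
  qed
  have "norm (\<integral>x. q (decay 1 x) * \<psi> x \<partial>?M) \<le> e * (\<integral>x. norm (\<psi> x) \<partial>?M)" if e: "e > 0" for e
  proof -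
    obtain p where p: "real_polynomial_function p" "\<And>y. y \<in> {0..1} \<Longrightarrow> \<bar>q y - p y\<bar> < e"
      using Stone_Weierstrass_real_polynomial_function[of "{0..1}" q e] e continuous_on_subset[OF q]
      by auto
    obtain a n where an: "p = (\<lambda>x. \<Sum>i\<le>n. a i * x ^ i)"
      using p(1) real_polynomial_function_iff_sum by auto
    have cp: "continuous_on UNIV p" unfolding an by (intro continuous_intros)
    have "(\<integral>x. p (decay 1 x) * \<psi> x \<partial>?M) = (\<integral>x. (\<Sum>i\<le>n. a i * ((decay 1 x) ^ i * \<psi> x)) \<partial>?M)"
      by (rule Bochner_Integration.integral_cong[OF refl]) (simp add: an sum_distrib_right mult.assoc)
    also have "\<dots> = (\<Sum>i\<le>n. \<integral>x. a i * ((decay 1 x) ^ i * \<psi> x) \<partial>?M)"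
    proof (rule Bochner_Integration.integral_sum)
      fix i
      have "integrable ?M (\<lambda>x. (decay 1 x) ^ i * \<psi> x)"
        using int[of "\<lambda>y. y ^ i"] by (simp add: continuous_intros)
      then show "integrable ?M (\<lambda>x. a i * ((decay 1 x) ^ i * \<psi> x))" by (rule integrable_mult_right)
    qed
    also have "\<dots> = 0" using mom by simp
    finally have p0: "(\<integral>x. p (decay 1 x) * \<psi> x \<partial>?M) = 0" .
    have "(\<integral>x. q (decay 1 x) * \<psi> x \<partial>?M) = (\<integral>x. q (decay 1 x) * \<psi> x - p (decay 1 x) * \<psi> x \<partial>?M)"
      using p0 by (simp add: Bochner_Integration.integral_diff[OF int[OF q] int[OF cp]])
    also have "norm \<dots> \<le> (\<integral>x. norm (q (decay 1 x) * \<psi> x - p (decay 1 x) * \<psi> x) \<partial>?M)"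
      by (rule integral_norm_bound)
    also have "\<dots> \<le> (\<integral>x. e * norm (\<psi> x) \<partial>?M)"
    proof (rule integral_mono)
      show "integrable ?M (\<lambda>x. norm (q (decay 1 x) * \<psi> x - p (decay 1 x) * \<psi> x))"
        by (intro integrable_norm Bochner_Integration.integrable_diff int q cp)
      show "integrable ?M (\<lambda>x. e * norm (\<psi> x))" using \<psi> by simp
      fix x assume "x \<in> space ?M"
      have "norm (q (decay 1 x) * \<psi> x - p (decay 1 x) * \<psi> x) = \<bar>q (decay 1 x) - p (decay 1 x)\<bar> * norm (\<psi> x)"
        unfolding left_diff_distrib[symmetric] norm_mult of_real_diff[symmetric] norm_of_real by simp
      also have "\<dots> \<le> e * norm (\<psi> x)"
        using p(2)[OF d01[OF \<open>x \<in> space ?M\<close>]] by (intro mult_right_mono) auto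
      finally show "norm (q (decay 1 x) * \<psi> x - p (decay 1 x) * \<psi> x) \<le> e * norm (\<psi> x)" .
    qed
    finally show ?thesis by simp
  qed
  then have bound: "norm (\<integral>x. q (decay 1 x) * \<psi> x \<partial>?M) \<le> e * (\<integral>x. norm (\<psi> x) \<partial>?M)" if "e > 0" for e
    using that .
  have "norm (\<integral>x. q (decay 1 x) * \<psi> x \<partial>?M) \<le> 0"
  proof (rule field_le_epsilon)
    fix e :: real assume e: "e > 0"
    define I where "I = (\<integral>x. norm (\<psi> x) \<partial>?M) + 1"
    have I: "(\<integral>x. norm (\<psi> x) \<partial>?M) \<le> I" "I > 0"
      using Bochner_Integration.integral_nonneg[of ?M "\<lambda>x. norm (\<psi> x)"] by (auto simp: I_def intro: add_nonneg_pos)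
    then have "e / I * (\<integral>x. norm (\<psi> x) \<partial>?M) \<le> e / I * I" using e by (intro mult_left_mono) auto
    then show "norm (\<integral>x. q (decay 1 x) * \<psi> x \<partial>?M) \<le> 0 + e"
      using bound[of "e / I"] I e by simp
  qed
  then show ?thesis by simp
qed

text \<open>One factor \<open>decay 1\<close> is moved into \<psi> to make it integrable. The n-th
  moment of \<psi> is then the transform at n + 1, so positive integers supply all moments including
  the zeroth. Continuous functions of \<open>decay 1\<close> approximate indicators of
  segments.\<close>

lemma L2_eq_zero_if_laplace_zero:
  fixes V :: "('s, 'e::complex_hilbert) L2"
  assumes V: "\<And>n::nat. \<And>e. n > 0 \<Longrightarrow> cinner (test (decay (real n)) e) V = 0"
  shows "V = 0"
proof (rule L2_eq_zeroI, rule AE_zero_if_cinner_AE_zero)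
  let ?M = "domain_measure TYPE('s)"
  show "strongly_measurable ?M (rep_L2 V)" by (rule rep_L2_strongly_measurable) simp
  fix e :: 'e
  define \<psi> where "\<psi> = (\<lambda>x. decay 1 x * cinner e (rep_L2 V x))"
  have \<psi>: "integrable ?M \<psi>" unfolding \<psi>_def
    by (rule integrable_cinner_test[OF square_integrable_decay]) simp
  have mom: "(\<integral>x. (decay 1 x) ^ n * \<psi> x \<partial>?M) = 0" for n :: nat
  proof -
    have "(decay 1 x) ^ n * \<psi> x = decay (real (Suc n)) x * cinner e (rep_L2 V x)" for x
    proof -
      have "(decay 1 x) ^ n * decay 1 x = decay (real (Suc n)) x"
        by (simp add: decay_def exp_of_nat_mult[symmetric] exp_add[symmetric] algebra_simps)
      then show ?thesis by (simp add: \<psi>_def flip: mult.assoc of_real_mult of_real_power)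
    qed
    then show ?thesis
      using V[of "Suc n" e] by (simp add: cinner_test[OF square_integrable_decay])
  qed
  have "AE x in ?M. \<psi> x = 0"
  proof (rule AE_zero_if_integral_seg_zero)
    fix b :: real assume b: "b > 0"
    have sub: "seg b \<subseteq> domain_set TYPE('s)" using seg_subset[of b] b by simp
    show "integrable (lborel_on (seg b)) \<psi>"
      by (rule integrable_lborel_on_subset[OF \<psi> sub seg_borel D_borel])
    \<comment> \<open>Equal to 1 from \<open>exp (- b)\<close> upwards, with a ramp of slope m
      below. Since \<open>decay 1 x\<close> reaches \<open>exp (- b)\<close> exactly when \<sigma> *
      x is at most b, the limit along \<open>decay 1\<close> is the indicator of
      \<open>seg b\<close>.\<close>
    define q where "q = (\<lambda>(m::nat) y. max 0 (min 1 (1 - m * (exp (- b) - y))) :: real)"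
    have q: "continuous_on UNIV (q m)" for m unfolding q_def by (intro continuous_intros)
    have dm: "decay 1 \<in> borel_measurable ?M"
      unfolding decay_def[abs_def] by (intro measurable_restrict_space1) measurable
    have q01: "0 \<le> q m y" "q m y \<le> 1" for m y by (auto simp: q_def)
    have "(\<lambda>m. \<integral>x. q m (decay 1 x) * \<psi> x \<partial>?M) \<longlonglongrightarrow> (\<integral>x. indicat_real (seg b) x * \<psi> x \<partial>?M)"
    proof (rule integral_dominated_convergence[where w="\<lambda>x. norm (\<psi> x)"])
      have "indicat_real (seg b) \<in> borel_measurable ?M" by (intro measurable_restrict_space1) simp
      then show "(\<lambda>x. complex_of_real (indicat_real (seg b) x) * \<psi> x) \<in> borel_measurable ?M"
        using \<psi> by (intro borel_measurable_times borel_measurable_of_real) auto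
      have "(\<lambda>x. q m (decay 1 x)) \<in> borel_measurable ?M" for m
        using measurable_compose[OF dm borel_measurable_continuous_onI[OF q]] .
      then show "(\<lambda>x. complex_of_real (q m (decay 1 x)) * \<psi> x) \<in> borel_measurable ?M" for m
        using \<psi> by (intro borel_measurable_times borel_measurable_of_real) auto
      show "integrable ?M (\<lambda>x. norm (\<psi> x))" using \<psi> by simp
      show "AE x in ?M. norm (complex_of_real (q m (decay 1 x)) * \<psi> x) \<le> norm (\<psi> x)" for m
        using q01[of m] by (intro AE_I2) (simp add: norm_mult mult_left_le_one_le)
      show "AE x in ?M. (\<lambda>m. complex_of_real (q m (decay 1 x)) * \<psi> x) \<longlonglongrightarrow> complex_of_real (indicat_real (seg b) x) * \<psi> x"
      proof (rule AE_I2)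
        fix x assume "x \<in> space ?M"
        then have x: "0 \<le> \<sigma> * x" by (simp add: space_domain_measure mem_D)
        have "(\<lambda>m. q m (decay 1 x)) \<longlonglongrightarrow> indicat_real (seg b) x"
        proof (cases "\<sigma> * x \<le> b")
          case True
          then have "exp (- b) \<le> decay 1 x" by (simp add: decay_def)
          then have "q m (decay 1 x) = 1" for m by (simp add: q_def mult_nonneg_nonpos)
          moreover have "x \<in> seg b" using x True b by (simp add: mem_seg)
          ultimately show ?thesis by simp
        next
          case False
          then have d: "exp (- b) - decay 1 x > 0" by (simp add: decay_def)
          obtain N :: nat where N: "1 / (exp (- b) - decay 1 x) \<le> N" using real_arch_simple by blast
          have "q m (decay 1 x) = 0" if "m \<ge> N" for m
          proof -
            have "1 / (exp (- b) - decay 1 x) \<le> real m" using N that by linarith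
            then have "1 \<le> m * (exp (- b) - decay 1 x)" using d by (simp add: pos_divide_le_eq)
            then show ?thesis by (simp add: q_def)
          qed
          then have "\<forall>\<^sub>F m in sequentially. 0 = q m (decay 1 x)"
            by (intro eventually_sequentiallyI[of N]) simp
          from Lim_transform_eventually[OF tendsto_const this]
          have "(\<lambda>m. q m (decay 1 x)) \<longlonglongrightarrow> 0" .
          moreover have "x \<notin> seg b" using False b by (simp add: mem_seg)
          ultimately show ?thesis by simp
        qed
        then show "(\<lambda>m. complex_of_real (q m (decay 1 x)) * \<psi> x) \<longlonglongrightarrow> complex_of_real (indicat_real (seg b) x) * \<psi> x"
          by (intro tendsto_intros)
      qed
    qed
    then have "(\<integral>x. indicat_real (seg b) x * \<psi> x \<partial>?M) = 0"
      by (simp add: integral_continuous_decay_zero[OF \<psi> mom q] LIMSEQ_const_iff)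
    moreover have "(\<integral>x. indicat_real (seg b) x * \<psi> x \<partial>?M) = (\<integral>x. indicat_real (seg b) x * \<psi> x \<partial>lborel_on (seg b))"
      by (rule integral_domain_seg[OF b]) simp
    moreover have "(\<integral>x. indicat_real (seg b) x * \<psi> x \<partial>lborel_on (seg b)) = (\<integral>x. \<psi> x \<partial>lborel_on (seg b))"
      by (rule Bochner_Integration.integral_cong[OF refl]) (simp add: space_restrict_space)
    ultimately show "(\<integral>x. \<psi> x \<partial>lborel_on (seg b)) = 0" by simp
  qed
  then show "AE x in ?M. cinner (rep_L2 V x) e = 0"
  proof eventually_elim
    fix x assume "\<psi> x = 0"
    then have "cinner e (rep_L2 V x) = 0" by (simp add: \<psi>_def decay_def)
    then show "cinner (rep_L2 V x) e = 0" by (subst cinner_commute) simp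
  qed
qed

lemma sobolev_zero:
  "((0 :: ('s, 'e::complex_hilbert) L2), 0) \<in> sobolev_deriv" "((0 :: ('s, 'e) L2), 0) \<in> sobolev_trace"
proof -
  have s: "scalar_sobolev (tent 1) (tent' 1)" by (rule scalar_sobolev_tent) simp
  then have "bounded_clinear (test (tent 1) :: 'e \<Rightarrow> ('s, 'e) L2)" "bounded_clinear (test (tent' 1) :: 'e \<Rightarrow> ('s, 'e) L2)"
    by (auto simp: scalar_sobolev_def intro!: bounded_clinear_test)
  then have "test (tent 1) 0 = (0 :: ('s, 'e) L2)" "test (tent' 1) 0 = (0 :: ('s, 'e) L2)"
    by (auto simp: bounded_clinear_def linear_simps)
  with test_sobolev[OF s, of "0 :: 'e"]
  show "((0 :: ('s, 'e::complex_hilbert) L2), 0) \<in> sobolev_deriv" "((0 :: ('s, 'e) L2), 0) \<in> sobolev_trace"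
    by simp_all
qed

text \<open>The points are chosen so that t = \<open>decay n\<close> times e satisfies i t' =
  \<open>cnj z\<close> t for z = i \<sigma> n. In Green's identity the zero trace removes the
  boundary term and the remaining terms in w cancel, leaving only the pairing of t with y.\<close>

lemma zero_if_resolvents_have_trace_zero:
  fixes y :: "('s, 'e::complex_hilbert) L2"
  assumes res: "\<And>n. (0::nat) < n \<Longrightarrow> \<exists>w w'. (w, w') \<in> sobolev_deriv \<and> (w, 0) \<in> sobolev_trace \<and>
    \<i> *\<^sub>C w' = y + (\<i> * complex_of_real (\<sigma> * n)) *\<^sub>C w"
  shows "y = 0"
proof (rule L2_eq_zero_if_laplace_zero)
  fix n :: nat and e :: 'e assume n: "0 < n"
  define t where "t = (test (decay (real n)) e :: ('s, 'e) L2)"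
  have s: "scalar_sobolev (decay (real n)) (\<lambda>x. (- real n * \<sigma>) * decay (real n) x)"
    by (rule scalar_sobolev_decay) (use n in simp)
  obtain w w' where w: "(w, w') \<in> sobolev_deriv" "(w, 0) \<in> sobolev_trace"
    "\<i> *\<^sub>C w' = y + (\<i> * complex_of_real (\<sigma> * n)) *\<^sub>C w"
    using res[OF n] by blast
  have "bounded_clinear (test (decay (real n)) :: 'e \<Rightarrow> ('s, 'e) L2)"
    using s by (auto simp: scalar_sobolev_def intro: bounded_clinear_test)
  then have "test (decay (real n)) ((- real n * \<sigma>) *\<^sub>R e) = (- real n * \<sigma>) *\<^sub>R t"
    unfolding t_def by (simp only: bounded_clinear_def scaleR_scaleC)
  moreover have "test (\<lambda>x. (- real n * \<sigma>) * decay (real n) x) e = (test (decay (real n)) ((- real n * \<sigma>) *\<^sub>R e) :: ('s, 'e) L2)"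
    unfolding test_def by (simp only: scaleR_scaleR mult.commute)
  ultimately have t': "test (\<lambda>x. (- real n * \<sigma>) * decay (real n) x) e = (- real n * \<sigma>) *\<^sub>R t"
    by simp
  have "complex_of_real (- real n * \<sigma>) * cinner t w + cinner t w' = 0"
    using sobolev_green[OF test_sobolev[OF s, of e] w(1,2)]
    unfolding t' t_def[symmetric] cinner_scaleR_left by simp
  then have tw: "cinner t w' = complex_of_real (\<sigma> * n) * cinner t w"
    by (simp add: add_eq_0_iff mult_ac)
  have "cinner t (\<i> *\<^sub>C w') = cinner t (y + (\<i> * complex_of_real (\<sigma> * n)) *\<^sub>C w)"
    by (simp only: w(3))
  then have "cinner t y = 0"
    by (simp add: cinner_add_right cinner_scaleC_right tw)
  then show "cinner (test (decay (real n)) e) y = 0" by (simp add: t_def)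
qed

end

interpretation hp: half_line "TYPE(rplus)" 1
  by unfold_locales (auto simp: domain_set_rplus_def)

interpretation hm: half_line "TYPE(rminus)" "- 1"
  by unfold_locales (auto simp: domain_set_rminus_def)

section \<open>Green's identity for the boundary triple\<close>

locale boundary_triple =
  fixes A\<^sub>0 :: "('h::complex_hilbert \<times> 'h) set"
    and P :: "'e::complex_hilbert \<Rightarrow> 'h"
    and \<Lambda> :: "('e \<times> 'e) set"
  assumes A0: "selfadjoint_operator A\<^sub>0"
    and zero_resolvent: "0 \<in> resolvent_set A\<^sub>0"
    and P: "bounded_clinear P"
    and dom_inter_ran: "Domain A\<^sub>0 \<inter> range P = {0}"
    and ker_P: "{\<phi>. P \<phi> = 0} = {0}"
    and \<Lambda>: "selfadjoint_operator \<Lambda>"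
begin

abbreviation S :: "'h \<Rightarrow> 'h" where "S \<equiv> resolvent A\<^sub>0 0"

abbreviation Ps :: "'h \<Rightarrow> 'e" where "Ps \<equiv> bounded_adjoint P"

lemma S_mem: "(S f, f) \<in> A\<^sub>0"
  using resolvent_mem[OF zero_resolvent, of f] by simp

lemma cinner_S: "cinner (S f) g = cinner f (S g)"
  using selfadjoint_symmetric[OF A0 S_mem S_mem] by simp

lemma S_add: "S (f + g) = S f + S g" and S_scaleC: "S (c *\<^sub>C f) = c *\<^sub>C S f"
  and S_diff: "S (f - g) = S f - S g" and S_zero: "S 0 = 0"
  using bounded_clinear_resolvent[OF zero_resolvent]
  by (auto simp: bounded_clinear_def linear_simps)

lemma P_add: "P (f + g) = P f + P g" and P_scaleC: "P (c *\<^sub>C f) = c *\<^sub>C P f"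
  and P_diff: "P (f - g) = P f - P g" and P_zero: "P 0 = 0"
  using P by (auto simp: bounded_clinear_def linear_simps)

lemma cinner_P: "cinner (P \<phi>) y = cinner \<phi> (Ps y)"
  by (rule cinner_bounded_adjoint[OF P])

lemma cinner_Ps: "cinner (Ps y) \<phi> = cinner y (P \<phi>)"
  by (metis cinner_P cinner_commute)

lemma Ps_zero: "Ps 0 = 0"
  by (rule cinner_right_eq_zeroI) (simp add: cinner_P[symmetric])

text \<open>The common value lies in the trivial intersection, so both summands vanish; f vanishes
  because the operator sends 0 only to 0, and \<phi> because the kernel of P is trivial.\<close>

lemma decomposition_zero:
  assumes "S f + P \<phi> = 0" shows "f = 0" "\<phi> = 0"
proof -
  have "P (- \<phi>) = - P \<phi>" using P_diff[of 0 \<phi>] by (simp add: P_zero)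
  moreover have "S f = - P \<phi>" using assms by (simp add: eq_neg_iff_add_eq_0)
  ultimately have eq: "S f = P (- \<phi>)" by simp
  have "S f \<in> Domain A\<^sub>0 \<inter> range P" using S_mem[of f] by (auto simp: eq)
  then have "S f = 0" using dom_inter_ran by auto
  moreover have "(0, 0) \<in> A\<^sub>0" using S_mem[of 0] by (simp add: S_zero)
  ultimately show "f = 0"
    using S_mem[of f] A0
    by (auto simp: selfadjoint_operator_def linear_operator_def single_valued_def)
  have "- \<phi> \<in> {\<phi>. P \<phi> = 0}" using eq \<open>S f = 0\<close> by simp
  then show "\<phi> = 0" using ker_P by auto
qed

lemma decomposition_unique:
  assumes "S f + P \<phi> = S g + P \<psi>" shows "f = g" "\<phi> = \<psi>"
  using decomposition_zero[of "f - g" "\<phi> - \<psi>"] assms by (auto simp: S_diff P_diff algebra_simps)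

text \<open>The three graphs each come with their own decomposition of u; uniqueness merges them
  into one.\<close>

lemma triple_cases:
  assumes "(u, f) \<in> op_A A\<^sub>0 P" "(u, g\<^sub>0) \<in> op_\<Gamma>\<^sub>0 A\<^sub>0 P" "(u, g\<^sub>1) \<in> op_\<Gamma>\<^sub>1 A\<^sub>0 P \<Lambda>"
  obtains \<psi> where "u = S f + P g\<^sub>0" "g\<^sub>1 = Ps f + \<psi>" "(g\<^sub>0, \<psi>) \<in> \<Lambda>"
proof -
  obtain \<phi>\<^sub>1 where 1: "u = S f + P \<phi>\<^sub>1" using assms(1) by (auto simp: op_A_def)
  obtain f\<^sub>2 where 2: "u = S f\<^sub>2 + P g\<^sub>0" using assms(2) by (auto simp: op_\<Gamma>\<^sub>0_def)
  obtain f\<^sub>3 \<phi>\<^sub>3 \<psi> where 3: "u = S f\<^sub>3 + P \<phi>\<^sub>3" "g\<^sub>1 = Ps f\<^sub>3 + \<psi>" "(\<phi>\<^sub>3, \<psi>) \<in> \<Lambda>"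
    using assms(3) by (auto simp: op_\<Gamma>\<^sub>1_def)
  have "f = f\<^sub>2" "\<phi>\<^sub>1 = g\<^sub>0" using 1 2 decomposition_unique[of f \<phi>\<^sub>1 f\<^sub>2 g\<^sub>0] by auto
  moreover have "f = f\<^sub>3" "\<phi>\<^sub>1 = \<phi>\<^sub>3" using 1 3 decomposition_unique[of f \<phi>\<^sub>1 f\<^sub>3 \<phi>\<^sub>3] by auto
  ultimately show thesis using 1 3 by (intro that[of \<psi>]) auto
qed

lemma triple_memI:
  assumes "(\<phi>, \<psi>) \<in> \<Lambda>"
  shows "(S f + P \<phi>, f) \<in> op_A A\<^sub>0 P" "(S f + P \<phi>, \<phi>) \<in> op_\<Gamma>\<^sub>0 A\<^sub>0 P"
    "(S f + P \<phi>, Ps f + \<psi>) \<in> op_\<Gamma>\<^sub>1 A\<^sub>0 P \<Lambda>"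
  using assms by (auto simp: op_A_def op_\<Gamma>\<^sub>0_def op_\<Gamma>\<^sub>1_def)

text \<open>The terms in \<open>S\<close> cancel by its symmetry and those in \<Lambda> by the
  symmetry of \<Lambda>; the cross terms between \<open>P\<close> and \<open>Ps\<close> are the
  boundary form.\<close>

lemma boundary_green:
  assumes u: "(u, f) \<in> op_A A\<^sub>0 P" "(u, g\<^sub>0) \<in> op_\<Gamma>\<^sub>0 A\<^sub>0 P" "(u, g\<^sub>1) \<in> op_\<Gamma>\<^sub>1 A\<^sub>0 P \<Lambda>"
    and v: "(v, k) \<in> op_A A\<^sub>0 P" "(v, l\<^sub>0) \<in> op_\<Gamma>\<^sub>0 A\<^sub>0 P" "(v, l\<^sub>1) \<in> op_\<Gamma>\<^sub>1 A\<^sub>0 P \<Lambda>"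
  shows "cinner f v - cinner u k = cinner g\<^sub>1 l\<^sub>0 - cinner g\<^sub>0 l\<^sub>1"
proof -
  obtain \<psi> where 1: "u = S f + P g\<^sub>0" "g\<^sub>1 = Ps f + \<psi>" "(g\<^sub>0, \<psi>) \<in> \<Lambda>"
    using triple_cases[OF u] .
  obtain \<eta> where 2: "v = S k + P l\<^sub>0" "l\<^sub>1 = Ps k + \<eta>" "(l\<^sub>0, \<eta>) \<in> \<Lambda>"
    using triple_cases[OF v] .
  have "cinner \<psi> l\<^sub>0 = cinner g\<^sub>0 \<eta>" by (rule selfadjoint_symmetric[OF \<Lambda> 1(3) 2(3)])
  then show ?thesis
    by (simp add: 1 2 cinner_add_left cinner_add_right cinner_S cinner_P cinner_Ps)
qed

lemma csubspace_op_L: "csubspace (op_L A\<^sub>0 P \<Lambda>)"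
proof -
  note sub = selfadjoint_csubspace[OF \<Lambda>]
  have Ps_add: "Ps (x + y) = Ps x + Ps y" and Ps_scaleC: "Ps (c *\<^sub>C x) = c *\<^sub>C Ps x" for x y c
    by (rule cinner_right_eqI, simp add: cinner_P[symmetric] cinner_add_right cinner_scaleC_right)+
  \<comment> \<open>In the parameters f, \<phi>, \<psi> the boundary condition is a single linear
    equation, so closure under the operations is checked on them.\<close>
  have iff: "w \<in> op_L A\<^sub>0 P \<Lambda> \<longleftrightarrow>
      (\<exists>f \<phi> \<psi>. w = (S f + P \<phi>, f) \<and> (\<phi>, \<psi>) \<in> \<Lambda> \<and> Ps f + \<psi> = \<i> *\<^sub>C \<phi>)" for w
  proof
    assume "w \<in> op_L A\<^sub>0 P \<Lambda>"
    then obtain u f g\<^sub>0 g\<^sub>1 where u: "w = (u, f)" "(u, f) \<in> op_A A\<^sub>0 P" "(u, g\<^sub>0) \<in> op_\<Gamma>\<^sub>0 A\<^sub>0 P"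
      "(u, g\<^sub>1) \<in> op_\<Gamma>\<^sub>1 A\<^sub>0 P \<Lambda>" "g\<^sub>1 = \<i> *\<^sub>C g\<^sub>0" by (auto simp: op_L_def)
    obtain \<psi> where "u = S f + P g\<^sub>0" "g\<^sub>1 = Ps f + \<psi>" "(g\<^sub>0, \<psi>) \<in> \<Lambda>"
      using triple_cases[OF u(2-4)] .
    with u(1,5) show "\<exists>f \<phi> \<psi>. w = (S f + P \<phi>, f) \<and> (\<phi>, \<psi>) \<in> \<Lambda> \<and> Ps f + \<psi> = \<i> *\<^sub>C \<phi>"
      by (intro exI[of _ f] exI[of _ g\<^sub>0] exI[of _ \<psi>]) simp
  next
    assume "\<exists>f \<phi> \<psi>. w = (S f + P \<phi>, f) \<and> (\<phi>, \<psi>) \<in> \<Lambda> \<and> Ps f + \<psi> = \<i> *\<^sub>C \<phi>"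
    then obtain f \<phi> \<psi> where w: "w = (S f + P \<phi>, f)" "(\<phi>, \<psi>) \<in> \<Lambda>" "Ps f + \<psi> = \<i> *\<^sub>C \<phi>"
      by blast
    have "(S f + P \<phi>, \<i> *\<^sub>C \<phi>) \<in> op_\<Gamma>\<^sub>1 A\<^sub>0 P \<Lambda>" using triple_memI(3)[OF w(2), of f] by (simp add: w(3))
    then show "w \<in> op_L A\<^sub>0 P \<Lambda>"
      using triple_memI(1,2)[OF w(2), of f] unfolding op_L_def w(1) by blast
  qed
  show ?thesis
    unfolding csubspace_def
  proof (intro conjI ballI allI)
    have "(0, 0) \<in> \<Lambda>" using csubspace_zero[OF sub] by (simp add: zero_prod_def)
    then show "0 \<in> op_L A\<^sub>0 P \<Lambda>" unfolding iff
      by (intro exI[of _ 0]) (simp add: zero_prod_def S_zero P_zero Ps_zero)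
    fix x c assume "x \<in> op_L A\<^sub>0 P \<Lambda>"
    then obtain f \<phi> \<psi> where x: "x = (S f + P \<phi>, f)" "(\<phi>, \<psi>) \<in> \<Lambda>" "Ps f + \<psi> = \<i> *\<^sub>C \<phi>"
      unfolding iff by blast
    have "Ps (c *\<^sub>C f) + c *\<^sub>C \<psi> = c *\<^sub>C (Ps f + \<psi>)" by (simp add: Ps_scaleC scaleC_add_right)
    also have "\<dots> = \<i> *\<^sub>C (c *\<^sub>C \<phi>)" by (simp add: x scaleC_scaleC mult.commute)
    finally show "c *\<^sub>C x \<in> op_L A\<^sub>0 P \<Lambda>" unfolding iff
      using csubspace_graph_scaleC[OF sub x(2), of c]
      by (intro exI[of _ "c *\<^sub>C f"] exI[of _ "c *\<^sub>C \<phi>"] exI[of _ "c *\<^sub>C \<psi>"])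
        (simp add: x(1) scaleC_prod_def S_scaleC P_scaleC scaleC_add_right)
    fix y assume "y \<in> op_L A\<^sub>0 P \<Lambda>"
    then obtain f' \<phi>' \<psi>' where y: "y = (S f' + P \<phi>', f')" "(\<phi>', \<psi>') \<in> \<Lambda>" "Ps f' + \<psi>' = \<i> *\<^sub>C \<phi>'"
      unfolding iff by blast
    have "Ps (f + f') + (\<psi> + \<psi>') = (Ps f + \<psi>) + (Ps f' + \<psi>')" by (simp add: Ps_add)
    also have "\<dots> = \<i> *\<^sub>C (\<phi> + \<phi>')" by (simp add: x y scaleC_add_right)
    finally show "x + y \<in> op_L A\<^sub>0 P \<Lambda>" unfolding iff
      using csubspace_graph_add[OF sub x(2) y(2)]
      by (intro exI[of _ "f + f'"] exI[of _ "\<phi> + \<phi>'"] exI[of _ "\<psi> + \<psi>'"])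
        (simp add: x(1) y(1) S_add P_add)
  qed
qed

text \<open>On the domain of L the boundary form of u with itself is 2 i times the squared norm of
  g, so the imaginary part of \<open>cinner f u\<close> is nonnegative and adds to that of
  -z.\<close>

lemma op_L_lower_bound:
  assumes "(u, f) \<in> op_L A\<^sub>0 P \<Lambda>" "Im z < 0"
  shows "- Im z * norm u \<le> norm (f - z *\<^sub>C u)"
proof (rule norm_le_if_Im_cinner)
  obtain g where u: "(u, f) \<in> op_A A\<^sub>0 P" "(u, g) \<in> op_\<Gamma>\<^sub>0 A\<^sub>0 P" "(u, \<i> *\<^sub>C g) \<in> op_\<Gamma>\<^sub>1 A\<^sub>0 P \<Lambda>"
    using assms(1) by (auto simp: op_L_def)
  have "cinner f u - cnj (cinner f u) = 2 * \<i> * (norm g)\<^sup>2"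
    using boundary_green[OF u u]
    by (simp add: cinner_scaleC_left cinner_scaleC_right cinner_self cinner_commute[of u f, symmetric])
  then have "Im (cinner f u) = (norm g)\<^sup>2" by (auto simp: complex_eq_iff simp flip: of_real_power)
  then have "Im (cinner (f - z *\<^sub>C u) u) = (norm g)\<^sup>2 + (- Im z) * (norm u)\<^sup>2"
    by (simp add: cinner_diff_left cinner_scaleC_left cinner_self flip: of_real_power)
  then show "- Im z * (norm u)\<^sup>2 \<le> \<bar>Im (cinner (f - z *\<^sub>C u) u)\<bar>"
    by (smt (verit) zero_le_power2)
qed

end

section \<open>The dilation\<close>

text \<open>In the difference of the forms for g1 + i g0 and g1 - i g0 only the cross terms remain,
  each twice; \<open>sqrt 2\<close> in the boundary conditions absorbs this factor.\<close>

lemma boundary_form_eq: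
  fixes g\<^sub>0 g\<^sub>1 l\<^sub>0 l\<^sub>1 :: "'e::complex_inner"
  assumes "g\<^sub>1 + \<i> *\<^sub>C g\<^sub>0 = sqrt 2 *\<^sub>R ep" "g\<^sub>1 - \<i> *\<^sub>C g\<^sub>0 = sqrt 2 *\<^sub>R em"
    and "l\<^sub>1 + \<i> *\<^sub>C l\<^sub>0 = sqrt 2 *\<^sub>R dp" "l\<^sub>1 - \<i> *\<^sub>C l\<^sub>0 = sqrt 2 *\<^sub>R dm"
  shows "cinner g\<^sub>1 l\<^sub>0 - cinner g\<^sub>0 l\<^sub>1 = \<i> * (cinner ep dp - cinner em dm)"
proof -
  have s: "complex_of_real (sqrt 2) * complex_of_real (sqrt 2) = 2"
    by (simp flip: of_real_mult)
  have two: "2 * cinner x y = cinner (sqrt 2 *\<^sub>R x) (sqrt 2 *\<^sub>R y)" for x y :: 'e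
    by (simp only: cinner_scaleR_left cinner_scaleR_right mult.assoc[symmetric] s)
  have "2 * cinner ep dp = cinner (g\<^sub>1 + \<i> *\<^sub>C g\<^sub>0) (l\<^sub>1 + \<i> *\<^sub>C l\<^sub>0)"
    "2 * cinner em dm = cinner (g\<^sub>1 - \<i> *\<^sub>C g\<^sub>0) (l\<^sub>1 - \<i> *\<^sub>C l\<^sub>0)"
    unfolding assms by (rule two)+
  then show ?thesis
    by (simp add: cinner_add_left cinner_add_right cinner_diff_left cinner_diff_right
        cinner_scaleC_left cinner_scaleC_right complex_eq_iff)
qed

context boundary_triple begin


section \<open>Self-adjointness of the dilation\<close>

lemma dilation_memI:
  assumes "(vm, vm') \<in> sobolev_deriv" "(vm, em) \<in> sobolev_trace"
    and "(vp, vp') \<in> sobolev_deriv" "(vp, ep) \<in> sobolev_trace"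
    and "(\<phi>, \<psi>) \<in> \<Lambda>"
    and "Ps f + \<psi> + \<i> *\<^sub>C \<phi> = sqrt 2 *\<^sub>R ep" "Ps f + \<psi> - \<i> *\<^sub>C \<phi> = sqrt 2 *\<^sub>R em"
  shows "((vm, S f + P \<phi>, vp), (\<i> *\<^sub>C vm', f, \<i> *\<^sub>C vp')) \<in> dilation_op A\<^sub>0 P \<Lambda>"
  using assms triple_memI[OF assms(5), of f] unfolding dilation_op_def by blast

lemma dilationE:
  assumes "(V, W) \<in> dilation_op A\<^sub>0 P \<Lambda>"
  obtains vm vm' em vp vp' ep u f g\<^sub>0 g\<^sub>1 where "V = (vm, u, vp)" "W = (\<i> *\<^sub>C vm', f, \<i> *\<^sub>C vp')"
    "(vm, vm') \<in> sobolev_deriv" "(vm, em) \<in> sobolev_trace"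
    "(vp, vp') \<in> sobolev_deriv" "(vp, ep) \<in> sobolev_trace"
    "(u, f) \<in> op_A A\<^sub>0 P" "(u, g\<^sub>0) \<in> op_\<Gamma>\<^sub>0 A\<^sub>0 P" "(u, g\<^sub>1) \<in> op_\<Gamma>\<^sub>1 A\<^sub>0 P \<Lambda>"
    "g\<^sub>1 + \<i> *\<^sub>C g\<^sub>0 = sqrt 2 *\<^sub>R ep" "g\<^sub>1 - \<i> *\<^sub>C g\<^sub>0 = sqrt 2 *\<^sub>R em"
  using assms unfolding dilation_op_def by blast

text \<open>With angle brackets for \<open>cinner\<close>, the left half-line contributes the defect
  i <em, dm>, the right one -i <ep, dp>, and the middle component i (<ep, dp> - <em, dm>).\<close>

lemma dilation_symmetric:
  assumes "(V, W) \<in> dilation_op A\<^sub>0 P \<Lambda>" "(Y, K) \<in> dilation_op A\<^sub>0 P \<Lambda>"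
  shows "cinner W Y = cinner V K"
proof -
  from assms(1) obtain vm vm' em vp vp' ep u f g\<^sub>0 g\<^sub>1 where v: "V = (vm, u, vp)" "W = (\<i> *\<^sub>C vm', f, \<i> *\<^sub>C vp')"
    "(vm, vm') \<in> sobolev_deriv" "(vm, em) \<in> sobolev_trace"
    "(vp, vp') \<in> sobolev_deriv" "(vp, ep) \<in> sobolev_trace"
    "(u, f) \<in> op_A A\<^sub>0 P" "(u, g\<^sub>0) \<in> op_\<Gamma>\<^sub>0 A\<^sub>0 P" "(u, g\<^sub>1) \<in> op_\<Gamma>\<^sub>1 A\<^sub>0 P \<Lambda>"
    "g\<^sub>1 + \<i> *\<^sub>C g\<^sub>0 = sqrt 2 *\<^sub>R ep" "g\<^sub>1 - \<i> *\<^sub>C g\<^sub>0 = sqrt 2 *\<^sub>R em" by (rule dilationE)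
  from assms(2) obtain ym ym' dm yp yp' dp y k l\<^sub>0 l\<^sub>1 where y: "Y = (ym, y, yp)" "K = (\<i> *\<^sub>C ym', k, \<i> *\<^sub>C yp')"
    "(ym, ym') \<in> sobolev_deriv" "(ym, dm) \<in> sobolev_trace"
    "(yp, yp') \<in> sobolev_deriv" "(yp, dp) \<in> sobolev_trace"
    "(y, k) \<in> op_A A\<^sub>0 P" "(y, l\<^sub>0) \<in> op_\<Gamma>\<^sub>0 A\<^sub>0 P" "(y, l\<^sub>1) \<in> op_\<Gamma>\<^sub>1 A\<^sub>0 P \<Lambda>"
    "l\<^sub>1 + \<i> *\<^sub>C l\<^sub>0 = sqrt 2 *\<^sub>R dp" "l\<^sub>1 - \<i> *\<^sub>C l\<^sub>0 = sqrt 2 *\<^sub>R dm" by (rule dilationE)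
  have m: "cinner vm' ym = cinner em dm - cinner vm ym'"
    using hm.sobolev_green[OF v(3,4) y(3,4)] by (simp add: eq_diff_eq)
  have p: "cinner vp' yp = - cinner ep dp - cinner vp yp'"
    using hp.sobolev_green[OF v(5,6) y(5,6)] by (simp add: eq_diff_eq)
  have "cinner f y = cinner u k + \<i> * (cinner ep dp - cinner em dm)"
    using boundary_green[OF v(7-9) y(7-9)] boundary_form_eq[OF v(10,11) y(10,11)] by (simp add: algebra_simps)
  then show ?thesis
    by (simp add: v(1,2) y(1,2) cinner_prod_def cinner_scaleC_left cinner_scaleC_right m p algebra_simps)
qed

lemma dilation_adjoint_subset:
  assumes "(Y, K) \<in> op_adjoint (dilation_op A\<^sub>0 P \<Lambda>)"
  shows "(Y, K) \<in> dilation_op A\<^sub>0 P \<Lambda>"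
proof -
  obtain ym y yp where Y: "Y = (ym, y, yp)" by (cases Y)
  obtain km k kp where K: "K = (km, k, kp)" by (cases K)
  have adj: "cinner wm ym + (cinner f y + cinner wp yp) = cinner vm km + (cinner u k + cinner vp kp)"
    if "((vm, u, vp), (wm, f, wp)) \<in> dilation_op A\<^sub>0 P \<Lambda>" for vm u vp wm f wp
    using assms that unfolding op_adjoint_def Y K by (fastforce simp: cinner_prod_def)
  have \<Lambda>0: "(0, 0) \<in> \<Lambda>"
    using csubspace_zero[OF selfadjoint_csubspace[OF \<Lambda>]] by (simp add: zero_prod_def)
  have "\<exists>d. (yp, - \<i> *\<^sub>C kp) \<in> sobolev_deriv \<and> (yp, d) \<in> sobolev_trace"
  proof (rule hp.sobolev_adjoint)
    fix v v' :: "(rplus, 'e) L2" assume v: "(v, v') \<in> sobolev_deriv" "(v, 0) \<in> sobolev_trace"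
    have "((0, S 0 + P 0, v), (\<i> *\<^sub>C 0, 0, \<i> *\<^sub>C v')) \<in> dilation_op A\<^sub>0 P \<Lambda>"
      by (rule dilation_memI[OF hm.sobolev_zero v \<Lambda>0]) (simp_all add: Ps_zero)
    from adj[OF this] show "cinner (\<i> *\<^sub>C v') yp = cinner v kp" by (simp add: S_zero P_zero)
  qed
  then obtain ep where ep: "(yp, - \<i> *\<^sub>C kp) \<in> sobolev_deriv" "(yp, ep) \<in> sobolev_trace" by blast
  have "\<exists>d. (ym, - \<i> *\<^sub>C km) \<in> sobolev_deriv \<and> (ym, d) \<in> sobolev_trace"
  proof (rule hm.sobolev_adjoint)
    fix v v' :: "(rminus, 'e) L2" assume v: "(v, v') \<in> sobolev_deriv" "(v, 0) \<in> sobolev_trace"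
    have "((v, S 0 + P 0, 0), (\<i> *\<^sub>C v', 0, \<i> *\<^sub>C 0)) \<in> dilation_op A\<^sub>0 P \<Lambda>"
      by (rule dilation_memI[OF v hp.sobolev_zero \<Lambda>0]) (simp_all add: Ps_zero)
    from adj[OF this] show "cinner (\<i> *\<^sub>C v') ym = cinner v km" by (simp add: S_zero P_zero)
  qed
  then obtain em where em: "(ym, - \<i> *\<^sub>C km) \<in> sobolev_deriv" "(ym, em) \<in> sobolev_trace" by blast
  \<comment> \<open>\<open>G\<^sub>0\<close> and \<open>G\<^sub>1\<close> solve the two boundary
    conditions for given traces ep and em; they are the expected boundary values of y.\<close>
  define r where "r = complex_of_real (1 / sqrt 2)"
  define G\<^sub>0 where "G\<^sub>0 = r *\<^sub>C (- \<i> *\<^sub>C (ep - em))"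
  define G\<^sub>1 where "G\<^sub>1 = r *\<^sub>C (ep + em)"
  have sr: "sqrt 2 *\<^sub>R (r *\<^sub>C x) = x" for x :: 'e
    by (simp add: r_def scaleR_scaleC scaleC_scaleC flip: of_real_mult)
  have rr: "r *\<^sub>C (x + x) = sqrt 2 *\<^sub>R x" for x :: 'e
  proof -
    have xx: "x + x = sqrt 2 *\<^sub>R (sqrt 2 *\<^sub>R x)" by (simp flip: scaleR_2)
    have "r *\<^sub>C (x + x) = (r * sqrt 2) *\<^sub>C (sqrt 2 *\<^sub>R x)"
      unfolding xx by (simp only: scaleR_scaleC scaleC_scaleC mult.assoc)
    also have "r * sqrt 2 = 1" by (simp add: r_def flip: of_real_mult)
    finally show ?thesis by simp
  qed
  have iG: "\<i> *\<^sub>C G\<^sub>0 = r *\<^sub>C (ep - em)"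
  proof -
    have "\<i> * (r * - \<i>) = r * (\<i> * - \<i>)" by (simp only: mult.left_commute)
    also have "\<dots> = r" by simp
    finally have "\<i> * (r * - \<i>) = r" .
    then show ?thesis by (simp only: G\<^sub>0_def scaleC_scaleC)
  qed
  have G: "G\<^sub>1 + \<i> *\<^sub>C G\<^sub>0 = sqrt 2 *\<^sub>R ep" "G\<^sub>1 - \<i> *\<^sub>C G\<^sub>0 = sqrt 2 *\<^sub>R em"
    unfolding iG G\<^sub>1_def scaleC_add_right[symmetric] scaleC_diff_right[symmetric] rr[symmetric]
    by (simp_all add: algebra_simps)
  \<comment> \<open>For arbitrary f and any pair of \<Lambda>, tents with the traces ap and am
    forced by the boundary conditions complete the middle vector to an element of the domain.
    Green's identity cancels the terms with km and kp and leaves an identity for y and k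
    alone.\<close>
  have key: "cinner f y - cinner (S f + P \<phi>) k = cinner (Ps f + \<psi>) G\<^sub>0 - cinner \<phi> G\<^sub>1"
    if \<phi>: "(\<phi>, \<psi>) \<in> \<Lambda>" for f \<phi> \<psi>
  proof -
    define ap where "ap = r *\<^sub>C (Ps f + \<psi> + \<i> *\<^sub>C \<phi>)"
    define am where "am = r *\<^sub>C (Ps f + \<psi> - \<i> *\<^sub>C \<phi>)"
    have sp: "hp.scalar_sobolev (hp.tent 1) (hp.tent' 1)" and sm: "hm.scalar_sobolev (hm.tent 1) (hm.tent' 1)"
      by (rule hp.scalar_sobolev_tent hm.scalar_sobolev_tent; simp)+
    have vp: "(hp.test (hp.tent 1) ap, ap) \<in> sobolev_trace"
      using hp.test_sobolev(2)[OF sp, of ap] by (simp add: hp.tent_zero)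
    have vm: "(hm.test (hm.tent 1) am, am) \<in> sobolev_trace"
      using hm.test_sobolev(2)[OF sm, of am] by (simp add: hm.tent_zero)
    have mem: "((hm.test (hm.tent 1) am, S f + P \<phi>, hp.test (hp.tent 1) ap),
        (\<i> *\<^sub>C hm.test (hm.tent' 1) am, f, \<i> *\<^sub>C hp.test (hp.tent' 1) ap)) \<in> dilation_op A\<^sub>0 P \<Lambda>"
      by (rule dilation_memI[OF hm.test_sobolev(1)[OF sm] vm hp.test_sobolev(1)[OF sp] vp \<phi>])
        (simp_all add: ap_def am_def sr)
    have p: "cinner (hp.test (hp.tent' 1) ap) yp = - cinner ap ep - \<i> * cinner (hp.test (hp.tent 1) ap) kp"
      using hp.sobolev_green[OF hp.test_sobolev(1)[OF sp] vp ep] by (simp add: cinner_scaleC_right eq_diff_eq)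
    have m: "cinner (hm.test (hm.tent' 1) am) ym = cinner am em - \<i> * cinner (hm.test (hm.tent 1) am) km"
      using hm.sobolev_green[OF hm.test_sobolev(1)[OF sm] vm em] by (simp add: cinner_scaleC_right eq_diff_eq)
    have "cinner f y - cinner (S f + P \<phi>) k = \<i> * cinner ap ep - \<i> * cinner am em"
      using adj[OF mem] by (simp add: cinner_scaleC_left p m algebra_simps)
    also have "\<dots> = cinner (Ps f + \<psi>) G\<^sub>0 - cinner \<phi> G\<^sub>1"
    proof -
      have "cnj r = r" by (simp add: r_def)
      then show ?thesis
        by (simp add: ap_def am_def G\<^sub>0_def G\<^sub>1_def cinner_scaleC_left cinner_scaleC_right cinner_add_left
            cinner_add_right cinner_diff_left cinner_diff_right algebra_simps)
    qed
    finally show ?thesis .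
  qed
  \<comment> \<open>The two parameters in \<open>key\<close> are separated: the pair (0, 0) with
    arbitrary f determines y, and f = 0 says that the second pair belongs to the adjoint of
    \<Lambda>.\<close>
  have y: "y = S k + P G\<^sub>0"
  proof (rule cinner_right_eqI)
    fix f show "cinner f y = cinner f (S k + P G\<^sub>0)"
      using key[OF \<Lambda>0, of f] by (simp add: P_zero cinner_S cinner_Ps cinner_add_right algebra_simps)
  qed
  have "(G\<^sub>0, G\<^sub>1 - Ps k) \<in> \<Lambda>"
  proof (rule selfadjoint_memI[OF \<Lambda>])
    fix \<phi> \<psi> assume "(\<phi>, \<psi>) \<in> \<Lambda>"
    from key[OF this, of 0] show "cinner \<psi> G\<^sub>0 = cinner \<phi> (G\<^sub>1 - Ps k)"
      by (simp add: S_zero Ps_zero cinner_P cinner_diff_right algebra_simps)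
  qed
  then have "((ym, S k + P G\<^sub>0, yp), (\<i> *\<^sub>C - \<i> *\<^sub>C km, k, \<i> *\<^sub>C - \<i> *\<^sub>C kp)) \<in> dilation_op A\<^sub>0 P \<Lambda>"
    by (rule dilation_memI[OF em ep]) (simp_all add: G)
  then show ?thesis by (simp add: Y K y scaleC_scaleC)
qed

text \<open>Used twice: applied to differences it gives single-valuedness, and applied to pairs in
  the adjoint it gives density of the domain.\<close>

lemma dilation_zero:
  assumes "(0, W) \<in> dilation_op A\<^sub>0 P \<Lambda>"
  shows "W = 0"
proof -
  from assms obtain vm vm' em vp vp' ep u f g\<^sub>0 g\<^sub>1 where v: "0 = (vm, u, vp)" "W = (\<i> *\<^sub>C vm', f, \<i> *\<^sub>C vp')"
    "(vm, vm') \<in> sobolev_deriv" "(vm, em) \<in> sobolev_trace"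
    "(vp, vp') \<in> sobolev_deriv" "(vp, ep) \<in> sobolev_trace"
    "(u, f) \<in> op_A A\<^sub>0 P" "(u, g\<^sub>0) \<in> op_\<Gamma>\<^sub>0 A\<^sub>0 P" "(u, g\<^sub>1) \<in> op_\<Gamma>\<^sub>1 A\<^sub>0 P \<Lambda>"
    "g\<^sub>1 + \<i> *\<^sub>C g\<^sub>0 = sqrt 2 *\<^sub>R ep" "g\<^sub>1 - \<i> *\<^sub>C g\<^sub>0 = sqrt 2 *\<^sub>R em" by (rule dilationE)
  have 0: "vm = 0" "u = 0" "vp = 0" using v(1) by (simp_all add: zero_prod_def)
  obtain \<psi> where "u = S f + P g\<^sub>0" using triple_cases[OF v(7-9)] .
  then have "f = 0" using decomposition_zero[of f g\<^sub>0] 0 by simp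
  moreover have "vm' = 0" "vp' = 0"
    using hm.sobolev_deriv_zero hp.sobolev_deriv_zero v(3,5) 0 by auto
  ultimately show ?thesis by (simp add: v(2) zero_prod_def)
qed

text \<open>A vector Y orthogonal to the domain yields the pair (0, Y) in the adjoint, which is the
  dilation itself, so Y = 0. Density thus follows from equality with the adjoint.\<close>

lemma selfadjoint_dilation: "selfadjoint_operator (dilation_op A\<^sub>0 P \<Lambda>)"
proof -
  let ?T = "dilation_op A\<^sub>0 P \<Lambda>"
  have adj: "op_adjoint ?T = ?T"
  proof
    show "op_adjoint ?T \<subseteq> ?T" using dilation_adjoint_subset by auto
    show "?T \<subseteq> op_adjoint ?T" using dilation_symmetric by (auto simp: op_adjoint_def)
  qed
  have sub: "csubspace ?T" using csubspace_op_adjoint[of ?T] by (simp add: adj)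
  have "single_valued ?T"
  proof (rule single_valuedI)
    fix V W W' assume "(V, W) \<in> ?T" "(V, W') \<in> ?T"
    from csubspace_graph_diff[OF sub this] show "W = W'" using dilation_zero by fastforce
  qed
  moreover have "closure (Domain ?T) = UNIV"
  proof (rule closure_eq_UNIV_if_orthogonal_trivial)
    show "csubspace (Domain ?T)" by (rule csubspace_Domain[OF sub])
    fix Y assume "\<And>V. V \<in> Domain ?T \<Longrightarrow> cinner V Y = 0"
    then have "(0, Y) \<in> op_adjoint ?T" by (auto simp: op_adjoint_def)
    then show "Y = 0" using dilation_zero adj by simp
  qed
  ultimately show ?thesis by (simp add: selfadjoint_operator_def linear_operator_def sub adj)
qed

section \<open>Compression of the resolvent and minimality\<close>

lemma dilation_resolvent_set: "Im z \<noteq> 0 \<Longrightarrow> z \<in> resolvent_set (dilation_op A\<^sub>0 P \<Lambda>)"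
  by (rule nonreal_in_resolvent_set[OF selfadjoint_dilation])

text \<open>For \<open>z\<close> in the lower half-plane \<open>x \<mapsto> exp (- \<i> z x)\<close> is not square integrable on the negative
  half-line, so the incoming component of the resolvent vanishes on \<open>embed_H h\<close> and the boundary
  condition reduces to the one that defines \<open>L\<close>.\<close>

lemma proj_dilation_resolvent_mem:
  fixes h :: 'h
  assumes z: "Im z < 0"
  defines "u \<equiv> proj_H (resolvent (dilation_op A\<^sub>0 P \<Lambda>) z (embed_H h))"
  shows "(u, h + z *\<^sub>C u) \<in> op_L A\<^sub>0 P \<Lambda>"
proof -
  define V where "V = resolvent (dilation_op A\<^sub>0 P \<Lambda>) z (embed_H h)"
  have "(V, embed_H h + z *\<^sub>C V) \<in> dilation_op A\<^sub>0 P \<Lambda>"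
    unfolding V_def by (rule resolvent_mem, rule dilation_resolvent_set) (use z in simp)
  then obtain vm vm' em vp vp' ep u' f g\<^sub>0 g\<^sub>1 where v: "V = (vm, u', vp)" "embed_H h + z *\<^sub>C V = (\<i> *\<^sub>C vm', f, \<i> *\<^sub>C vp')"
    "(vm, vm') \<in> sobolev_deriv" "(vm, em) \<in> sobolev_trace"
    "(vp, vp') \<in> sobolev_deriv" "(vp, ep) \<in> sobolev_trace"
    "(u', f) \<in> op_A A\<^sub>0 P" "(u', g\<^sub>0) \<in> op_\<Gamma>\<^sub>0 A\<^sub>0 P" "(u', g\<^sub>1) \<in> op_\<Gamma>\<^sub>1 A\<^sub>0 P \<Lambda>"
    "g\<^sub>1 + \<i> *\<^sub>C g\<^sub>0 = sqrt 2 *\<^sub>R ep" "g\<^sub>1 - \<i> *\<^sub>C g\<^sub>0 = sqrt 2 *\<^sub>R em" by (rule dilationE)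
  have eq: "z *\<^sub>C vm = \<i> *\<^sub>C vm'" "f = h + z *\<^sub>C u'"
    using v(1,2) by (simp_all add: embed_H_def scaleC_prod_def)
  have "vm' = (- \<i>) *\<^sub>C (z *\<^sub>C vm)" unfolding eq by (simp add: scaleC_scaleC)
  then have vm': "vm' = (- \<i> * z) *\<^sub>C vm" by (simp only: scaleC_scaleC)
  \<comment> \<open>Green's identity of vm with itself, with vm' = -i z vm, equates 2 Im z times the
    squared norm of vm with that of em. The left side is nonpositive and the right side nonnegative,
    so the incoming trace is 0.\<close>
  have "cinner vm' vm + cinner vm vm' = cinner em em"
    using hm.sobolev_green[OF v(3,4) v(3,4)] by simp
  then have "complex_of_real (2 * Im z * (norm vm)\<^sup>2) = complex_of_real ((norm em)\<^sup>2)"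
    unfolding vm' cinner_scaleC_left cinner_scaleC_right cinner_self
    by (simp add: complex_eq_iff flip: of_real_power)
  then have "2 * Im z * (norm vm)\<^sup>2 = (norm em)\<^sup>2" unfolding of_real_eq_iff .
  moreover have "2 * Im z * (norm vm)\<^sup>2 \<le> 0" by (rule mult_nonpos_nonneg) (use z in auto)
  ultimately have "em = 0" by simp
  then have "g\<^sub>1 = \<i> *\<^sub>C g\<^sub>0" using v(11) by simp
  then have "(u', f) \<in> op_L A\<^sub>0 P \<Lambda>" using v(7-9) by (auto simp: op_L_def)
  moreover have "u = u'" by (simp add: u_def V_def[symmetric] v(1) proj_H_def)
  ultimately show ?thesis by (simp add: eq)
qed

text \<open>The compressed resolvent of the dilation supplies a solution for every h, and
  dissipativity supplies the bound.\<close>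

lemma op_L_resolvent_set:
  assumes z: "Im z < 0"
  shows "z \<in> resolvent_set (op_L A\<^sub>0 P \<Lambda>)"
proof (rule resolvent_setI[where c="- Im z"])
  show "\<exists>u. (u, h + z *\<^sub>C u) \<in> op_L A\<^sub>0 P \<Lambda>" for h
    using proj_dilation_resolvent_mem[OF z] by blast
  show "- Im z > 0" using z by simp
  show "\<And>u f. (u, f) \<in> op_L A\<^sub>0 P \<Lambda> \<Longrightarrow> - Im z * norm u \<le> norm (f - z *\<^sub>C u)"
    by (rule op_L_lower_bound[OF _ z])
qed (rule csubspace_op_L)

lemma dilation_minimal:
  "closure (csubspace hull
    (\<Union>z\<in>{z. Im z \<noteq> 0}. resolvent (dilation_op A\<^sub>0 P \<Lambda>) z ` range embed_H)) = UNIV"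
proof (rule closure_eq_UNIV_if_orthogonal_trivial[OF csubspace_hull])
  let ?T = "dilation_op A\<^sub>0 P \<Lambda>"
  fix Y assume orth: "\<And>V. V \<in> csubspace hull (\<Union>z\<in>{z. Im z \<noteq> 0}. resolvent ?T z ` range embed_H) \<Longrightarrow> cinner V Y = 0"
  obtain ym y yp where Y: "Y = (ym, y, yp)" by (cases Y)
  have res: "\<exists>wm wm' wp wp'. y = 0 \<and> (wm, wm') \<in> sobolev_deriv \<and> (wm, 0) \<in> sobolev_trace \<and>
      (wp, wp') \<in> sobolev_deriv \<and> (wp, 0) \<in> sobolev_trace \<and>
      \<i> *\<^sub>C wm' = ym + z *\<^sub>C wm \<and> \<i> *\<^sub>C wp' = yp + z *\<^sub>C wp" if z: "Im z \<noteq> 0" for z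
  proof -
    define W where "W = resolvent ?T z Y"
    have W: "(W, Y + z *\<^sub>C W) \<in> ?T" unfolding W_def by (rule resolvent_mem[OF dilation_resolvent_set[OF z]])
    have "cinner h (proj_H W) = 0" for h
    proof -
      \<comment> \<open>The resolvents at z and \<open>cnj z\<close> are adjoint to each other, so
        orthogonality of Y to V becomes orthogonality of \<open>embed_H h\<close> to W.\<close>
      define V where "V = resolvent ?T (cnj z) (embed_H h)"
      have V: "(V, embed_H h + cnj z *\<^sub>C V) \<in> ?T"
        unfolding V_def by (rule resolvent_mem, rule dilation_resolvent_set) (use z in simp)
      have "V \<in> csubspace hull (\<Union>z\<in>{z. Im z \<noteq> 0}. resolvent ?T z ` range embed_H)"
        unfolding V_def by (rule hull_inc, rule UN_I[of "cnj z"]) (use z in auto)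
      then have "cinner V Y = 0" by (rule orth)
      with dilation_symmetric[OF V W] have "cinner (embed_H h) W = 0"
        by (simp add: cinner_add_left cinner_add_right cinner_scaleC_left cinner_scaleC_right)
      then show ?thesis by (cases W) (simp add: embed_H_def proj_H_def cinner_prod_def)
    qed
    then have projW: "proj_H W = 0" by (rule cinner_right_eq_zeroI)
    from W obtain vm vm' em vp vp' ep u f g\<^sub>0 g\<^sub>1 where v: "W = (vm, u, vp)" "Y + z *\<^sub>C W = (\<i> *\<^sub>C vm', f, \<i> *\<^sub>C vp')"
      "(vm, vm') \<in> sobolev_deriv" "(vm, em) \<in> sobolev_trace"
      "(vp, vp') \<in> sobolev_deriv" "(vp, ep) \<in> sobolev_trace"
      "(u, f) \<in> op_A A\<^sub>0 P" "(u, g\<^sub>0) \<in> op_\<Gamma>\<^sub>0 A\<^sub>0 P" "(u, g\<^sub>1) \<in> op_\<Gamma>\<^sub>1 A\<^sub>0 P \<Lambda>"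
      "g\<^sub>1 + \<i> *\<^sub>C g\<^sub>0 = sqrt 2 *\<^sub>R ep" "g\<^sub>1 - \<i> *\<^sub>C g\<^sub>0 = sqrt 2 *\<^sub>R em" by (rule dilationE)
    have u: "u = 0" using projW by (simp add: v(1) proj_H_def)
    obtain \<psi> where \<psi>: "u = S f + P g\<^sub>0" "g\<^sub>1 = Ps f + \<psi>" "(g\<^sub>0, \<psi>) \<in> \<Lambda>" using triple_cases[OF v(7-9)] .
    \<comment> \<open>A zero middle component has the zero decomposition; \<Lambda> being
      single-valued, all boundary values vanish and with them both traces.\<close>
    have f: "f = 0" "g\<^sub>0 = 0" using decomposition_zero[of f g\<^sub>0] u \<psi>(1) by auto
    have "(0, 0) \<in> \<Lambda>" using csubspace_zero[OF selfadjoint_csubspace[OF \<Lambda>]] by (simp add: zero_prod_def)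
    then have "\<psi> = 0"
      using \<psi>(3) f(2) \<Lambda> by (auto simp: selfadjoint_operator_def linear_operator_def single_valued_def)
    then have "g\<^sub>1 = 0" using \<psi>(2) f(1) by (simp add: Ps_zero)
    then have "ep = 0" "em = 0" using v(10,11) f(2) by simp_all
    moreover have "y = 0" "\<i> *\<^sub>C vm' = ym + z *\<^sub>C vm" "\<i> *\<^sub>C vp' = yp + z *\<^sub>C vp"
      using v(2) f(1) u by (simp_all add: Y v(1) scaleC_prod_def)
    ultimately show ?thesis using v(3-6) by blast
  qed
  \<comment> \<open>The middle component of the resolvent equation reads f = y + z u with f = u = 0,
    so one nonreal point settles y.\<close>
  have "y = 0" using res[of \<i>] by auto
  moreover have "yp = 0"
  proof (rule hp.zero_if_resolvents_have_trace_zero)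
    fix n :: nat assume "n > 0"
    then show "\<exists>w w'. (w, w') \<in> sobolev_deriv \<and> (w, 0) \<in> sobolev_trace \<and>
        \<i> *\<^sub>C w' = yp + (\<i> * complex_of_real (1 * real n)) *\<^sub>C w"
      using res[of "\<i> * complex_of_real (1 * real n)"] by auto
  qed
  moreover have "ym = 0"
  proof (rule hm.zero_if_resolvents_have_trace_zero)
    fix n :: nat assume "n > 0"
    then show "\<exists>w w'. (w, w') \<in> sobolev_deriv \<and> (w, 0) \<in> sobolev_trace \<and>
        \<i> *\<^sub>C w' = ym + (\<i> * complex_of_real (- 1 * real n)) *\<^sub>C w"
      using res[of "\<i> * complex_of_real (- 1 * real n)"] by auto
  qed
  ultimately show "Y = 0" by (simp add: Y zero_prod_def)
qed

end

theorem theorem3p3: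
  fixes A\<^sub>0 :: "('h::complex_hilbert \<times> 'h) set"
    and P :: "'e::complex_hilbert \<Rightarrow> 'h"
    and \<Lambda> :: "('e \<times> 'e) set"
  assumes "separable_space (euclidean :: 'h topology)"
    and "selfadjoint_operator A\<^sub>0"
    and "0 \<in> resolvent_set A\<^sub>0"
    and "bounded_clinear P"
    and "Domain A\<^sub>0 \<inter> range P = {0}"
    and "{\<phi>. P \<phi> = 0} = {0}"
    and "selfadjoint_operator \<Lambda>"
  shows "selfadjoint_operator (dilation_op A\<^sub>0 P \<Lambda>) \<and>
    (\<forall>z. Im z \<noteq> 0 \<longrightarrow> z \<in> resolvent_set (dilation_op A\<^sub>0 P \<Lambda>)) \<and>
    (\<forall>z. Im z < 0 \<longrightarrow> z \<in> resolvent_set (op_L A\<^sub>0 P \<Lambda>) \<and>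
      (\<forall>h. proj_H (resolvent (dilation_op A\<^sub>0 P \<Lambda>) z (embed_H h)) =
        resolvent (op_L A\<^sub>0 P \<Lambda>) z h)) \<and>
    closure (csubspace hull
      (\<Union>z\<in>{z. Im z \<noteq> 0}. resolvent (dilation_op A\<^sub>0 P \<Lambda>) z ` range embed_H)) = UNIV"
proof -
  interpret boundary_triple A\<^sub>0 P \<Lambda>
    by unfold_locales (fact assms)+
  show ?thesis
    using selfadjoint_dilation dilation_resolvent_set op_L_resolvent_set dilation_minimal
      resolvent_eqI[OF op_L_resolvent_set proj_dilation_resolvent_mem]
    by simp
qed

end
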